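(* Let $n\ge1$, $\alpha\in(0,1]$, and let $\{f_k\,d\gamma\}_{k\ge 1}$ be a sequence of centered probability measures on $\mathbb{R}^n$ with $\sqrt{f_k}\in W^{1,2}(\mathbb{R}^n,d\gamma)$ and $f_k\ge\alpha$ for all $k$, such that $\delta(f_k)\to 0$ as $k\to\infty$. Then there exist a subsequence $\{f_{k_j}\}\subset\{f_k\}$ and a constant $c\in[\alpha,1]$ such that $f_{k_j}\to c$ almost everywhere as $j\to\infty$.
   Context: On $\mathbb{R}^n$, $d\gamma=(2\pi)^{-n/2}e^{-|x|^2/2}dx$ is the standard Gaussian measure. For a probability measure $f\,d\gamma$ with $\sqrt f\in W^{1,2}(\mathbb{R}^n,d\gamma)$, the Fisher information is $\mathrm{I}(f)=\int \frac{|\nabla f|^2}{f}\,d\gamma$, the relative entropy is $\mathrm{H}(f)=\int f\log f\,d\gamma$, and the log-Sobolev deficit is $\delta(f)=\frac12 \mathrm{I}(f)-\mathrm{H}(f)\ge 0$. A probability measure $\mu$ is centered if $\int x\,d\mu=0$. *)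

theory Defs
  imports "HOL-Probability.Probability"
begin

definition std_gaussian :: "'a::euclidean_space measure" where
  "std_gaussian = density lborel
     (\<lambda>x. ennreal ((2 * pi) powr (- real DIM('a) / 2) * exp (- (norm x)\<^sup>2 / 2)))"

primrec Ck :: "nat \<Rightarrow> ('a::euclidean_space \<Rightarrow> real) \<Rightarrow> bool" where
  "Ck 0 \<phi> \<longleftrightarrow> continuous_on UNIV \<phi>"
| "Ck (Suc k) \<phi> \<longleftrightarrow> (\<forall>x. \<phi> differentiable (at x)) \<and>
     (\<forall>b\<in>Basis. Ck k (\<lambda>x. frechet_derivative \<phi> (at x) b))"

definition test_function :: "('a::euclidean_space \<Rightarrow> real) \<Rightarrow> bool" where
  "test_function \<phi> \<longleftrightarrow> (\<forall>k. Ck k \<phi>) \<and> compact (closure {x. \<phi> x \<noteq> 0})"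

definition locally_integrable :: "('a::euclidean_space \<Rightarrow> 'b::euclidean_space) \<Rightarrow> bool" where
  "locally_integrable u \<longleftrightarrow> (\<forall>K. compact K \<longrightarrow> set_integrable lborel K u)"

text \<open>Distributional gradient, tested against Lebesgue measure (not the Gaussian measure).\<close>

definition has_weak_gradient ::
    "('a::euclidean_space \<Rightarrow> real) \<Rightarrow> ('a \<Rightarrow> 'a) \<Rightarrow> bool" where
  "has_weak_gradient u g \<longleftrightarrow> locally_integrable u \<and> locally_integrable g \<and>
     (\<forall>\<phi>. test_function \<phi> \<longrightarrow> (\<forall>b\<in>Basis.
        (\<integral>x. u x * frechet_derivative \<phi> (at x) b \<partial>lborel) = - (\<integral>x. (g x \<bullet> b) * \<phi> x \<partial>lborel)))"

text \<open>A weak gradient is unique up to a Lebesgue-null set, so the choice below does not affect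
  integrals; the value is unspecified if there is no weak gradient.\<close>

definition weak_gradient :: "('a::euclidean_space \<Rightarrow> real) \<Rightarrow> 'a \<Rightarrow> 'a" where
  "weak_gradient u = (SOME g. has_weak_gradient u g)"

definition gaussian_W12 :: "('a::euclidean_space \<Rightarrow> real) \<Rightarrow> bool" where
  "gaussian_W12 u \<longleftrightarrow> integrable std_gaussian (\<lambda>x. (u x)\<^sup>2) \<and>
     (\<exists>g. has_weak_gradient u g \<and> integrable std_gaussian (\<lambda>x. (norm (g x))\<^sup>2))"

text \<open>The two integrals below are Bochner integrals, with value 0 on non-integrable functions.
  For a probability density \<open>f\<close> with \<open>sqrt f\<close> in the Gaussian Sobolev space both integrands are
  integrable: \<open>f\<close> has weak gradient \<open>2 sqrt f \<nabla>(sqrt f)\<close>, so the Fisher integrand is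
  \<open>4 |\<nabla>(sqrt f)|^2\<close>, and \<open>f log f\<close> is bounded below and controlled from above by the Gaussian
  logarithmic Sobolev inequality. Where \<open>f = 0\<close> the conventions \<open>0 log 0 = 0\<close> and
  \<open>0 / 0 = 0\<close> apply.\<close>

definition fisher_information :: "('a::euclidean_space \<Rightarrow> real) \<Rightarrow> real" where
  "fisher_information f = (\<integral>x. (norm (weak_gradient f x))\<^sup>2 / f x \<partial>std_gaussian)"

definition relative_entropy :: "('a::euclidean_space \<Rightarrow> real) \<Rightarrow> real" where
  "relative_entropy f = (\<integral>x. f x * ln (f x) \<partial>std_gaussian)"

definition log_sobolev_deficit :: "('a::euclidean_space \<Rightarrow> real) \<Rightarrow> real" where
  "log_sobolev_deficit f = fisher_information f / 2 - relative_entropy f"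

text \<open>Being centered includes the existence of the first moment.\<close>

definition centered :: "'a::euclidean_space measure \<Rightarrow> bool" where
  "centered M \<longleftrightarrow> has_bochner_integral M (\<lambda>x. x) 0"

end

theory Submission
  imports Defs
begin

text \<open>On the line let \<open>T = id + \<theta>\<close> be the monotone map which transports \<open>f d\<gamma>\<close>, normalized, to \<open>\<gamma>\<close>. Taking
  logarithms in \<open>f \<gamma> = m \<gamma>(T) T'\<close> and integrating by parts, the deficit of \<open>f\<close> is at least
  \<open>\<integral> f (\<theta>' - log (1 + \<theta>') + (\<theta> + (log f)')\<^sup>2 / 2) d\<gamma>\<close>. If \<open>f \<ge> \<alpha>\<close> and the deficit is small, then \<open>\<theta>\<close> is
  nearly constant and \<open>log f\<close> nearly affine in \<open>L\<^sup>1(\<gamma>)\<close>; since \<open>log f\<close> is bounded below and the mass of \<open>f\<close> is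
  bounded above, the slope is small and \<open>f\<close> is nearly constant.

  In higher dimension entropy is subadditive over the coordinates, so that the deficit bounds the mean of
  the deficits of the restrictions of \<open>f\<close> to lines parallel to the axes; these restrictions are absolutely
  continuous because \<open>sqrt f\<close> has a weak gradient. All but a small portion of the lines carry a bounded
  mass, hence \<open>1 / f\<close>, which is bounded, is close in \<open>L\<^sup>1\<close> to its averages over each coordinate and thus to a
  constant. Truncating \<open>f\<close> beforehand makes all integrals finite. A subsequence of these constants
  converges, and Jensen's inequality gives \<open>c \<le> 1\<close>.\<close>

section \<open>Primitives of locally integrable functions\<close>

text \<open>The obstacle on the line is the boundary term, Gaussian density times
  \<open>\<theta>\<close> times \<open>f\<close>, of the integration by parts: the growth of the
  transport \<open>T\<close> is not controlled by the deficit. The bound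
  \<open>f \<ge> \<alpha>\<close> controls it. The normalized measure gives every set at least a
  fixed fraction of its Gaussian mass, so the Gaussian mass beyond \<open>T R\<close> cannot be
  small, and \<open>T R\<close> is at most a constant over the square root of the density at
  \<open>R + 1\<close>. The density at \<open>R\<close> beats this, provided that \<open>f\<close>
  is bounded.

  The truncation by \<open>\<kappa>\<close> is preferred to a sharp cut-off because the reciprocal
  of the truncated root is the reciprocal of the root plus the constant \<open>1 / M\<close>. A
  limit of reciprocals of truncated densities with \<open>M\<close> tending to infinity is thus a
  limit of \<open>1 / f\<close>, and what the truncation removes needs no estimate.

  Restrictions to lines are not normalized and their masses vary. The one-dimensional estimate is
  therefore stated for masses up to a bound \<open>L\<close>; lines of larger mass are treated by
  Markov's inequality, since all lines together have mass at most 1.\<close>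

lemma local_to_global_bound:
  fixes e \<eta> :: "real \<Rightarrow> real"
  assumes "a \<le> b" "0 < d"
    and loc: "\<And>x y. a \<le> x \<Longrightarrow> x \<le> y \<Longrightarrow> y \<le> b \<Longrightarrow> y - x < d \<Longrightarrow> \<bar>e y - e x\<bar> \<le> \<eta> y - \<eta> x"
  shows "\<bar>e b - e a\<bar> \<le> \<eta> b - \<eta> a"
proof -
  obtain N :: nat where N: "(b - a) / d < real N" using reals_Archimedean2 by blast
  have "0 \<le> (b - a) / d" using assms by simp
  then have N0: "0 < real N" using N by linarith
  \<comment> \<open>The interval is cut into \<open>N\<close> equal pieces shorter than
    \<open>d\<close>, over which the local estimates add up.\<close>
  define s where "s = (b - a) / N"
  have s: "0 \<le> s" "s < d" using assms N N0 by (auto simp: s_def field_simps)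
  have "\<bar>e (a + j * s) - e a\<bar> \<le> \<eta> (a + j * s) - \<eta> a" if "j \<le> N" for j :: nat
    using that
  proof (induction j)
    case 0
    then show ?case by simp
  next
    case (Suc j)
    have "real (Suc j) * s \<le> real N * s" using Suc.prems s by (intro mult_right_mono) auto
    also have "\<dots> = b - a" using N0 by (simp add: s_def)
    finally have "\<bar>e (a + Suc j * s) - e (a + j * s)\<bar> \<le> \<eta> (a + Suc j * s) - \<eta> (a + j * s)"
      using s by (intro loc) (auto simp: algebra_simps)
    then show ?case using Suc by linarith
  qed
  from this[of N] show ?thesis using N0 by (simp add: s_def)
qed

text \<open>Local absolute continuity of \<open>f\<close> with derivative \<open>h\<close>,
  expressed by integrals alone, so that differentiability almost everywhere never has to be
  discussed.\<close>

definition primitive_of :: "(real \<Rightarrow> real) \<Rightarrow> (real \<Rightarrow> real) \<Rightarrow> bool" where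
  "primitive_of f h \<longleftrightarrow> h \<in> borel_measurable borel \<and>
     (\<forall>x y. x \<le> y \<longrightarrow> set_integrable lborel {x..y} h \<and> (LINT t:{x..y}|lborel. h t) = f y - f x)"

lemma primitive_ofD:
  assumes "primitive_of f h"
  shows "h \<in> borel_measurable borel" "set_integrable lborel {x..y} h"
    "x \<le> y \<Longrightarrow> (LINT t:{x..y}|lborel. h t) = f y - f x"
proof -
  show "h \<in> borel_measurable borel" "x \<le> y \<Longrightarrow> (LINT t:{x..y}|lborel. h t) = f y - f x"
    using assms by (auto simp: primitive_of_def)
  show "set_integrable lborel {x..y} h"
    using assms by (cases "x \<le> y") (auto simp: primitive_of_def set_integrable_def)
qed

lemma set_lborel_integral_split:
  fixes h :: "real \<Rightarrow> real"
  assumes "set_integrable lborel {a..c} h" "a \<le> b" "b \<le> c"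
  shows "(LINT t:{a..c}|lborel. h t) = (LINT t:{a..b}|lborel. h t) + (LINT t:{b..c}|lborel. h t)"
proof -
  have 1: "set_integrable lborel {a..b} h" "set_integrable lborel {b<..c} h"
    using assms by (auto intro: set_integrable_subset)
  have "{a..c} = {a..b} \<union> {b<..c}" using assms by auto
  then have "(LINT t:{a..c}|lborel. h t) = (LINT t:{a..b}|lborel. h t) + (LINT t:{b<..c}|lborel. h t)"
    using 1 by (simp add: set_integral_Un disjoint_iff)
  also have "(LINT t:{b<..c}|lborel. h t) = (LINT t:{b..c}|lborel. h t)"
    unfolding set_lebesgue_integral_def
    by (rule integral_discrete_difference[where X="{b}"]) (auto simp: indicator_def)
  finally show ?thesis .
qed

lemma primitive_of_continuous:
  assumes "primitive_of f h"
  shows "continuous_on S f"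
proof -
  have "continuous_on {a..b} f" if "a \<le> b" for a b
  proof -
    have "continuous_on {a..b} (\<lambda>y. integral {a..y} h + f a)"
      using set_borel_integral_eq_integral(1)[OF primitive_ofD(2)[OF assms]]
      by (intro continuous_intros indefinite_integral_continuous_1) auto
    then show ?thesis
    proof (rule continuous_on_eq)
      fix y assume "y \<in> {a..b}"
      then have "(LINT t:{a..y}|lborel. h t) = f y - f a" by (intro primitive_ofD[OF assms]) auto
      then show "integral {a..y} h + f a = f y"
        using set_borel_integral_eq_integral(2)[OF primitive_ofD(2)[OF assms], of a y] by simp
    qed
  qed
  then have "isCont f x" for x
    using continuous_on_interior[of "{x-1..x+1}" f x] by auto
  then show ?thesis by (simp add: continuous_at_imp_continuous_on)
qed

lemma primitive_of_continuous_deriv: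
  assumes "\<And>x. (p has_real_derivative p' x) (at x)" "continuous_on UNIV p'"
  shows "primitive_of p p'"
  unfolding primitive_of_def
proof (intro conjI allI impI)
  show "p' \<in> borel_measurable borel" using assms(2) by (rule borel_measurable_continuous_onI)
  fix x y :: real assume "x \<le> y"
  show "set_integrable lborel {x..y} p'"
    using assms(2) continuous_on_subset unfolding set_integrable_def
    by (intro borel_integrable_compact) auto
  show "(LINT t:{x..y}|lborel. p' t) = p y - p x"
    unfolding set_lebesgue_integral_def real_scaleR_def
    using integral_FTC_Icc_real[OF \<open>x \<le> y\<close>, of p p'] assms(1) assms(2)
    by (simp add: mult.commute continuous_on_eq_continuous_at)
qed

lemma primitive_of_add:
  assumes "primitive_of f h" "primitive_of f' h'"
  shows "primitive_of (\<lambda>x. f x + f' x) (\<lambda>x. h x + h' x)"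
  using assms by (auto simp: primitive_of_def)

lemma primitive_of_cmult:
  assumes "primitive_of f h"
  shows "primitive_of (\<lambda>x. c * f x) (\<lambda>x. c * h x)"
  using assms by (auto simp: primitive_of_def simp flip: right_diff_distrib)

lemma set_integrable_continuous_mult:
  fixes h \<psi> :: "real \<Rightarrow> real"
  assumes "continuous_on UNIV \<psi>" "set_integrable lborel {a..b} h"
  shows "set_integrable lborel {a..b} (\<lambda>t. \<psi> t * h t)"
proof -
  have "compact (\<psi> ` {a..b})"
    using assms(1) continuous_on_subset by (intro compact_continuous_image) auto
  then obtain B where B: "\<And>t. t \<in> {a..b} \<Longrightarrow> \<bar>\<psi> t\<bar> \<le> B"
    using compact_imp_bounded bounded_real by (metis imageI)
  have [measurable]: "\<psi> \<in> borel_measurable borel"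
    using assms(1) by (rule borel_measurable_continuous_onI)
  have "integrable lborel (\<lambda>t. \<psi> t * (indicator {a..b} t * h t))"
  proof (rule Bochner_Integration.integrable_bound)
    show "integrable lborel (\<lambda>t. B * (indicator {a..b} t * h t))"
      using assms(2) by (intro integrable_mult_right) (simp add: set_integrable_def)
    show "(\<lambda>t. \<psi> t * (indicator {a..b} t * h t)) \<in> borel_measurable lborel"
      using borel_measurable_integrable[OF assms(2)[unfolded set_integrable_def]]
      by (intro borel_measurable_times[of \<psi>]) auto
    have "\<bar>\<psi> t\<bar> * \<bar>h t\<bar> \<le> \<bar>B\<bar> * \<bar>h t\<bar>" if "t \<in> {a..b}" for t
      using B[OF that] by (intro mult_right_mono) auto
    then show "AE t in lborel. norm (\<psi> t * (indicator {a..b} t * h t)) \<le> norm (B * (indicator {a..b} t * h t))"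
      by (auto simp: abs_mult indicator_def)
  qed
  then show ?thesis by (simp add: set_integrable_def mult.left_commute)
qed

text \<open>The intermediate value given by the mean value theorem is attained by the continuous
  \<open>f\<close> between \<open>x\<close> and \<open>y\<close>. The derivative of
  \<open>\<Phi>\<close> is thus taken at a point \<open>f z\<close> of the path itself, where
  uniform continuity of \<open>\<Phi>' \<circ> f\<close> applies.\<close>

lemma mean_value_on_path:
  fixes f :: "real \<Rightarrow> real"
  assumes f: "continuous_on UNIV f" and "x \<le> y" and "range f \<subseteq> S" "is_interval S"
    and D: "\<And>s. s \<in> S \<Longrightarrow> (\<Phi> has_real_derivative \<Phi>' s) (at s)"
  obtains z where "x \<le> z" "z \<le> y" "\<Phi> (f y) - \<Phi> (f x) = \<Phi>' (f z) * (f y - f x)"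
proof -
  have S: "s \<in> S" if "f u \<le> s" "s \<le> f v" for s u v
    using that assms(3,4) by (metis is_interval_1 rangeI subsetD)
  have fc: "continuous_on {x..y} f" using f continuous_on_subset by blast
  consider "f x = f y" | "f x < f y" | "f y < f x" by linarith
  then show thesis
  proof cases
    case 1
    then show thesis using that[of x] \<open>x \<le> y\<close> by simp
  next
    case 2
    obtain s where s: "f x < s" "s < f y" "\<Phi> (f y) - \<Phi> (f x) = (f y - f x) * \<Phi>' s"
      using MVT2[OF 2, of \<Phi> \<Phi>'] D S by blast
    obtain z where "x \<le> z" "z \<le> y" "f z = s"
      using IVT'[OF _ _ \<open>x \<le> y\<close> fc, of s] s by auto
    then show thesis using that[of z] s by simp
  next
    case 3
    obtain s where s: "f y < s" "s < f x" "\<Phi> (f x) - \<Phi> (f y) = (f x - f y) * \<Phi>' s"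
      using MVT2[OF 3, of \<Phi> \<Phi>'] D S by blast
    obtain z where "x \<le> z" "z \<le> y" "f z = s"
      using IVT2'[OF _ _ \<open>x \<le> y\<close> fc, of s] s by auto
    then show thesis using that[of z] s by (simp add: algebra_simps)
  qed
qed

text \<open>Let \<open>e\<close> be the difference between \<open>\<Phi> (f y)\<close> and the
  integral of the claimed derivative. On a short interval the mean value theorem replaces
  \<open>\<Phi>'\<close> by one of its values on the path, so the increment of \<open>e\<close> is
  at most \<open>\<epsilon>\<close> times that of the integral \<open>H\<close> of
  \<open>\<bar>h\<bar>\<close>. Adding up over short intervals and letting \<open>\<epsilon>\<close>
  tend to 0 shows that \<open>e\<close> is constant.\<close>

lemma primitive_of_chain:
  assumes fh: "primitive_of f h" and "range f \<subseteq> S" "is_interval S"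
    and D: "\<And>s. s \<in> S \<Longrightarrow> (\<Phi> has_real_derivative \<Phi>' s) (at s)"
    and C: "continuous_on S \<Phi>'"
  shows "primitive_of (\<lambda>x. \<Phi> (f x)) (\<lambda>x. \<Phi>' (f x) * h x)"
  unfolding primitive_of_def
proof (intro conjI allI impI)
  note fc = primitive_of_continuous[OF fh]
  have \<psi>c: "continuous_on UNIV (\<lambda>x. \<Phi>' (f x))"
    using C fc assms(2) by (intro continuous_on_compose2[of S \<Phi>' UNIV f]) auto
  note [measurable] = primitive_ofD(1)[OF fh] borel_measurable_continuous_onI[OF \<psi>c]
  show "(\<lambda>x. \<Phi>' (f x) * h x) \<in> borel_measurable borel" by measurable
  have int: "set_integrable lborel {x..y} (\<lambda>x. \<Phi>' (f x) * h x)" for x y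
    by (intro set_integrable_continuous_mult[OF \<psi>c] primitive_ofD(2)[OF fh])
  then show "set_integrable lborel {x..y} (\<lambda>x. \<Phi>' (f x) * h x)" for x y .
  fix a b :: real assume "a \<le> b"
  define e where "e y = \<Phi> (f y) - (LINT t:{a..y}|lborel. \<Phi>' (f t) * h t)" for y
  define H where "H y = (LINT t:{a..y}|lborel. \<bar>h t\<bar>)" for y
  have hi: "set_integrable lborel {x..y} (\<lambda>t. \<bar>h t\<bar>)" for x y
    using set_integrable_abs[OF primitive_ofD(2)[OF fh]] .
  have H0: "H a = 0" "(LINT t:{a..a}|lborel. \<Phi>' (f t) * h t) = 0"
    by (auto simp: H_def set_lebesgue_integral_def indicator_def intro!: integral_eq_zero_AE AE_I[where N="{a}"])
  have bd: "\<bar>e b - e a\<bar> \<le> \<epsilon> * H b" if "\<epsilon> > 0" for \<epsilon>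
  proof -
    have "uniformly_continuous_on {a..b} (\<lambda>x. \<Phi>' (f x))"
      using \<psi>c continuous_on_subset by (intro compact_uniformly_continuous) auto
    then obtain d where d: "d > 0"
      "\<And>s t. s \<in> {a..b} \<Longrightarrow> t \<in> {a..b} \<Longrightarrow> \<bar>s - t\<bar> < d \<Longrightarrow> \<bar>\<Phi>' (f s) - \<Phi>' (f t)\<bar> < \<epsilon>"
      using \<open>\<epsilon> > 0\<close> unfolding uniformly_continuous_on_def dist_real_def by meson
    have "\<bar>e b - e a\<bar> \<le> \<epsilon> * H b - \<epsilon> * H a"
    proof (rule local_to_global_bound[OF \<open>a \<le> b\<close> d(1)])
      fix x y assume xy: "a \<le> x" "x \<le> y" "y \<le> b" "y - x < d"
      obtain z where z: "x \<le> z" "z \<le> y" "\<Phi> (f y) - \<Phi> (f x) = \<Phi>' (f z) * (f y - f x)"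
        using mean_value_on_path[OF fc xy(2) assms(2,3) D] by blast
      have "e y - e x = \<Phi>' (f z) * (LINT t:{x..y}|lborel. h t) - (LINT t:{x..y}|lborel. \<Phi>' (f t) * h t)"
        using set_lborel_integral_split[OF int xy(1,2)] z(3) primitive_ofD(3)[OF fh xy(2)]
        by (simp add: e_def)
      also have "\<dots> = (LINT t:{x..y}|lborel. \<Phi>' (f z) * h t - \<Phi>' (f t) * h t)"
        using int primitive_ofD(2)[OF fh] by (subst set_integral_diff) auto
      also have "\<bar>\<dots>\<bar> \<le> (LINT t:{x..y}|lborel. \<bar>\<Phi>' (f z) * h t - \<Phi>' (f t) * h t\<bar>)"
        unfolding set_lebesgue_integral_def
        by (rule order_trans[OF integral_abs_bound]) (simp add: abs_mult)
      also have "\<dots> \<le> (LINT t:{x..y}|lborel. \<epsilon> * \<bar>h t\<bar>)"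
      proof (rule set_integral_mono)
        show "set_integrable lborel {x..y} (\<lambda>t. \<bar>\<Phi>' (f z) * h t - \<Phi>' (f t) * h t\<bar>)"
          using int primitive_ofD(2)[OF fh] by (intro set_integrable_abs set_integral_diff) auto
        show "set_integrable lborel {x..y} (\<lambda>t. \<epsilon> * \<bar>h t\<bar>)" using hi by auto
        fix t assume "t \<in> {x..y}"
        then have "\<bar>\<Phi>' (f z) - \<Phi>' (f t)\<bar> \<le> \<epsilon>" using xy z by (intro less_imp_le d) auto
        then have "\<bar>\<Phi>' (f z) - \<Phi>' (f t)\<bar> * \<bar>h t\<bar> \<le> \<epsilon> * \<bar>h t\<bar>" by (rule mult_right_mono) simp
        then show "\<bar>\<Phi>' (f z) * h t - \<Phi>' (f t) * h t\<bar> \<le> \<epsilon> * \<bar>h t\<bar>"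
          by (simp add: abs_mult[symmetric] left_diff_distrib)
      qed
      also have "\<dots> = \<epsilon> * H y - \<epsilon> * H x"
        using set_lborel_integral_split[OF hi xy(1,2)] by (simp add: H_def algebra_simps)
      finally show "\<bar>e y - e x\<bar> \<le> \<epsilon> * H y - \<epsilon> * H x" .
    qed
    then show ?thesis using H0 by simp
  qed
  have "\<bar>e b - e a\<bar> \<le> 0"
  proof (rule field_le_epsilon)
    fix \<epsilon> :: real assume "\<epsilon> > 0"
    have "0 \<le> H b" unfolding H_def set_lebesgue_integral_def by (intro integral_nonneg_AE) auto
    have "\<bar>e b - e a\<bar> \<le> \<epsilon> / (H b + 1) * H b" using \<open>0 \<le> H b\<close> \<open>\<epsilon> > 0\<close> by (intro bd) auto
    also have "\<dots> \<le> \<epsilon>" using \<open>0 \<le> H b\<close> \<open>\<epsilon> > 0\<close> by (simp add: field_simps)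
    finally show "\<bar>e b - e a\<bar> \<le> 0 + \<epsilon>" by simp
  qed
  then show "(LINT t:{a..b}|lborel. \<Phi>' (f t) * h t) = \<Phi> (f b) - \<Phi> (f a)"
    using H0 by (simp add: e_def)
qed

lemma primitive_of_power2:
  assumes "primitive_of f h"
  shows "primitive_of (\<lambda>x. (f x)\<^sup>2) (\<lambda>x. 2 * f x * h x)"
  by (rule primitive_of_chain[OF assms, of UNIV "\<lambda>s. s\<^sup>2" "\<lambda>s. 2 * s"])
     (auto intro!: derivative_eq_intros continuous_intros)

text \<open>Polarization: a product is half of a difference of squares, so the chain rule for the
  square suffices.\<close>

lemma primitive_of_mult:
  assumes "primitive_of f h" "primitive_of p q"
  shows "primitive_of (\<lambda>x. p x * f x) (\<lambda>x. q x * f x + p x * h x)"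
proof -
  note * = primitive_of_cmult[OF primitive_of_power2, of _ _ "1/2"]
  note ** = primitive_of_cmult[OF primitive_of_power2, of _ _ "-1/2"]
  have "primitive_of (\<lambda>x. 1/2 * (p x + f x)\<^sup>2 + (-1/2 * (p x)\<^sup>2 + -1/2 * (f x)\<^sup>2))
    (\<lambda>x. 1/2 * (2 * (p x + f x) * (q x + h x)) + (-1/2 * (2 * p x * q x) + -1/2 * (2 * f x * h x)))"
    by (intro primitive_of_add[OF * primitive_of_add[OF ** **]] primitive_of_add assms)
  moreover have "(\<lambda>x. 1/2 * (p x + f x)\<^sup>2 + (-1/2 * (p x)\<^sup>2 + -1/2 * (f x)\<^sup>2)) = (\<lambda>x. p x * f x)"
    by (auto simp: fun_eq_iff power2_eq_square field_simps)
  moreover have "(\<lambda>x. 1/2 * (2 * (p x + f x) * (q x + h x)) + (-1/2 * (2 * p x * q x) + -1/2 * (2 * f x * h x)))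
      = (\<lambda>x. q x * f x + p x * h x)"
    by (auto simp: fun_eq_iff field_simps)
  ultimately show ?thesis by metis
qed

section \<open>Monotone transport on the line\<close>

lemma primitive_of_DERIV:
  assumes fh: "primitive_of f h" and h: "continuous_on UNIV h"
  shows "(f has_real_derivative h x) (at x)"
proof -
  have "((\<lambda>y. integral {x-1..y} h) has_real_derivative h x) (at x within {x-1..x+1})"
    using h continuous_on_subset by (intro integral_has_real_derivative) auto
  then have D: "((\<lambda>y. integral {x-1..y} h + f (x-1)) has_real_derivative h x) (at x within {x-1..x+1})"
    by (auto intro!: derivative_eq_intros)
  have eq: "integral {x-1..y} h + f (x-1) = f y" if "y \<in> {x-1..x+1}" for y
  proof -
    have "(LINT t:{x-1..y}|lborel. h t) = f y - f (x-1)" using that by (intro primitive_ofD[OF fh]) auto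
    then show ?thesis
      using set_borel_integral_eq_integral(2)[OF primitive_ofD(2)[OF fh], of "x-1" y] by simp
  qed
  have "(f has_real_derivative h x) (at x within {x-1..x+1})"
    by (rule has_field_derivative_transform_within[where d=1, OF D _ _ eq]) auto
  moreover have "x \<in> interior {x-1..x+1}" by simp
  ultimately show ?thesis by (simp only: at_within_interior)
qed

section \<open>Continuous positive probability densities and their distribution functions\<close>

abbreviation lborel_density :: "(real \<Rightarrow> real) \<Rightarrow> real measure" where
  "lborel_density q \<equiv> density lborel (\<lambda>x. ennreal (q x))"

context
  fixes q :: "real \<Rightarrow> real"
  assumes q: "continuous_on UNIV q" and q0: "\<And>x. 0 < q x" and prob: "prob_space (lborel_density q)"
begin

interpretation Q: prob_space "lborel_density q" by (rule prob)

interpretation Q: real_distribution "lborel_density q"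
  by (simp add: real_distribution_def prob real_distribution_axioms_def)

lemma continuous_density_measurable[measurable]: "q \<in> borel_measurable borel"
  using q by (rule borel_measurable_continuous_onI)

lemma continuous_density_integrable: "integrable lborel q"
proof (rule integrableI_nonneg)
  have "(\<integral>\<^sup>+ x. ennreal (q x) \<partial>lborel) = emeasure (lborel_density q) UNIV"
    by (subst emeasure_density) auto
  also have "\<dots> = 1" using Q.emeasure_space_1 by simp
  finally show "(\<integral>\<^sup>+ x. ennreal (q x) \<partial>lborel) < \<infinity>" by simp
qed (use q0 in \<open>auto intro: less_imp_le\<close>)

lemma continuous_density_measure:
  assumes [measurable]: "A \<in> sets borel"
  shows "measure (lborel_density q) A = (\<integral>x. q x * indicator A x \<partial>lborel)"
proof -
  have "measure (lborel_density q) A = (\<integral>x. indicator A x \<partial>lborel_density q)"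
    by simp
  also have "\<dots> = (\<integral>x. q x * indicator A x \<partial>lborel)"
    using q0 by (subst integral_real_density) (auto intro: less_imp_le)
  finally show ?thesis .
qed

lemma continuous_density_cdf_primitive: "primitive_of (cdf (lborel_density q)) q"
  unfolding primitive_of_def
proof (intro conjI allI impI)
  fix x y :: real assume "x \<le> y"
  show "set_integrable lborel {x..y} q"
    using continuous_density_integrable unfolding set_integrable_def by (intro integrable_mult_indicator) auto
  have "cdf (lborel_density q) y - cdf (lborel_density q) x
      = (\<integral>t. q t * indicator {x<..y} t \<partial>lborel)"
  proof (cases "x = y")
    case False
    then show ?thesis using Q.cdf_diff_eq[of x y] \<open>x \<le> y\<close>
      by (subst continuous_density_measure[symmetric]) auto
  qed simp
  also have "\<dots> = (LINT t:{x..y}|lborel. q t)"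
    unfolding set_lebesgue_integral_def
    by (rule integral_discrete_difference[where X="{x}"]) (auto simp: indicator_def)
  finally show "(LINT t:{x..y}|lborel. q t) = cdf (lborel_density q) y - cdf (lborel_density q) x" ..
qed auto

lemma continuous_density_cdf_DERIV: "(cdf (lborel_density q) has_real_derivative q x) (at x)"
  by (rule primitive_of_DERIV[OF continuous_density_cdf_primitive q])

lemma continuous_density_cdf_strict_mono: "x < y \<Longrightarrow> cdf (lborel_density q) x < cdf (lborel_density q) y"
  by (rule DERIV_pos_imp_increasing) (blast intro: continuous_density_cdf_DERIV q0)+

lemma continuous_density_cdf_pos: "0 < cdf (lborel_density q) x"
  using continuous_density_cdf_strict_mono[of "x - 1" x] Q.cdf_nonneg[of "x - 1"] by linarith

lemma continuous_density_cdf_less_1: "cdf (lborel_density q) x < 1"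
  using continuous_density_cdf_strict_mono[of x "x + 1"] Q.cdf_bounded_prob[of "x + 1"] by linarith

lemma continuous_density_cdf_surj:
  assumes "0 < c" "c < 1"
  shows "\<exists>x. cdf (lborel_density q) x = c"
proof -
  let ?F = "cdf (lborel_density q)"
  have "eventually (\<lambda>x. ?F x < c) at_bot" using order_tendstoD(2)[OF Q.cdf_lim_at_bot assms(1)] .
  then obtain a where a: "\<And>x. x \<le> a \<Longrightarrow> ?F x < c" by (auto simp: eventually_at_bot_linorder)
  have "eventually (\<lambda>x. c < ?F x) at_top" using order_tendstoD(1)[OF Q.cdf_lim_at_top_prob assms(2)] .
  then obtain b where b: "\<And>x. b \<le> x \<Longrightarrow> c < ?F x" by (auto simp: eventually_at_top_linorder)
  have "\<exists>x. min a b \<le> x \<and> x \<le> max a b \<and> ?F x = c"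
    using a[of "min a b"] b[of "max a b"] primitive_of_continuous[OF continuous_density_cdf_primitive]
    by (intro IVT') auto
  then show ?thesis by blast
qed

end

declare continuous_density_measurable [measurable del]

text \<open>\<open>T\<close> is the quantile function of \<open>r\<close> composed with the
  distribution function of \<open>q\<close>. Since both densities are continuous and positive, both
  distribution functions are continuously differentiable bijections onto the open unit interval, and
  the change of variables formula holds at every point.\<close>

lemma monotone_transport:
  fixes q r :: "real \<Rightarrow> real"
  assumes q: "continuous_on UNIV q" "\<And>x. 0 < q x" "prob_space (lborel_density q)"
    and r: "continuous_on UNIV r" "\<And>x. 0 < r x" "prob_space (lborel_density r)"
  obtains T where
    "\<And>x. cdf (lborel_density r) (T x) = cdf (lborel_density q) x"
    "\<And>x. (T has_real_derivative q x / r (T x)) (at x)"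
proof -
  let ?F = "cdf (lborel_density q)" and ?G = "cdf (lborel_density r)"
  have "\<exists>y. ?G y = ?F x" for x
    by (intro continuous_density_cdf_surj[OF r] continuous_density_cdf_pos[OF q] continuous_density_cdf_less_1[OF q])
  then obtain T where T: "\<And>x. ?G (T x) = ?F x" by metis
  have inj: "y = z" if "?G y = ?G z" for y z
    using that continuous_density_cdf_strict_mono[OF r, of y z] continuous_density_cdf_strict_mono[OF r, of z y]
    by (cases y z rule: linorder_cases) simp_all
  define S where "S c = (SOME y. ?G y = c)" for c
  have SG: "S (?G y) = y" for y
    unfolding S_def by (rule some_equality) (auto intro: inj)
  have GS: "?G (S c) = c" if "0 < c" "c < 1" for c
    unfolding S_def using continuous_density_cdf_surj[OF r that] by (rule someI_ex)
  have TS: "T x = S (?F x)" for x using SG[of "T x"] T by simp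
  have "(T has_real_derivative q x / r (T x)) (at x)" for x
  proof -
    have "isCont S (?G (T x))"
      by (rule isCont_inverse_function[of 1])
         (simp_all add: SG DERIV_isCont[OF continuous_density_cdf_DERIV[OF r]])
    then have "(S has_real_derivative inverse (r (S (?F x)))) (at (?F x))"
      using less_imp_neq[OF r(2)[of "S (?F x)"]] T[of x]
      by (intro DERIV_inverse_function[where f="?G" and a=0 and b=1] continuous_density_cdf_DERIV[OF r]
            continuous_density_cdf_pos[OF q] continuous_density_cdf_less_1[OF q] GS) simp_all
    then have "((\<lambda>x. S (?F x)) has_real_derivative inverse (r (S (?F x))) * q x) (at x)"
      by (rule DERIV_chain2[OF _ continuous_density_cdf_DERIV[OF q]])
    then show ?thesis unfolding TS[symmetric] by (simp add: field_simps)
  qed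
  then show thesis using that T by blast
qed

section \<open>The standard Gaussian measure on the line\<close>

abbreviation gauss1 :: "real measure" where
  "gauss1 \<equiv> lborel_density std_normal_density"

lemma std_normal_density_pos [simp]: "0 < std_normal_density x"
  by (rule normal_density_pos) simp

lemma continuous_std_normal_density: "continuous_on S std_normal_density"
  unfolding std_normal_density_def by (intro continuous_intros) auto

lemma DERIV_std_normal_density: "(std_normal_density has_real_derivative - x * std_normal_density x) (at x)"
proof -
  have "((\<lambda>x. c * exp (- x\<^sup>2 / 2)) has_real_derivative - x * (c * exp (- x\<^sup>2 / 2))) (at x)" for c :: real
    by (auto intro!: derivative_eq_intros)
  from this[of "1 / sqrt (2 * pi)"] show ?thesis
    unfolding std_normal_density_def[abs_def] .
qed

lemma prob_space_gauss1: "prob_space gauss1"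
  by (rule prob_space_normal_density) simp

interpretation gauss1: prob_space gauss1 by (rule prob_space_gauss1)

lemma gauss1_integral:
  fixes g :: "real \<Rightarrow> real"
  assumes "g \<in> borel_measurable borel"
  shows "(\<integral>x. g x \<partial>gauss1) = (\<integral>x. std_normal_density x * g x \<partial>lborel)"
    "integrable gauss1 g \<longleftrightarrow> integrable lborel (\<lambda>x. std_normal_density x * g x)"
  using assms by (subst integral_density integrable_density; simp)+

lemma gauss1_nn_integral:
  assumes "g \<in> borel_measurable borel"
  shows "(\<integral>\<^sup>+x. g x \<partial>gauss1) = (\<integral>\<^sup>+x. ennreal (std_normal_density x) * g x \<partial>lborel)"
  using assms by (subst nn_integral_density; simp)

lemma gauss1_second_moment: "integrable gauss1 (\<lambda>x. x\<^sup>2)" "(\<integral>x. x\<^sup>2 \<partial>gauss1) = 1"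
proof -
  have "has_bochner_integral lborel (\<lambda>x. std_normal_density x * x\<^sup>2) 1"
    using std_normal_moment_even[of 1] by (simp add: fact_numeral)
  then show "integrable gauss1 (\<lambda>x. x\<^sup>2)" "(\<integral>x. x\<^sup>2 \<partial>gauss1) = 1"
    using gauss1_integral[of "\<lambda>x. x\<^sup>2"] by (auto simp: has_bochner_integral_iff)
qed

text \<open>Chebyshev's inequality with second moment 1. This crude tail bound is enough to limit
  the growth of the transport map.\<close>

lemma gauss1_measure_le:
  assumes [measurable]: "A \<in> sets borel" and "0 < y" "\<And>x. x \<in> A \<Longrightarrow> y \<le> \<bar>x\<bar>"
  shows "measure gauss1 A \<le> 1 / y\<^sup>2"
proof -
  have "measure gauss1 A = (\<integral>x. indicator A x \<partial>gauss1)" by simp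
  also have "\<dots> \<le> (\<integral>x. x\<^sup>2 / y\<^sup>2 \<partial>gauss1)"
  proof (rule integral_mono)
    show "integrable gauss1 (\<lambda>x. x\<^sup>2 / y\<^sup>2)" using gauss1_second_moment by simp
    fix x :: real
    have "x \<in> A \<Longrightarrow> y\<^sup>2 \<le> x\<^sup>2" using assms(2) assms(3)[of x] by (simp add: abs_le_square_iff[symmetric])
    then show "indicator A x \<le> x\<^sup>2 / y\<^sup>2" using assms(2) by (auto simp: indicator_def field_simps)
  qed (auto intro: gauss1.integrable_const_bound[where B=1])
  also have "\<dots> = 1 / y\<^sup>2" using gauss1_second_moment by simp
  finally show ?thesis .
qed

text \<open>The set contains a unit interval on which the density is at least its value at
  \<open>y\<close>. This accounts for the shifts \<open>R + 1\<close> below.\<close>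

lemma gauss1_measure_ge:
  assumes [measurable]: "A \<in> sets borel" and "{u<..u+1} \<subseteq> A" "\<And>x. x \<in> {u<..u+1} \<Longrightarrow> \<bar>x\<bar> \<le> y"
  shows "std_normal_density y \<le> measure gauss1 A"
proof -
  have "std_normal_density y = (\<integral>x. std_normal_density y * indicator {u<..u+1} x \<partial>lborel)" by simp
  also have "\<dots> \<le> (\<integral>x. std_normal_density x * indicator A x \<partial>lborel)"
  proof (rule integral_mono)
    show "integrable lborel (\<lambda>x. std_normal_density x * indicator A x)"
      using integrable_mult_indicator[of A lborel std_normal_density] by (simp add: mult.commute)
    fix x
    have "x \<in> {u<..u+1} \<Longrightarrow> std_normal_density y \<le> std_normal_density x"
      using assms(3)[of x] by (auto simp: std_normal_density_def abs_le_square_iff[symmetric] divide_right_mono)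
    then show "std_normal_density y * indicator {u<..u+1} x \<le> std_normal_density x * indicator A x"
      using assms(2) by (auto simp: indicator_def less_imp_le)
  qed simp
  also have "\<dots> = measure gauss1 A"
    by (rule continuous_density_measure[symmetric]) (auto intro: continuous_std_normal_density prob_space_gauss1)
  finally show ?thesis .
qed

section \<open>The logarithmic Sobolev inequality on the line\<close>

lemma std_normal_density_nonzero [simp]: "std_normal_density x \<noteq> 0"
  using std_normal_density_pos[of x] by linarith

text \<open>This quotient is, up to a constant, the bound for the boundary terms: the transport map
  contributes the denominator and the Gaussian weight the numerator. The exponents
  \<open>R\<^sup>2 / 2\<close> and \<open>(R + 1)\<^sup>2 / 4\<close> leave a Gaussian decay, of
  which only \<open>exp (- R)\<close> is kept.\<close>

lemma std_normal_density_ratio_tendsto: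
  "(\<lambda>n. std_normal_density (real n) / sqrt (std_normal_density (real n + 1))) \<longlonglongrightarrow> 0"
proof (rule real_tendsto_sandwich[OF _ _ tendsto_const])
  show "\<forall>\<^sub>F n in sequentially. 0 \<le> std_normal_density (real n) / sqrt (std_normal_density (real n + 1))"
    by (intro always_eventually allI divide_nonneg_nonneg real_sqrt_ge_zero less_imp_le[OF std_normal_density_pos])
  define c where "c = 1 / sqrt (2 * pi)"
  have c: "0 < c" by (simp add: c_def)
  have "std_normal_density x / sqrt (std_normal_density (x + 1)) \<le> sqrt c * exp (5/2) * exp (-x)" for x :: real
  proof -
    have "sqrt (exp (- (x+1)\<^sup>2 / 2)) = exp (- (x+1)\<^sup>2 / 4)"
      by (rule real_sqrt_unique) (simp_all add: power2_eq_square exp_add[symmetric])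
    then have "sqrt (std_normal_density (x + 1)) = sqrt c * exp (- (x+1)\<^sup>2 / 4)"
      unfolding std_normal_density_def c_def[symmetric] by (simp add: real_sqrt_mult)
    then have "std_normal_density x / sqrt (std_normal_density (x + 1))
        = (c / sqrt c) * (exp (- x\<^sup>2 / 2) / exp (- (x+1)\<^sup>2 / 4))"
      unfolding std_normal_density_def c_def[symmetric] by simp
    also have "c / sqrt c = sqrt c" using c by (simp add: real_div_sqrt)
    also have "exp (- x\<^sup>2 / 2) / exp (- (x+1)\<^sup>2 / 4) = exp (- x\<^sup>2 / 2 + (x+1)\<^sup>2 / 4)"
      by (simp add: exp_diff[symmetric])
    \<comment> \<open>The difference of the two exponents is
      \<open>(x - 3)\<^sup>2 / 4\<close>.\<close>
    also have "\<dots> \<le> exp (5/2 + - x)"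
    proof -
      have "0 \<le> (x - 3)\<^sup>2" by simp
      then show ?thesis by (simp add: power2_eq_square field_simps)
    qed
    also have "\<dots> = exp (5/2) * exp (-x)" by (rule exp_add)
    finally show ?thesis using c by (simp add: mult.assoc)
  qed
  then show "\<forall>\<^sub>F n in sequentially. std_normal_density (real n) / sqrt (std_normal_density (real n + 1))
      \<le> sqrt c * exp (5/2) * exp (- real n)" by auto
  have "(\<lambda>n. exp (- real n)) \<longlonglongrightarrow> 0"
    by (rule filterlim_compose[OF exp_at_bot])
       (simp add: filterlim_uminus_at_bot filterlim_real_sequentially)
  then show "(\<lambda>n. sqrt c * exp (5/2) * exp (- real n)) \<longlonglongrightarrow> 0"
    by (rule tendsto_mult_right_zero)
qed

lemma gauss1_integrable_bounded:
  fixes g :: "real \<Rightarrow> real"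
  assumes "g \<in> borel_measurable borel" "\<And>x. \<bar>g x\<bar> \<le> B"
  shows "integrable gauss1 g"
  using assms by (intro gauss1.integrable_const_bound[where B=B]) auto

text \<open>Since \<open>f\<close> need not have mass 1, the relevant quantity is \<open>m\<close>
  times the entropy of the probability density \<open>f / m\<close>.\<close>

lemma gauss1_entropy_identity:
  fixes f :: "real \<Rightarrow> real"
  assumes [measurable]: "f \<in> borel_measurable borel" and \<alpha>: "0 < \<alpha>"
    and f: "\<And>x. \<alpha> \<le> f x" "\<And>x. f x \<le> M" and m: "m = (\<integral>x. f x \<partial>gauss1)"
  shows "integrable gauss1 f" "\<alpha> \<le> m" "integrable gauss1 (\<lambda>x. f x * ln (f x))"
    "integrable gauss1 (\<lambda>x. f x * ln (f x / m))"
    "(\<integral>x. f x * ln (f x / m) \<partial>gauss1) = (\<integral>x. f x * ln (f x) \<partial>gauss1) - m * ln m"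
proof -
  have "\<bar>f x\<bar> \<le> M" for x using f[of x] \<alpha> by linarith
  then show i: "integrable gauss1 f" by (intro gauss1_integrable_bounded[of _ M]) auto
  have "(\<integral>x. \<alpha> \<partial>gauss1) \<le> m" unfolding m using f by (intro integral_mono i) auto
  then show am: "\<alpha> \<le> m" using gauss1.prob_space by simp
  show i2: "integrable gauss1 (\<lambda>x. f x * ln (f x))"
  proof (rule gauss1_integrable_bounded)
    show "\<bar>f x * ln (f x)\<bar> \<le> M * (\<bar>ln \<alpha>\<bar> + \<bar>ln M\<bar>)" for x
    proof -
      have "ln \<alpha> \<le> ln (f x)" "ln (f x) \<le> ln M" using f[of x] \<alpha> by (auto intro!: ln_mono)
      then have "\<bar>ln (f x)\<bar> \<le> \<bar>ln \<alpha>\<bar> + \<bar>ln M\<bar>" by linarith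
      then show ?thesis using f[of x] \<alpha> by (simp add: abs_mult mult_mono)
    qed
  qed measurable
  have eq: "f x * ln (f x / m) = f x * ln (f x) - ln m * f x" for x
    using am \<alpha> f[of x] by (simp add: ln_div algebra_simps)
  show "integrable gauss1 (\<lambda>x. f x * ln (f x / m))" unfolding eq using i i2 by auto
  show "(\<integral>x. f x * ln (f x / m) \<partial>gauss1) = (\<integral>x. f x * ln (f x) \<partial>gauss1) - m * ln m"
    unfolding eq using i i2 by (simp add: m)
qed

lemma ln_std_normal_density_ratio:
  "ln (std_normal_density y / std_normal_density x) = x\<^sup>2 / 2 - y\<^sup>2 / 2"
proof -
  have "std_normal_density y / std_normal_density x = exp (- y\<^sup>2 / 2) / exp (- x\<^sup>2 / 2)"
    by (simp add: std_normal_density_def)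
  then show ?thesis by (simp add: exp_diff[symmetric])
qed

text \<open>The nonnegative integrand \<open>K\<close>, weighted by the Gaussian density, equals the
  integrand \<open>gl\<close> of the deficit plus the derivative of \<open>P * f\<close>, where
  \<open>P\<close> is \<open>\<theta>\<close> times the density. Integrated over
  \<open>{-n..n}\<close>, this yields the deficit up to boundary terms. These are bounded from one
  side only, by quantities \<open>\<beta> n\<close> tending to 0, whence an inequality. The left
  side is a \<open>nn_integral\<close>, so integrability is part of what is obtained.\<close>

lemma gaussian_transport_deficit:
  fixes f h :: "real \<Rightarrow> real"
  assumes fh: "primitive_of f h" and \<alpha>: "0 < \<alpha>"
    and f: "\<And>x. \<alpha> \<le> f x" "\<And>x. f x \<le> M"
    and J: "integrable gauss1 (\<lambda>x. (h x)\<^sup>2 / f x)"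
    and m: "m = (\<integral>x. f x \<partial>gauss1)"
    and d: "d = (\<integral>x. (h x)\<^sup>2 / f x \<partial>gauss1) / 2 - ((\<integral>x. f x * ln (f x) \<partial>gauss1) - m * ln m)"
  obtains \<theta> \<theta>' where "\<And>x. (\<theta> has_real_derivative \<theta>' x) (at x)" "continuous_on UNIV \<theta>'" "\<And>x. -1 < \<theta>' x"
    "0 \<le> d"
    "(\<integral>\<^sup>+x. ennreal (f x * (\<theta>' x - ln (1 + \<theta>' x)) + f x * (\<theta> x + h x / f x)\<^sup>2 / 2) \<partial>gauss1) \<le> ennreal d"
proof -
  note fc = primitive_of_continuous[OF fh]
  note [measurable] = primitive_ofD(1)[OF fh] borel_measurable_continuous_onI[OF fc]
  have fpos: "0 < f x" for x using f(1)[of x] \<alpha> by linarith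
  have M: "0 < M" using fpos[of 0] f(2)[of 0] by linarith
  note ent = gauss1_entropy_identity[OF _ \<alpha> f m, simplified]
  have mpos: "0 < m" using ent(2) \<alpha> by linarith
  let ?\<gamma> = std_normal_density
  define q where "q x = ?\<gamma> x * f x / m" for x
  have qc: "continuous_on UNIV q"
    unfolding q_def using fc mpos by (intro continuous_intros continuous_std_normal_density) auto
  have qpos: "0 < q x" for x using fpos mpos by (simp add: q_def)
  have [measurable]: "q \<in> borel_measurable borel" using qc by (rule borel_measurable_continuous_onI)
  have qi: "integrable lborel q" "(\<integral>x. q x \<partial>lborel) = 1"
    using ent(1) m mpos by (auto simp: gauss1_integral q_def[abs_def])
  have qprob: "prob_space (lborel_density q)"
  proof (rule prob_spaceI)
    have "(\<integral>\<^sup>+x. ennreal (q x) \<partial>lborel) = ennreal 1"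
      using qi qpos by (subst nn_integral_eq_integral) (auto intro: less_imp_le)
    then show "emeasure (lborel_density q) (space (lborel_density q)) = 1"
      by (subst emeasure_density) auto
  qed
  interpret Q: prob_space "lborel_density q" by (rule qprob)
  obtain T where T: "\<And>x. cdf gauss1 (T x) = cdf (lborel_density q) x"
      and T': "\<And>x. (T has_real_derivative q x / ?\<gamma> (T x)) (at x)"
    using monotone_transport[OF qc qpos qprob continuous_std_normal_density std_normal_density_pos prob_space_gauss1]
    by blast
  \<comment> \<open>The density \<open>q\<close> is at least \<open>\<alpha> / m\<close> times the
    Gaussian one. This is what keeps the transport from moving points too far out.\<close>
  have QN: "\<alpha> / m * measure gauss1 A \<le> measure (lborel_density q) A"
    if [measurable]: "A \<in> sets borel" for A
  proof -
    have i: "integrable lborel (\<lambda>x. ?\<gamma> x * indicator A x)" "integrable lborel (\<lambda>x. q x * indicator A x)"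
      using integrable_mult_indicator[of A lborel ?\<gamma>] integrable_mult_indicator[of A lborel q] qi(1)
      by (simp_all add: mult.commute)
    have "\<alpha> / m * measure gauss1 A = (\<integral>x. \<alpha> / m * (?\<gamma> x * indicator A x) \<partial>lborel)"
      using continuous_density_measure[OF continuous_std_normal_density std_normal_density_pos prob_space_gauss1 that]
      by simp
    also have "\<dots> \<le> (\<integral>x. q x * indicator A x \<partial>lborel)"
    proof (rule integral_mono)
      show "\<alpha> / m * (?\<gamma> x * indicator A x) \<le> q x * indicator A x" for x
        using f(1)[of x] mpos less_imp_le[OF std_normal_density_pos[of x]]
        by (auto simp: q_def indicator_def divide_right_mono mult.commute mult_right_mono)
    qed (use i in auto)
    also have "\<dots> = measure (lborel_density q) A"
      by (rule continuous_density_measure[OF qc qpos qprob that, symmetric])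
    finally show ?thesis .
  qed
  define \<theta> where "\<theta> x = T x - x" for x
  define \<theta>' where "\<theta>' x = q x / ?\<gamma> (T x) - 1" for x
  have D\<theta>: "(\<theta> has_real_derivative \<theta>' x) (at x)" for x
    unfolding \<theta>_def[abs_def] \<theta>'_def using T' by (intro derivative_intros)
  have Tc: "continuous_on UNIV T" using T' DERIV_isCont by (metis continuous_at_imp_continuous_on)
  have \<theta>c: "continuous_on UNIV \<theta>" unfolding \<theta>_def[abs_def] by (intro continuous_intros Tc)
  have \<theta>'c: "continuous_on UNIV \<theta>'"
    unfolding \<theta>'_def[abs_def] using less_imp_neq[OF std_normal_density_pos]
    by (intro continuous_intros qc continuous_on_compose2[OF continuous_std_normal_density[of UNIV] Tc]) auto
  have \<theta>'1: "-1 < \<theta>' x" for x using qpos by (simp add: \<theta>'_def)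
  note [measurable] = borel_measurable_continuous_onI[OF \<theta>c] borel_measurable_continuous_onI[OF \<theta>'c]

  \<comment> \<open>If the Gaussian mass beyond \<open>y\<close> is at least
    \<open>\<alpha> / m\<close> times the density at \<open>R + 1\<close>, Chebyshev's inequality
    bounds \<open>y\<^sup>2\<close> by the reciprocal of that number; \<open>\<beta> R\<close> is
    the resulting bound for the boundary term. It is used with \<open>y = T R\<close> on the right
    and \<open>y = - T (- R)\<close> on the left, and for \<open>y \<le> 0\<close> there is nothing
    to prove.\<close>
  define \<beta> where "\<beta> R = M * sqrt (m / \<alpha>) * (?\<gamma> R / sqrt (?\<gamma> (R + 1)))" for R
  have key: "?\<gamma> R * y * f x \<le> \<beta> R"
    if "0 < y \<Longrightarrow> \<alpha> / m * ?\<gamma> (R + 1) \<le> 1 / y\<^sup>2" for y R x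
  proof (cases "0 < y")
    case False
    then have "?\<gamma> R * y * f x \<le> 0" using fpos[of x] std_normal_density_pos[of R]
      by (meson less_imp_le linorder_not_less mult_nonneg_nonpos mult_nonpos_nonneg)
    also have "0 \<le> \<beta> R" unfolding \<beta>_def using M mpos \<alpha> less_imp_le[OF std_normal_density_pos] by auto
    finally show ?thesis .
  next
    case True
    have "y\<^sup>2 \<le> m / \<alpha> / ?\<gamma> (R + 1)"
      using that[OF True] True mpos \<alpha> std_normal_density_pos[of "R + 1"] by (simp add: field_simps)
    then have "y \<le> sqrt (m / \<alpha>) / sqrt (?\<gamma> (R + 1))"
      using real_le_rsqrt by (simp flip: real_sqrt_divide)
    then have "?\<gamma> R * y * f x \<le> ?\<gamma> R * (sqrt (m / \<alpha>) / sqrt (?\<gamma> (R + 1))) * M"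
      using f(2)[of x] fpos[of x] True less_imp_le[OF std_normal_density_pos] M mpos \<alpha>
      by (intro mult_mono mult_nonneg_nonneg) auto
    then show ?thesis by (simp add: \<beta>_def mult_ac)
  qed
  have up: "?\<gamma> R * \<theta> R * f R \<le> \<beta> R" if "0 \<le> R" for R
  proof -
    have "\<alpha> / m * ?\<gamma> (R + 1) \<le> 1 / (T R)\<^sup>2" if "0 < T R"
    proof -
      have "\<alpha> / m * ?\<gamma> (R + 1) \<le> \<alpha> / m * measure gauss1 {R<..}"
        using \<alpha> mpos \<open>0 \<le> R\<close> by (intro mult_left_mono gauss1_measure_ge[of _ R]) auto
      also have "\<dots> \<le> measure (lborel_density q) {R<..}" by (rule QN) simp
      also have "\<dots> = 1 - cdf (lborel_density q) R"
        using Q.prob_compl[of "{..R}"] by (simp add: cdf_def Compl_eq_Diff_UNIV[symmetric])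
      also have "\<dots> = measure gauss1 {T R<..}"
        using gauss1.prob_compl[of "{..T R}"] T[of R] by (simp add: cdf_def Compl_eq_Diff_UNIV[symmetric])
      also have "\<dots> \<le> 1 / (T R)\<^sup>2" using that by (intro gauss1_measure_le) auto
      finally show ?thesis .
    qed
    then have "?\<gamma> R * T R * f R \<le> \<beta> R" by (rule key)
    moreover have "?\<gamma> R * \<theta> R * f R \<le> ?\<gamma> R * T R * f R"
      using fpos[of R] \<open>0 \<le> R\<close> less_imp_le[OF std_normal_density_pos]
      by (intro mult_right_mono mult_left_mono) (auto simp: \<theta>_def)
    ultimately show ?thesis by linarith
  qed
  have lo: "- (?\<gamma> (-R) * \<theta> (-R) * f (-R)) \<le> \<beta> R" if "0 \<le> R" for R
  proof -
    have "\<alpha> / m * ?\<gamma> (R + 1) \<le> 1 / (- T (- R))\<^sup>2" if "0 < - T (- R)"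
    proof -
      have "\<alpha> / m * ?\<gamma> (R + 1) \<le> \<alpha> / m * measure gauss1 {..-R}"
        using \<alpha> mpos \<open>0 \<le> R\<close> by (intro mult_left_mono gauss1_measure_ge[of _ "- R - 1"]) auto
      also have "\<dots> \<le> measure (lborel_density q) {..-R}" by (rule QN) simp
      also have "\<dots> = measure gauss1 {..T (- R)}" using T[of "- R"] by (simp add: cdf_def)
      also have "\<dots> \<le> 1 / (- T (- R))\<^sup>2" using that by (intro gauss1_measure_le) auto
      finally show ?thesis .
    qed
    then have "?\<gamma> R * (- T (- R)) * f (- R) \<le> \<beta> R" by (rule key)
    moreover have "?\<gamma> R * (- \<theta> (- R)) * f (- R) \<le> ?\<gamma> R * (- T (- R)) * f (- R)"
      using fpos[of "- R"] \<open>0 \<le> R\<close> less_imp_le[OF std_normal_density_pos]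
      by (intro mult_right_mono mult_left_mono) (auto simp: \<theta>_def)
    ultimately show ?thesis by (simp add: std_normal_density_def)
  qed
  have \<beta>0: "(\<lambda>n. 2 * \<beta> (real n)) \<longlonglongrightarrow> 0"
    unfolding \<beta>_def using std_normal_density_ratio_tendsto by (intro tendsto_mult_right_zero)

  define gl where "gl x = ?\<gamma> x * ((h x)\<^sup>2 / f x / 2 - f x * ln (f x / m))" for x
  define P where "P x = ?\<gamma> x * \<theta> x" for x
  define P' where "P' x = - x * ?\<gamma> x * \<theta> x + ?\<gamma> x * \<theta>' x" for x
  define K where "K x = f x * (\<theta>' x - ln (1 + \<theta>' x)) + f x * (\<theta> x + h x / f x)\<^sup>2 / 2" for x
  have K0: "0 \<le> K x" for x
    using fpos[of x] ln_add_one_self_le_self2[OF \<theta>'1[of x]] by (auto simp: K_def intro!: add_nonneg_nonneg mult_nonneg_nonneg)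
  have [measurable]: "K \<in> borel_measurable borel" unfolding K_def[abs_def] by measurable
  have gl: "integrable lborel gl" "(\<integral>x. gl x \<partial>lborel) = d"
  proof -
    have *: "(\<lambda>x. (h x)\<^sup>2 / f x / 2 - f x * ln (f x / m)) \<in> borel_measurable borel" by measurable
    have "integrable gauss1 (\<lambda>x. (h x)\<^sup>2 / f x / 2 - f x * ln (f x / m))"
      by (intro Bochner_Integration.integrable_diff integrable_divide J ent(4))
    then show "integrable lborel gl" unfolding gl_def gauss1_integral(2)[OF *] .
    have "(\<integral>x. gl x \<partial>lborel) = (\<integral>x. (h x)\<^sup>2 / f x / 2 - f x * ln (f x / m) \<partial>gauss1)"
      unfolding gl_def gauss1_integral(1)[OF *] ..
    also have "\<dots> = d"
      unfolding d ent(5)[symmetric] integral_divide_zero[of _ _ 2, symmetric]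
      by (rule Bochner_Integration.integral_diff[OF integrable_divide[OF J, of 2] ent(4)])
    finally show "(\<integral>x. gl x \<partial>lborel) = d" .
  qed
  have PP: "primitive_of (\<lambda>x. P x * f x) (\<lambda>x. P' x * f x + P x * h x)"
  proof (rule primitive_of_mult[OF fh primitive_of_continuous_deriv])
    show "(P has_real_derivative P' x) (at x)" for x
      unfolding P_def[abs_def] P'_def by (auto intro!: derivative_eq_intros DERIV_std_normal_density D\<theta>)
    show "continuous_on UNIV P'"
      unfolding P'_def[abs_def] by (intro continuous_intros \<theta>c \<theta>'c continuous_std_normal_density)
  qed
  \<comment> \<open>The logarithm of the quotient of Gaussian densities produces
    \<open>x * \<theta> x\<close> and \<open>(\<theta> x)\<^sup>2 / 2\<close>. The former cancels
    against the derivative of the density in \<open>P'\<close>; the latter, the cross term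
    \<open>\<theta> x * h x\<close> from \<open>P * h\<close> and the Fisher integrand form the
    square.\<close>
  have Keq: "?\<gamma> x * K x = gl x + (P' x * f x + P x * h x)" for x
  proof -
    have "ln (f x / m) = ln ((1 + \<theta>' x) * (?\<gamma> (T x) / ?\<gamma> x))"
      by (simp add: \<theta>'_def q_def)
    also have "\<dots> = ln (1 + \<theta>' x) + (x\<^sup>2 / 2 - (T x)\<^sup>2 / 2)"
      using \<theta>'1[of x] by (subst ln_mult) (auto simp: ln_std_normal_density_ratio)
    also have "x\<^sup>2 / 2 - (T x)\<^sup>2 / 2 = - x * \<theta> x - (\<theta> x)\<^sup>2 / 2"
      by (simp add: \<theta>_def power2_eq_square field_simps)
    finally have L: "ln (f x / m) = ln (1 + \<theta>' x) + (- x * \<theta> x - (\<theta> x)\<^sup>2 / 2)" .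
    show ?thesis
      unfolding K_def gl_def P_def P'_def L using fpos[of x]
      by (simp add: power2_eq_square field_simps)
  qed
  define I where "I n = (LINT x:{-real n..real n}|lborel. gl x)" for n
  have I: "I \<longlonglongrightarrow> d"
    unfolding I_def set_lebesgue_integral_def gl(2)[symmetric]
  proof (rule integral_dominated_convergence[where w="\<lambda>x. \<bar>gl x\<bar>"])
    show "AE x in lborel. (\<lambda>n. indicat_real {- real n..real n} x *\<^sub>R gl x) \<longlonglongrightarrow> gl x"
    proof (intro AE_I2 tendsto_eventually)
      fix x :: real
      obtain N :: nat where "\<bar>x\<bar> \<le> real N" using real_arch_simple by blast
      then show "\<forall>\<^sub>F n in sequentially. indicat_real {- real n..real n} x *\<^sub>R gl x = gl x"
        by (intro eventually_sequentiallyI[of N]) (auto simp: indicator_def)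
    qed
  qed (use gl in \<open>auto simp: indicator_def\<close>)
  \<comment> \<open>Nonnegativity is recorded as well, because \<open>ennreal\<close> sends negative
    numbers to 0 and would hide the sign of the limit \<open>d\<close>.\<close>
  have bound: "0 \<le> I n + 2 * \<beta> n \<and>
      (\<integral>\<^sup>+x. ennreal (?\<gamma> x * K x) * indicator {-real n..real n} x \<partial>lborel) \<le> ennreal (I n + 2 * \<beta> n)" for n
  proof -
    have s: "set_integrable lborel {-real n..real n} gl"
      unfolding set_integrable_def by (intro integrable_mult_indicator gl) auto
    note s' = primitive_ofD(2)[OF PP, of "-real n" "real n"]
    have K: "set_integrable lborel {-real n..real n} (\<lambda>x. ?\<gamma> x * K x)"
      unfolding Keq by (intro set_integral_add s s')
    have "(LINT x:{-real n..real n}|lborel. ?\<gamma> x * K x) = I n + (P n * f n - P (- n) * f (- n))"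
      unfolding Keq I_def using set_integral_add(2)[OF s s'] primitive_ofD(3)[OF PP, of "-real n" "real n"] by simp
    also have "\<dots> \<le> I n + 2 * \<beta> n" using up[of "real n"] lo[of "real n"] by (simp add: P_def)
    finally have le: "(LINT x:{-real n..real n}|lborel. ?\<gamma> x * K x) \<le> I n + 2 * \<beta> n" .
    have nn: "0 \<le> indicator {-real n..real n} x *\<^sub>R (?\<gamma> x * K x)" for x
      using K0[of x] less_imp_le[OF std_normal_density_pos[of x]] by auto
    have "(\<integral>\<^sup>+x. ennreal (?\<gamma> x * K x) * indicator {-real n..real n} x \<partial>lborel)
        = (\<integral>\<^sup>+x. ennreal (indicator {-real n..real n} x *\<^sub>R (?\<gamma> x * K x)) \<partial>lborel)"
      by (intro nn_integral_cong) (auto simp: indicator_def)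
    also have "\<dots> = ennreal (LINT x:{-real n..real n}|lborel. ?\<gamma> x * K x)"
      unfolding set_lebesgue_integral_def
      using K nn by (intro nn_integral_eq_integral) (auto simp: set_integrable_def)
    also have "\<dots> \<le> ennreal (I n + 2 * \<beta> n)" using le by (rule ennreal_leI)
    finally have 1: "(\<integral>\<^sup>+x. ennreal (?\<gamma> x * K x) * indicator {-real n..real n} x \<partial>lborel) \<le> ennreal (I n + 2 * \<beta> n)" .
    have 2: "0 \<le> (LINT x:{-real n..real n}|lborel. ?\<gamma> x * K x)"
      unfolding set_lebesgue_integral_def using nn by (intro integral_nonneg_AE) auto
    from order_trans[OF 2 le] 1 show ?thesis by (rule conjI)
  qed
  have lim: "(\<lambda>n. I n + 2 * \<beta> n) \<longlonglongrightarrow> d" using tendsto_add[OF I \<beta>0] by simp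
  have "0 \<le> d" using bound by (intro LIMSEQ_le_const[OF lim]) auto
  moreover have "(\<integral>\<^sup>+x. ennreal (K x) \<partial>gauss1) \<le> ennreal d"
  proof -
    have "(\<integral>\<^sup>+x. ennreal (K x) \<partial>gauss1) = (\<integral>\<^sup>+x. ennreal (?\<gamma> x * K x) \<partial>lborel)"
      by (subst gauss1_nn_integral) (auto simp: ennreal_mult less_imp_le K0 cong: nn_integral_cong)
    also have "\<dots> = (\<integral>\<^sup>+x. (SUP n::nat. ennreal (?\<gamma> x * K x) * indicator {-real n..real n} x) \<partial>lborel)"
    proof (rule nn_integral_cong)
      fix x :: real
      obtain N :: nat where "\<bar>x\<bar> \<le> real N" using real_arch_simple by blast
      then have "ennreal (?\<gamma> x * K x) \<le> (SUP n::nat. ennreal (?\<gamma> x * K x) * indicator {-real n..real n} x)"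
        by (intro SUP_upper2[of N]) (auto simp: indicator_def)
      moreover have "(SUP n::nat. ennreal (?\<gamma> x * K x) * indicator {-real n..real n} x) \<le> ennreal (?\<gamma> x * K x)"
        by (intro SUP_least) (auto simp: indicator_def)
      ultimately show "ennreal (?\<gamma> x * K x) = (SUP n::nat. ennreal (?\<gamma> x * K x) * indicator {-real n..real n} x)"
        by (rule antisym)
    qed
    also have "\<dots> = (SUP n::nat. \<integral>\<^sup>+x. ennreal (?\<gamma> x * K x) * indicator {-real n..real n} x \<partial>lborel)"
      by (intro nn_integral_monotone_convergence_SUP) (auto simp: incseq_def le_fun_def indicator_def)
    also have "\<dots> \<le> ennreal d"
    proof (rule SUP_least)
      fix n :: nat
      show "(\<integral>\<^sup>+x. ennreal (?\<gamma> x * K x) * indicator {-real n..real n} x \<partial>lborel) \<le> ennreal d"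
      \<comment> \<open>The numbers \<open>I k + 2 * \<beta> k\<close> need not be monotone; only
        the integrals of \<open>K\<close> over growing intervals are. The integral over the fixed
        interval is therefore compared with the bounds of all larger ones.\<close>
      proof (rule LIMSEQ_le_const[OF tendsto_ennrealI[OF lim]], intro exI allI impI)
        fix k assume "n \<le> k"
        then have "(\<integral>\<^sup>+x. ennreal (?\<gamma> x * K x) * indicator {-real n..real n} x \<partial>lborel)
            \<le> (\<integral>\<^sup>+x. ennreal (?\<gamma> x * K x) * indicator {-real k..real k} x \<partial>lborel)"
          by (intro nn_integral_mono) (auto simp: indicator_def)
        then show "(\<integral>\<^sup>+x. ennreal (?\<gamma> x * K x) * indicator {-real n..real n} x \<partial>lborel) \<le> ennreal (I k + 2 * \<beta> k)"
          using bound[of k] by (meson order_trans)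
      qed
    qed
    finally show ?thesis .
  qed
  ultimately show thesis using that[OF D\<theta> \<theta>'c \<theta>'1] by (simp add: K_def)
qed

section \<open>Stability on the line\<close>

text \<open>The function \<open>s - ln (1 + s)\<close> is convex, quadratic near 0 and linear at
  infinity, so it controls \<open>\<bar>s\<bar>\<close> only up to an additive loss. The two halves
  of the estimate are the tangent lines of the logarithm at \<open>1 + \<epsilon>\<close> and
  \<open>1 - \<epsilon>\<close>.\<close>

lemma abs_le_minus_ln:
  fixes s \<epsilon> :: real
  assumes "-1 < s" "0 < \<epsilon>" "\<epsilon> < 1"
  shows "\<bar>s\<bar> \<le> \<epsilon> + 2 / \<epsilon> * (s - ln (1 + s))"
proof -
  have "ln ((1 + s) / (1 + \<epsilon>)) \<le> (1 + s) / (1 + \<epsilon>) - 1" using assms by (intro ln_le_minus_one) auto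
  moreover have "ln (1 + \<epsilon>) \<le> \<epsilon>" using assms by (intro ln_add_one_self_le_self2) auto
  ultimately have "(1 + s) * (1 - 1 / (1 + \<epsilon>)) - \<epsilon> \<le> s - ln (1 + s)"
    using assms by (simp add: ln_div algebra_simps)
  then have "(1 + \<epsilon>) * ((1 + s) * (1 - 1 / (1 + \<epsilon>)) - \<epsilon>) \<le> (1 + \<epsilon>) * (s - ln (1 + s))"
    using assms by (intro mult_left_mono) auto
  moreover have "(1 + \<epsilon>) * ((1 + s) * (1 - 1 / (1 + \<epsilon>)) - \<epsilon>) = \<epsilon> * (s - \<epsilon>)"
    using assms by (simp add: field_simps)
  ultimately have 1: "\<epsilon> * (s - \<epsilon>) \<le> (1 + \<epsilon>) * (s - ln (1 + s))" by simp
  have "ln ((1 + s) / (1 - \<epsilon>)) \<le> (1 + s) / (1 - \<epsilon>) - 1" using assms by (intro ln_le_minus_one) auto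
  moreover have "ln (1 - \<epsilon>) \<le> - \<epsilon>" using ln_add_one_self_le_self2[of "- \<epsilon>"] assms by simp
  ultimately have "(1 + s) * (1 - 1 / (1 - \<epsilon>)) + \<epsilon> \<le> s - ln (1 + s)"
    using assms by (simp add: ln_div algebra_simps)
  then have "(1 - \<epsilon>) * ((1 + s) * (1 - 1 / (1 - \<epsilon>)) + \<epsilon>) \<le> (1 - \<epsilon>) * (s - ln (1 + s))"
    using assms by (intro mult_left_mono) auto
  moreover have "(1 - \<epsilon>) * ((1 + s) * (1 - 1 / (1 - \<epsilon>)) + \<epsilon>) = \<epsilon> * (- s - \<epsilon>)"
    using assms by (simp add: field_simps)
  ultimately have 2: "\<epsilon> * (- s - \<epsilon>) \<le> (1 - \<epsilon>) * (s - ln (1 + s))" by simp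
  have 0: "0 \<le> s - ln (1 + s)" using ln_add_one_self_le_self2[OF assms(1)] by simp
  have "(1 + \<epsilon>) * (s - ln (1 + s)) \<le> 2 * (s - ln (1 + s))" "(1 - \<epsilon>) * (s - ln (1 + s)) \<le> 2 * (s - ln (1 + s))"
    using assms by (intro mult_right_mono[OF _ 0]; simp)+
  then have "\<epsilon> * (\<bar>s\<bar> - \<epsilon>) \<le> 2 * (s - ln (1 + s))" using 1 2 by (cases "0 \<le> s") auto
  then show ?thesis using assms by (simp add: field_simps)
qed

lemma abs_le_square:
  fixes z \<epsilon> :: real
  assumes "0 < \<epsilon>"
  shows "\<bar>z\<bar> \<le> \<epsilon> + z\<^sup>2 / \<epsilon>"
proof -
  have "0 \<le> (\<bar>z\<bar> - \<epsilon>)\<^sup>2" "0 \<le> \<bar>z\<bar> * \<epsilon>" using assms by auto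
  moreover have "(\<bar>z\<bar> - \<epsilon>)\<^sup>2 = z\<^sup>2 - 2 * (\<bar>z\<bar> * \<epsilon>) + \<epsilon>\<^sup>2" by (simp add: power2_diff)
  ultimately have "\<bar>z\<bar> * \<epsilon> \<le> \<epsilon>\<^sup>2 + z\<^sup>2" by linarith
  then show ?thesis using assms by (simp add: field_simps power2_eq_square)
qed

lemma nn_integral_shifted_std_normal: "(\<integral>\<^sup>+x. ennreal (std_normal_density (x - y)) \<partial>lborel) = 1"
proof -
  interpret prob_space "density lborel (\<lambda>x. ennreal (normal_density y 1 x))"
    by (rule prob_space_normal_density) simp
  have "(\<integral>\<^sup>+x. ennreal (normal_density y 1 x) \<partial>lborel) = 1"
    using emeasure_space_1 by (subst (asm) emeasure_density) auto
  then show ?thesis by (simp add: normal_density_def)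
qed

text \<open>Write \<open>v x - v 0\<close> as an integral of \<open>v'\<close> with the kernel
  \<open>k\<close> of the segment from 0 to \<open>x\<close>, and exchange the integrals. It remains
  to bound the Gaussian mass beyond \<open>y\<close> by a multiple of the density at
  \<open>y\<close>. For \<open>y\<close> between 0 and \<open>x\<close> one has
  \<open>x\<^sup>2 \<ge> y\<^sup>2 + (x - y)\<^sup>2\<close>, so the density at \<open>x\<close> is
  at most \<open>sqrt (2 * pi)\<close> times the product of those at \<open>y\<close> and
  \<open>x - y\<close>, and \<open>sqrt (2 * pi) \<le> 3\<close>.\<close>

lemma gauss1_L1_poincare:
  assumes v: "primitive_of v v'"
  shows "(\<integral>\<^sup>+x. ennreal \<bar>v x - v 0\<bar> \<partial>gauss1) \<le> 3 * (\<integral>\<^sup>+x. ennreal \<bar>v' x\<bar> \<partial>gauss1)"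
proof -
  let ?\<gamma> = std_normal_density
  note [measurable] = primitive_ofD(1)[OF v] borel_measurable_continuous_onI[OF primitive_of_continuous[OF v]]
  define k :: "real \<Rightarrow> real \<Rightarrow> ennreal" where "k x y = (if 0 \<le> y \<and> y \<le> x \<or> x \<le> y \<and> y \<le> 0 then 1 else 0)" for x y
  have [measurable]: "case_prod k \<in> borel_measurable (borel \<Otimes>\<^sub>M borel)" unfolding k_def by measurable
  have set: "ennreal \<bar>v y - v x\<bar> \<le> (\<integral>\<^sup>+t. ennreal \<bar>v' t\<bar> * indicator {x..y} t \<partial>lborel)" if "x \<le> y" for x y
  proof -
    have "\<bar>v y - v x\<bar> \<le> (\<integral>t. \<bar>indicator {x..y} t *\<^sub>R v' t\<bar> \<partial>lborel)"
      unfolding primitive_ofD(3)[OF v that, symmetric] set_lebesgue_integral_def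
      by (rule integral_abs_bound)
    then have "ennreal \<bar>v y - v x\<bar> \<le> ennreal (\<integral>t. \<bar>indicator {x..y} t *\<^sub>R v' t\<bar> \<partial>lborel)" by (rule ennreal_leI)
    also have "\<dots> = (\<integral>\<^sup>+t. ennreal \<bar>indicator {x..y} t *\<^sub>R v' t\<bar> \<partial>lborel)"
      using primitive_ofD(2)[OF v, of x y] unfolding set_integrable_def
      by (intro nn_integral_eq_integral[symmetric]) auto
    also have "\<dots> = (\<integral>\<^sup>+t. ennreal \<bar>v' t\<bar> * indicator {x..y} t \<partial>lborel)"
      by (intro nn_integral_cong) (auto simp: indicator_def)
    finally show ?thesis .
  qed
  have bd: "ennreal \<bar>v x - v 0\<bar> \<le> (\<integral>\<^sup>+y. ennreal \<bar>v' y\<bar> * k x y \<partial>lborel)" for x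
  proof (cases "0 \<le> x")
    case True
    have "(\<integral>\<^sup>+t. ennreal \<bar>v' t\<bar> * indicator {0..x} t \<partial>lborel) \<le> (\<integral>\<^sup>+y. ennreal \<bar>v' y\<bar> * k x y \<partial>lborel)"
      by (intro nn_integral_mono) (auto simp: k_def indicator_def)
    then show ?thesis using set[OF True] by simp
  next
    case False
    have "(\<integral>\<^sup>+t. ennreal \<bar>v' t\<bar> * indicator {x..0} t \<partial>lborel) \<le> (\<integral>\<^sup>+y. ennreal \<bar>v' y\<bar> * k x y \<partial>lborel)"
      by (intro nn_integral_mono) (auto simp: k_def indicator_def)
    then show ?thesis using set[of x 0] False by (simp add: abs_minus_commute)
  qed
  have ker: "(\<integral>\<^sup>+x. ennreal (?\<gamma> x) * k x y \<partial>lborel) \<le> 3 * ennreal (?\<gamma> y)" for y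
  proof -
    have p: "sqrt (2 * pi) \<le> 3" using pi_less_4 by (intro real_le_lsqrt) auto
    have "ennreal (?\<gamma> x) * k x y \<le> ennreal (3 * ?\<gamma> y) * ennreal (?\<gamma> (x - y))" for x
    proof (cases "0 \<le> y \<and> y \<le> x \<or> x \<le> y \<and> y \<le> 0")
      case True
      then have "0 \<le> y * (x - y)" by (auto simp: zero_le_mult_iff)
      then have "- x\<^sup>2 / 2 \<le> - y\<^sup>2 / 2 + - (x - y)\<^sup>2 / 2"
        by (simp add: power2_eq_square algebra_simps)
      then have "exp (- x\<^sup>2 / 2) \<le> exp (- y\<^sup>2 / 2) * exp (- (x - y)\<^sup>2 / 2)" by (simp flip: exp_add)
      then have "?\<gamma> x \<le> sqrt (2 * pi) * ?\<gamma> y * ?\<gamma> (x - y)"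
        unfolding std_normal_density_def by (simp add: field_simps)
      also have "\<dots> \<le> 3 * ?\<gamma> y * ?\<gamma> (x - y)"
        using p less_imp_le[OF std_normal_density_pos] by (intro mult_right_mono) auto
      finally show ?thesis using True by (simp add: k_def flip: ennreal_mult'' ennreal_mult)
    next
      case False
      then show ?thesis by (auto simp: k_def)
    qed
    then have "(\<integral>\<^sup>+x. ennreal (?\<gamma> x) * k x y \<partial>lborel) \<le> (\<integral>\<^sup>+x. ennreal (3 * ?\<gamma> y) * ennreal (?\<gamma> (x - y)) \<partial>lborel)"
      by (intro nn_integral_mono)
    also have "\<dots> = 3 * ennreal (?\<gamma> y)"
      by (subst nn_integral_cmult) (auto simp: nn_integral_shifted_std_normal ennreal_mult' less_imp_le)
    finally show ?thesis .
  qed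
  have "(\<integral>\<^sup>+x. ennreal \<bar>v x - v 0\<bar> \<partial>gauss1) \<le> (\<integral>\<^sup>+x. (\<integral>\<^sup>+y. ennreal \<bar>v' y\<bar> * k x y \<partial>lborel) \<partial>gauss1)"
    by (intro nn_integral_mono bd)
  also have "\<dots> = (\<integral>\<^sup>+x. \<integral>\<^sup>+y. ennreal (?\<gamma> x) * (ennreal \<bar>v' y\<bar> * k x y) \<partial>lborel \<partial>lborel)"
    by (subst gauss1_nn_integral) (auto simp: nn_integral_cmult)
  also have "\<dots> = (\<integral>\<^sup>+y. \<integral>\<^sup>+x. ennreal (?\<gamma> x) * (ennreal \<bar>v' y\<bar> * k x y) \<partial>lborel \<partial>lborel)"
    by (rule lborel_pair.Fubini') measurable
  also have "\<dots> = (\<integral>\<^sup>+y. ennreal \<bar>v' y\<bar> * (\<integral>\<^sup>+x. ennreal (?\<gamma> x) * k x y \<partial>lborel) \<partial>lborel)"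
    by (intro nn_integral_cong) (subst nn_integral_cmult[symmetric], auto simp: mult_ac)
  also have "\<dots> \<le> (\<integral>\<^sup>+y. ennreal \<bar>v' y\<bar> * (3 * ennreal (?\<gamma> y)) \<partial>lborel)"
    by (intro nn_integral_mono mult_left_mono ker) auto
  also have "\<dots> = 3 * (\<integral>\<^sup>+x. ennreal \<bar>v' x\<bar> \<partial>gauss1)"
    by (subst gauss1_nn_integral) (auto simp: nn_integral_cmult[symmetric] mult_ac)
  finally show ?thesis .
qed

lemma nn_integral_affine_bound:
  fixes g K :: "'a \<Rightarrow> real"
  assumes "prob_space N" and [measurable]: "g \<in> borel_measurable N" "K \<in> borel_measurable N"
    and "\<And>x. \<bar>g x\<bar> \<le> \<epsilon> + c * K x" "0 \<le> \<epsilon>" "0 \<le> c" "0 \<le> d" "\<And>x. 0 \<le> K x"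
    and "(\<integral>\<^sup>+x. ennreal (K x) \<partial>N) \<le> ennreal d"
  shows "(\<integral>\<^sup>+x. ennreal \<bar>g x\<bar> \<partial>N) \<le> ennreal (\<epsilon> + c * d)"
proof -
  interpret prob_space N by fact
  have "(\<integral>\<^sup>+x. ennreal \<bar>g x\<bar> \<partial>N) \<le> (\<integral>\<^sup>+x. ennreal \<epsilon> + ennreal c * ennreal (K x) \<partial>N)"
    using assms(4-8) by (intro nn_integral_mono) (simp add: ennreal_leI flip: ennreal_mult ennreal_plus)
  also have "\<dots> = ennreal \<epsilon> + ennreal c * (\<integral>\<^sup>+x. ennreal (K x) \<partial>N)"
    by (subst nn_integral_add) (auto simp: nn_integral_cmult emeasure_space_1)
  also have "\<dots> \<le> ennreal \<epsilon> + ennreal c * ennreal d"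
    using assms(9) by (intro add_left_mono mult_left_mono) auto
  also have "\<dots> = ennreal (\<epsilon> + c * d)" using assms(5-7) by (simp add: ennreal_mult)
  finally show ?thesis .
qed

text \<open>With \<open>e\<close> the number in brackets, \<open>\<theta>'\<close> and
  \<open>\<theta> + h / f\<close> have L1 norm at most \<open>e\<close>. The Poincare inequality
  brings \<open>\<theta>\<close> within \<open>3 * e\<close> of \<open>\<theta> 0\<close>, so the
  derivative of \<open>ln f\<close> is within \<open>4 * e\<close> of \<open>- \<theta> 0\<close>. A
  second use of the inequality gives the factor 12, with \<open>a = \<theta> 0\<close> and
  \<open>b = ln (f 0)\<close>.\<close>

lemma gauss1_log_nearly_affine:
  fixes f h :: "real \<Rightarrow> real"
  assumes fh: "primitive_of f h" and \<alpha>: "0 < \<alpha>"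
    and f: "\<And>x. \<alpha> \<le> f x" "\<And>x. f x \<le> M"
    and J: "integrable gauss1 (\<lambda>x. (h x)\<^sup>2 / f x)"
    and m: "m = (\<integral>x. f x \<partial>gauss1)"
    and d: "d = (\<integral>x. (h x)\<^sup>2 / f x \<partial>gauss1) / 2 - ((\<integral>x. f x * ln (f x) \<partial>gauss1) - m * ln m)"
    and \<epsilon>: "0 < \<epsilon>" "\<epsilon> < 1"
  obtains a b where "(\<integral>\<^sup>+x. ennreal \<bar>ln (f x) + a * x - b\<bar> \<partial>gauss1) \<le> ennreal (12 * (\<epsilon> + 2 / (\<epsilon> * \<alpha>) * d))"
proof -
  obtain \<theta> \<theta>' where D\<theta>: "\<And>x. (\<theta> has_real_derivative \<theta>' x) (at x)" and \<theta>'c: "continuous_on UNIV \<theta>'"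
    and \<theta>'1: "\<And>x. -1 < \<theta>' x" and d0: "0 \<le> d"
    and K: "(\<integral>\<^sup>+x. ennreal (f x * (\<theta>' x - ln (1 + \<theta>' x)) + f x * (\<theta> x + h x / f x)\<^sup>2 / 2) \<partial>gauss1) \<le> ennreal d"
    by (rule gaussian_transport_deficit[OF fh \<alpha> f J m d]) (rule that; assumption)
  have fpos: "0 < f x" for x using f(1)[of x] \<alpha> by linarith
  have P\<theta>: "primitive_of \<theta> \<theta>'" using D\<theta> \<theta>'c by (rule primitive_of_continuous_deriv)
  note [measurable] = primitive_ofD(1)[OF fh] borel_measurable_continuous_onI[OF primitive_of_continuous[OF fh]]
    primitive_ofD(1)[OF P\<theta>] borel_measurable_continuous_onI[OF primitive_of_continuous[OF P\<theta>]]
  define k where "k x = f x * (\<theta>' x - ln (1 + \<theta>' x)) + f x * (\<theta> x + h x / f x)\<^sup>2 / 2" for x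
  have [measurable]: "k \<in> borel_measurable borel" unfolding k_def[abs_def] by measurable
  define e where "e = \<epsilon> + 2 / (\<epsilon> * \<alpha>) * d"
  have \<psi>0: "0 \<le> \<theta>' x - ln (1 + \<theta>' x)" for x using ln_add_one_self_le_self2[OF \<theta>'1[of x]] by simp
  have k1: "\<alpha> * (\<theta>' x - ln (1 + \<theta>' x)) \<le> k x" and k2: "\<alpha> * ((\<theta> x + h x / f x)\<^sup>2 / 2) \<le> k x" and k0: "0 \<le> k x" for x
  proof -
    have "\<alpha> * (\<theta>' x - ln (1 + \<theta>' x)) \<le> f x * (\<theta>' x - ln (1 + \<theta>' x))"
      "\<alpha> * ((\<theta> x + h x / f x)\<^sup>2 / 2) \<le> f x * ((\<theta> x + h x / f x)\<^sup>2 / 2)"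
      "0 \<le> f x * (\<theta>' x - ln (1 + \<theta>' x))" "0 \<le> f x * ((\<theta> x + h x / f x)\<^sup>2 / 2)"
      using \<psi>0[of x] f(1)[of x] fpos[of x] by (auto intro!: mult_right_mono)
    then show "\<alpha> * (\<theta>' x - ln (1 + \<theta>' x)) \<le> k x" "\<alpha> * ((\<theta> x + h x / f x)\<^sup>2 / 2) \<le> k x" "0 \<le> k x"
      unfolding k_def by auto
  qed
  have e1: "(\<integral>\<^sup>+x. ennreal \<bar>\<theta>' x\<bar> \<partial>gauss1) \<le> ennreal e"
    unfolding e_def
  proof (rule nn_integral_affine_bound[OF prob_space_gauss1])
    fix x
    have "\<theta>' x - ln (1 + \<theta>' x) \<le> k x / \<alpha>" using k1[of x] \<alpha> by (simp add: field_simps)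
    then have "2 / \<epsilon> * (\<theta>' x - ln (1 + \<theta>' x)) \<le> 2 / \<epsilon> * (k x / \<alpha>)" using \<epsilon> by (intro mult_left_mono) auto
    then show "\<bar>\<theta>' x\<bar> \<le> \<epsilon> + 2 / (\<epsilon> * \<alpha>) * k x" using abs_le_minus_ln[OF \<theta>'1[of x] \<epsilon>] by simp
  qed (use \<epsilon> \<alpha> d0 k0 K in \<open>auto simp: k_def\<close>)
  have e2: "(\<integral>\<^sup>+x. ennreal \<bar>\<theta> x + h x / f x\<bar> \<partial>gauss1) \<le> ennreal e"
    unfolding e_def
  proof (rule nn_integral_affine_bound[OF prob_space_gauss1])
    fix x
    have "(\<theta> x + h x / f x)\<^sup>2 \<le> 2 * (k x / \<alpha>)" using k2[of x] \<alpha> by (simp add: field_simps)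
    then have "(\<theta> x + h x / f x)\<^sup>2 / \<epsilon> \<le> 2 * (k x / \<alpha>) / \<epsilon>" using \<epsilon> by (intro divide_right_mono) auto
    then show "\<bar>\<theta> x + h x / f x\<bar> \<le> \<epsilon> + 2 / (\<epsilon> * \<alpha>) * k x"
      using abs_le_square[OF \<epsilon>(1), of "\<theta> x + h x / f x"] by (simp add: mult.commute)
  qed (use \<epsilon> \<alpha> d0 k0 K in \<open>auto simp: k_def\<close>)
  have e0: "0 \<le> e" using \<epsilon> \<alpha> d0 by (simp add: e_def)
  have e3: "(\<integral>\<^sup>+x. ennreal \<bar>\<theta> x - \<theta> 0\<bar> \<partial>gauss1) \<le> 3 * ennreal e"
    using gauss1_L1_poincare[OF P\<theta>] mult_left_mono[OF e1, of 3] by (auto intro: order_trans)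
  define w where "w x = ln (f x) + \<theta> 0 * x" for x
  have Pw: "primitive_of w (\<lambda>x. inverse (f x) * h x + \<theta> 0)"
    unfolding w_def[abs_def]
  proof (rule primitive_of_add)
    show "primitive_of (\<lambda>x. ln (f x)) (\<lambda>x. inverse (f x) * h x)"
      using fpos by (intro primitive_of_chain[OF fh, of "{0<..}"])
        (auto intro!: continuous_intros DERIV_ln simp: is_interval_1)
    show "primitive_of (\<lambda>x. \<theta> 0 * x) (\<lambda>x. \<theta> 0)"
      by (rule primitive_of_continuous_deriv) (auto intro!: derivative_eq_intros)
  qed
  have "(\<integral>\<^sup>+x. ennreal \<bar>w x - w 0\<bar> \<partial>gauss1) \<le> 3 * (\<integral>\<^sup>+x. ennreal \<bar>inverse (f x) * h x + \<theta> 0\<bar> \<partial>gauss1)"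
    by (rule gauss1_L1_poincare[OF Pw])
  also have "\<dots> \<le> 3 * (\<integral>\<^sup>+x. ennreal \<bar>\<theta> x + h x / f x\<bar> + ennreal \<bar>\<theta> x - \<theta> 0\<bar> \<partial>gauss1)"
    by (intro mult_left_mono nn_integral_mono)
       (auto simp: field_simps intro!: ennreal_leI simp flip: ennreal_plus)
  also have "\<dots> = 3 * ((\<integral>\<^sup>+x. ennreal \<bar>\<theta> x + h x / f x\<bar> \<partial>gauss1) + (\<integral>\<^sup>+x. ennreal \<bar>\<theta> x - \<theta> 0\<bar> \<partial>gauss1))"
    by (subst nn_integral_add) auto
  also have "\<dots> \<le> 3 * (ennreal e + 3 * ennreal e)"
    by (intro mult_left_mono add_mono e2 e3) auto
  also have "\<dots> = ennreal (3 * (e + 3 * e))"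
    by (simp only: ennreal_mult ennreal_plus e0 mult_nonneg_nonneg add_nonneg_nonneg ennreal_numeral zero_le_numeral)
  also have "3 * (e + 3 * e) = 12 * e" by simp
  finally show thesis using that[of "\<theta> 0" "ln (f 0)"] by (simp add: w_def e_def)
qed

lemma gauss1_first_moment: "integrable gauss1 (\<lambda>x. x)" "(\<integral>x. x \<partial>gauss1) = 0" "(\<integral>x. \<bar>x\<bar> \<partial>gauss1) \<le> 1"
proof -
  show i: "integrable gauss1 (\<lambda>x. x)" and "(\<integral>x. x \<partial>gauss1) = 0"
    using std_normal_moment_odd[of 0] gauss1_integral[of "\<lambda>x. x"] by (auto simp: has_bochner_integral_iff)
  have "(\<integral>x. \<bar>x\<bar> \<partial>gauss1) \<le> (\<integral>x. (1 + x\<^sup>2) / 2 \<partial>gauss1)"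
  proof (rule integral_mono)
    show "\<bar>x\<bar> \<le> (1 + x\<^sup>2) / 2" for x :: real
      using sum_squares_bound[of 1 "\<bar>x\<bar>"] by simp
  qed (use i gauss1_second_moment in auto)
  also have "\<dots> = 1" using gauss1_second_moment gauss1.prob_space by simp
  finally show "(\<integral>x. \<bar>x\<bar> \<partial>gauss1) \<le> 1" .
qed

text \<open>On the half-line where \<open>a * x \<ge> \<bar>a\<bar> * R\<close>, the affine function
  \<open>b - a * x\<close> is at most \<open>b - \<bar>a\<bar> * R\<close>, whereas \<open>w\<close>
  stays above \<open>l\<close>. As this half-line has mass at least the density at
  \<open>R + 1\<close>, the L1 distance \<open>\<omega>\<close> limits the gap. The mean of
  \<open>w\<close> bounds \<open>b\<close>, because \<open>x\<close> has mean 0. Choosing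
  \<open>R\<close> large first and \<open>\<omega>\<close> small afterwards makes the slope
  small.\<close>

lemma gauss1_small_slope:
  fixes w :: "real \<Rightarrow> real"
  assumes w: "integrable gauss1 w" "\<And>x. l \<le> w x" "(\<integral>x. w x \<partial>gauss1) \<le> L"
    and \<omega>: "(\<integral>x. \<bar>w x + a * x - b\<bar> \<partial>gauss1) \<le> \<omega>" and R: "0 < R"
  shows "\<bar>a\<bar> * R \<le> L + \<omega> - l + \<omega> / std_normal_density (R + 1)"
proof -
  have i: "integrable gauss1 (\<lambda>x. w x + a * x - b)" using w(1) gauss1_first_moment(1) by auto
  have "b - (\<integral>x. w x \<partial>gauss1) = - (\<integral>x. w x + a * x - b \<partial>gauss1)"
    using w(1) gauss1_first_moment gauss1.prob_space by simp
  also have "\<dots> \<le> \<bar>\<integral>x. w x + a * x - b \<partial>gauss1\<bar>" by simp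
  also have "\<dots> \<le> (\<integral>x. \<bar>w x + a * x - b\<bar> \<partial>gauss1)" by (rule integral_abs_bound)
  finally have b: "b \<le> L + \<omega>" using w(3) \<omega> by linarith
  have \<omega>0: "0 \<le> \<omega>" using \<omega> by (rule order_trans[rotated]) simp
  define A where "A = {x. \<bar>a\<bar> * R \<le> a * x}"
  have [measurable]: "A \<in> sets borel" unfolding A_def by measurable
  have pA: "std_normal_density (R + 1) \<le> measure gauss1 A"
  proof (cases "0 \<le> a")
    case True
    then show ?thesis using R by (intro gauss1_measure_ge[of _ R]) (auto simp: A_def mult_left_mono)
  next
    case False
    have "- (a * R) \<le> a * x" if "x \<le> - R" for x
      using mult_left_mono_neg[OF that, of a] False by simp
    then show ?thesis using R False by (intro gauss1_measure_ge[of _ "- R - 1"]) (auto simp: A_def)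
  qed
  define D where "D = \<bar>a\<bar> * R - b + l"
  have "D * measure gauss1 A = (\<integral>x. D * indicator A x \<partial>gauss1)" by simp
  also have "\<dots> \<le> (\<integral>x. \<bar>w x + a * x - b\<bar> \<partial>gauss1)"
  proof (rule integral_mono)
    show "integrable gauss1 (\<lambda>x. D * indicator A x)"
      by (intro gauss1_integrable_bounded[of _ "\<bar>D\<bar>"]) (auto simp: indicator_def)
    show "D * indicator A x \<le> \<bar>w x + a * x - b\<bar>" for x
      using w(2)[of x] by (auto simp: D_def A_def indicator_def)
  qed (use i in auto)
  finally have "D * measure gauss1 A \<le> \<omega>" using \<omega> by linarith
  then have "D \<le> \<omega> / measure gauss1 A"
    using pA std_normal_density_pos[of "R + 1"] by (subst pos_le_divide_eq) linarith+
  also have "\<dots> \<le> \<omega> / std_normal_density (R + 1)" using pA \<omega>0 less_le_trans[OF std_normal_density_pos pA]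
    by (intro divide_left_mono mult_pos_pos) auto
  finally show ?thesis using b by (simp add: D_def)
qed

text \<open>The map \<open>exp (- s)\<close> has Lipschitz constant \<open>1 / \<alpha>\<close> for
  \<open>s \<ge> ln \<alpha>\<close>. Raising \<open>b\<close> to at least
  \<open>ln \<alpha>\<close> puts it into this range without increasing its distance to
  \<open>ln y\<close>.\<close>

lemma abs_inverse_minus_exp_le:
  fixes y \<alpha> b :: real
  assumes "0 < \<alpha>" "\<alpha> \<le> y"
  shows "\<bar>1 / y - exp (- max b (ln \<alpha>))\<bar> \<le> 1 / \<alpha> * \<bar>ln y - b\<bar>"
proof -
  have lip: "exp (- s) - exp (- t) \<le> 1 / \<alpha> * (t - s)" if "ln \<alpha> \<le> s" "s \<le> t" for s t :: real
  proof -
    have "1 - exp (s - t) \<le> t - s" using exp_ge_add_one_self[of "s - t"] by linarith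
    then have "exp (- s) * (1 - exp (s - t)) \<le> 1 / \<alpha> * (t - s)"
    proof (intro mult_mono)
      have "exp (- s) \<le> exp (- ln \<alpha>)" using that by simp
      then show "exp (- s) \<le> 1 / \<alpha>" using assms by (simp add: exp_minus field_simps)
    qed (use assms that in auto)
    then show ?thesis by (simp add: algebra_simps flip: exp_add)
  qed
  have y: "1 / y = exp (- ln y)" using assms by (simp add: exp_minus field_simps)
  have ly: "ln \<alpha> \<le> ln y" using assms by simp
  have "\<bar>1 / y - exp (- max b (ln \<alpha>))\<bar> \<le> 1 / \<alpha> * \<bar>ln y - max b (ln \<alpha>)\<bar>"
    unfolding y
  proof (cases "ln y \<le> max b (ln \<alpha>)")
    case True
    moreover have "exp (- max b (ln \<alpha>)) \<le> exp (- ln y)" using True by simp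
    ultimately show "\<bar>exp (- ln y) - exp (- max b (ln \<alpha>))\<bar> \<le> 1 / \<alpha> * \<bar>ln y - max b (ln \<alpha>)\<bar>"
      using lip[OF ly True] by (simp only: abs_of_nonneg abs_of_nonpos diff_ge_0_iff_ge diff_le_0_iff_le minus_diff_eq)
  next
    case False
    then have "max b (ln \<alpha>) \<le> ln y" by linarith
    moreover from this have "exp (- ln y) \<le> exp (- max b (ln \<alpha>))" by simp
    ultimately show "\<bar>exp (- ln y) - exp (- max b (ln \<alpha>))\<bar> \<le> 1 / \<alpha> * \<bar>ln y - max b (ln \<alpha>)\<bar>"
      using lip[of "max b (ln \<alpha>)" "ln y"]
      by (simp only: abs_of_nonneg abs_of_nonpos diff_ge_0_iff_ge diff_le_0_iff_le minus_diff_eq max.cobounded2)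
  qed
  also have "\<dots> \<le> 1 / \<alpha> * \<bar>ln y - b\<bar>" using assms
  proof (intro mult_left_mono)
    show "\<bar>ln y - max b (ln \<alpha>)\<bar> \<le> \<bar>ln y - b\<bar>" using ly by linarith
  qed auto
  finally show ?thesis .
qed

text \<open>Replaces a constant that depends on the line in an uncontrolled way by the mean, which
  is what averages over coordinates produce.\<close>

lemma (in prob_space) expectation_abs_deviation_le:
  fixes g :: "'a \<Rightarrow> real"
  assumes "integrable M g"
  shows "expectation (\<lambda>x. \<bar>g x - expectation g\<bar>) \<le> 2 * expectation (\<lambda>x. \<bar>g x - q\<bar>)"
proof -
  have "\<bar>q - expectation g\<bar> = \<bar>expectation (\<lambda>x. g x - q)\<bar>" using assms by (simp add: prob_space abs_minus_commute)
  also have "\<dots> \<le> expectation (\<lambda>x. \<bar>g x - q\<bar>)" by (rule integral_abs_bound)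
  finally have 1: "\<bar>q - expectation g\<bar> \<le> expectation (\<lambda>x. \<bar>g x - q\<bar>)" .
  have "expectation (\<lambda>x. \<bar>g x - expectation g\<bar>) \<le> expectation (\<lambda>x. \<bar>g x - q\<bar> + \<bar>q - expectation g\<bar>)"
    using assms by (intro integral_mono) auto
  also have "\<dots> = expectation (\<lambda>x. \<bar>g x - q\<bar>) + \<bar>q - expectation g\<bar>"
    using assms by (simp add: prob_space)
  finally show ?thesis using 1 by linarith
qed

text \<open>The bound \<open>M\<close> is quantified inside, so \<open>\<eta>\<close> does not
  depend on the level of truncation, which later tends to infinity. Only an upper bound
  \<open>L\<close> is put on the mass, since lines are not normalized.\<close>

definition slice_stable :: "real \<Rightarrow> real \<Rightarrow> real \<Rightarrow> real \<Rightarrow> bool" where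
  "slice_stable \<alpha> L \<epsilon> \<eta> \<longleftrightarrow> (\<forall>f h M. primitive_of f h \<longrightarrow> (\<forall>x. \<alpha> \<le> f x) \<longrightarrow> (\<forall>x. f x \<le> M) \<longrightarrow>
      integrable gauss1 (\<lambda>x. (h x)\<^sup>2 / f x) \<longrightarrow> (\<integral>x. f x \<partial>gauss1) \<le> L \<longrightarrow>
      (\<integral>x. (h x)\<^sup>2 / f x \<partial>gauss1) / 2
        - ((\<integral>x. f x * ln (f x) \<partial>gauss1) - (\<integral>x. f x \<partial>gauss1) * ln (\<integral>x. f x \<partial>gauss1)) \<le> \<eta> \<longrightarrow>
      (\<integral>x. \<bar>1 / f x - (\<integral>x. 1 / f x \<partial>gauss1)\<bar> \<partial>gauss1) \<le> \<epsilon>)"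

theorem ex_slice_stable:
  fixes \<alpha> L \<epsilon> :: real
  assumes \<alpha>: "0 < \<alpha>" and L: "0 < L" and \<epsilon>: "0 < \<epsilon>"
  shows "\<exists>\<eta>>0. slice_stable \<alpha> L \<epsilon> \<eta>"
proof -
  \<comment> \<open>The constants are chosen backwards. An L1 distance \<open>\<kappa>\<close> of
    \<open>ln f\<close> from a constant becomes \<open>\<epsilon>\<close> after the Lipschitz factor
    \<open>1 / \<alpha>\<close> and the factor 2 of passing to the mean. Half of
    \<open>\<kappa>\<close> is spent on the slope: \<open>C\<close> dominates
    \<open>L + \<omega> - ln \<alpha>\<close> as \<open>\<omega> \<le> 1\<close>, and
    \<open>R\<close> makes \<open>C = R * \<kappa> / 4\<close>, as much as
    \<open>\<omega> / p\<close> may take. The values of \<open>e\<close> and \<open>\<eta>\<close>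
    make both parts of \<open>12 * (e + 2 / (e * \<alpha>) * \<eta>)\<close> equal to
    \<open>\<omega> / 2\<close>.\<close>
  define \<kappa> where "\<kappa> = \<alpha> * \<epsilon> / 2"
  define C where "C = L + 1 + \<bar>ln \<alpha>\<bar>"
  define R where "R = 4 * C / \<kappa>"
  define p where "p = std_normal_density (R + 1)"
  define \<omega> where "\<omega> = min 1 (min (\<kappa> / 4) (p * R * \<kappa> / 4))"
  define e where "e = \<omega> / 24"
  define \<eta> where "\<eta> = e * \<alpha> * \<omega> / 48"
  have pos: "0 < \<kappa>" "0 < C" "0 < R" "0 < p" using assms by (auto simp: \<kappa>_def C_def R_def p_def)
  then have \<omega>: "0 < \<omega>" "\<omega> \<le> 1" "\<omega> \<le> \<kappa> / 4" "\<omega> \<le> p * R * \<kappa> / 4" by (auto simp: \<omega>_def)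
  then have e: "0 < e" "e < 1" by (auto simp: e_def)
  have \<eta>: "0 < \<eta>" using e \<omega> \<alpha> by (simp add: \<eta>_def)
  have \<eta>': "12 * (e + 2 / (e * \<alpha>) * \<eta>) = \<omega>" using e \<omega> \<alpha> by (simp add: \<eta>_def field_simps e_def)
  have "slice_stable \<alpha> L \<epsilon> \<eta>"
    unfolding slice_stable_def
  proof (intro allI impI)
    fix f h :: "real \<Rightarrow> real" and M
    assume fh: "primitive_of f h" and "\<forall>x. \<alpha> \<le> f x" "\<forall>x. f x \<le> M"
      and J: "integrable gauss1 (\<lambda>x. (h x)\<^sup>2 / f x)" and m: "(\<integral>x. f x \<partial>gauss1) \<le> L"
      and d: "(\<integral>x. (h x)\<^sup>2 / f x \<partial>gauss1) / 2
        - ((\<integral>x. f x * ln (f x) \<partial>gauss1) - (\<integral>x. f x \<partial>gauss1) * ln (\<integral>x. f x \<partial>gauss1)) \<le> \<eta>" (is "?d \<le> \<eta>")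
    then have f: "\<And>x. \<alpha> \<le> f x" "\<And>x. f x \<le> M" by auto
    have fpos: "0 < f x" for x using f(1)[of x] \<alpha> by linarith
    note [measurable] = borel_measurable_continuous_onI[OF primitive_of_continuous[OF fh]]
    obtain a b where ab: "(\<integral>\<^sup>+x. ennreal \<bar>ln (f x) + a * x - b\<bar> \<partial>gauss1) \<le> ennreal (12 * (e + 2 / (e * \<alpha>) * ?d))"
      by (rule gauss1_log_nearly_affine[OF fh \<alpha> f J refl refl e]) (rule that)
    have "12 * (e + 2 / (e * \<alpha>) * ?d) \<le> \<omega>"
      unfolding \<eta>'[symmetric] using d e \<alpha> by (intro mult_left_mono add_left_mono) auto
    then have ab': "(\<integral>\<^sup>+x. ennreal \<bar>ln (f x) + a * x - b\<bar> \<partial>gauss1) \<le> ennreal \<omega>"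
      using ab by (meson ennreal_leI order_trans)
    have wi: "integrable gauss1 (\<lambda>x. ln (f x))"
    proof (rule gauss1_integrable_bounded)
      show "\<bar>ln (f x)\<bar> \<le> \<bar>ln \<alpha>\<bar> + \<bar>ln M\<bar>" for x
      proof -
        have "ln \<alpha> \<le> ln (f x)" "ln (f x) \<le> ln M" using f[of x] fpos[of x] \<alpha> by (auto intro!: ln_mono)
        then show ?thesis by linarith
      qed
    qed measurable
    have ai: "integrable gauss1 (\<lambda>x. ln (f x) + a * x - b)"
      using wi gauss1_first_moment(1) by auto
    have \<omega>i: "(\<integral>x. \<bar>ln (f x) + a * x - b\<bar> \<partial>gauss1) \<le> \<omega>"
    proof -
      have "(\<integral>\<^sup>+x. ennreal \<bar>ln (f x) + a * x - b\<bar> \<partial>gauss1) = ennreal (\<integral>x. \<bar>ln (f x) + a * x - b\<bar> \<partial>gauss1)"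
        by (rule nn_integral_eq_integral[OF integrable_abs[OF ai]]) simp
      then show ?thesis using ab' \<omega>(1) by simp
    qed
    have fi: "integrable gauss1 f" by (rule gauss1_entropy_identity(1)[OF _ \<alpha> f refl]) simp
    have "(\<integral>x. ln (f x) \<partial>gauss1) \<le> (\<integral>x. f x \<partial>gauss1)"
      using fpos by (intro integral_mono wi fi less_imp_le[OF ln_less_self])
    then have wL: "(\<integral>x. ln (f x) \<partial>gauss1) \<le> L" using m by linarith
    have "\<bar>a\<bar> * R \<le> L + \<omega> - ln \<alpha> + \<omega> / p"
      unfolding p_def by (rule gauss1_small_slope[OF wi _ wL \<omega>i pos(3)]) (use f(1) fpos \<alpha> in simp)
    also have "\<dots> \<le> C + R * \<kappa> / 4"
    proof -
      have "\<omega> / p \<le> R * \<kappa> / 4" using \<omega>(4) pos by (simp add: field_simps)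
      then show ?thesis using \<omega>(2) unfolding C_def by linarith
    qed
    also have "C = R * \<kappa> / 4" using pos by (simp add: R_def)
    finally have "\<bar>a\<bar> * R \<le> (\<kappa> / 2) * R" by (simp add: field_simps)
    then have a: "\<bar>a\<bar> \<le> \<kappa> / 2" using pos by simp
    have "(\<integral>x. \<bar>ln (f x) - b\<bar> \<partial>gauss1) \<le> (\<integral>x. \<bar>ln (f x) + a * x - b\<bar> + \<bar>a\<bar> * \<bar>x\<bar> \<partial>gauss1)"
    proof (rule integral_mono)
      show "\<bar>ln (f x) - b\<bar> \<le> \<bar>ln (f x) + a * x - b\<bar> + \<bar>a\<bar> * \<bar>x\<bar>" for x
        unfolding abs_mult[symmetric] by linarith
    qed (use wi ai gauss1_first_moment(1) in auto)
    also have "\<dots> = (\<integral>x. \<bar>ln (f x) + a * x - b\<bar> \<partial>gauss1) + \<bar>a\<bar> * (\<integral>x. \<bar>x\<bar> \<partial>gauss1)"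
      using ai gauss1_first_moment(1) by simp
    also have "\<dots> \<le> \<omega> + \<kappa> / 2 * 1"
      using \<omega>i a gauss1_first_moment(3) pos by (intro add_mono mult_mono) auto
    also have "\<dots> \<le> \<kappa>" using \<omega>(3) pos by simp
    finally have wb: "(\<integral>x. \<bar>ln (f x) - b\<bar> \<partial>gauss1) \<le> \<kappa>" .
    have ii: "integrable gauss1 (\<lambda>x. 1 / f x)"
      using f fpos \<alpha> by (intro gauss1_integrable_bounded[of _ "1 / \<alpha>"]) (auto intro!: divide_left_mono simp: less_imp_le)
    have "(\<integral>x. \<bar>1 / f x - (\<integral>x. 1 / f x \<partial>gauss1)\<bar> \<partial>gauss1)
        \<le> 2 * (\<integral>x. \<bar>1 / f x - exp (- max b (ln \<alpha>))\<bar> \<partial>gauss1)"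
      by (rule gauss1.expectation_abs_deviation_le[OF ii])
    also have "\<dots> \<le> 2 * (\<integral>x. 1 / \<alpha> * \<bar>ln (f x) - b\<bar> \<partial>gauss1)"
      using ii wi by (intro mult_left_mono integral_mono abs_inverse_minus_exp_le \<alpha> f) auto
    also have "\<dots> \<le> 2 * (1 / \<alpha> * \<kappa>)"
      using wb \<alpha> by (simp add: divide_right_mono)
    also have "\<dots> = \<epsilon>" using \<alpha> by (simp add: \<kappa>_def)
    finally show "(\<integral>x. \<bar>1 / f x - (\<integral>x. 1 / f x \<partial>gauss1)\<bar> \<partial>gauss1) \<le> \<epsilon>" .
  qed
  then show ?thesis using \<eta> by blast
qed

section \<open>Tensorization\<close>

lemma nn_integral_lborel_translate:
  fixes f :: "'a::euclidean_space \<Rightarrow> ennreal"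
  assumes "f \<in> borel_measurable borel"
  shows "(\<integral>\<^sup>+x. f (x + c) \<partial>lborel) = (\<integral>\<^sup>+x. f x \<partial>lborel)"
proof -
  have "(\<integral>\<^sup>+x. f x \<partial>lborel) = (\<integral>\<^sup>+x. f x \<partial>distr lborel borel ((+) c))" by (simp add: lborel_distr_plus)
  also have "\<dots> = (\<integral>\<^sup>+x. f (c + x) \<partial>lborel)" using assms by (subst nn_integral_distr) auto
  finally show ?thesis by (simp add: add.commute)
qed

text \<open>Lines are parametrized by the absolute value of the coordinate, not by the distance from
  \<open>x\<close>. Hence \<open>upd b x\<close> depends only on the line through \<open>x\<close>,
  and functions of the line are those invariant under \<open>upd b\<close>.\<close>

definition upd :: "'a::euclidean_space \<Rightarrow> 'a \<Rightarrow> real \<Rightarrow> 'a" where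
  "upd b x t = x + (t - x \<bullet> b) *\<^sub>R b"

lemma upd_measurable [measurable]:
  assumes [measurable]: "f \<in> borel_measurable M" "g \<in> borel_measurable M"
  shows "(\<lambda>x. upd b (f x) (g x)) \<in> borel_measurable M"
  unfolding upd_def by measurable

lemma upd_upd: "b \<in> Basis \<Longrightarrow> upd b (upd b x t) s = upd b x s"
  by (simp add: upd_def inner_add_left algebra_simps)

lemma upd_commute: "b \<in> Basis \<Longrightarrow> c \<in> Basis \<Longrightarrow> b \<noteq> c \<Longrightarrow> upd b (upd c x t) s = upd c (upd b x s) t"
  by (simp add: upd_def inner_add_left inner_not_same_Basis algebra_simps)

section \<open>The standard Gaussian measure on a Euclidean space\<close>

definition gauss_density :: "'a::euclidean_space \<Rightarrow> real" where
  "gauss_density x = (2 * pi) powr (- real DIM('a) / 2) * exp (- (norm x)\<^sup>2 / 2)"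

lemma gauss_density_pos: "0 < gauss_density x"
  by (simp add: gauss_density_def)

lemma gauss_density_measurable [measurable]: "gauss_density \<in> borel_measurable borel"
  unfolding gauss_density_def by measurable

lemma std_gaussian_eq: "std_gaussian = density lborel (\<lambda>x. ennreal (gauss_density x))"
  by (simp add: std_gaussian_def gauss_density_def)

lemma sets_std_gaussian [simp, measurable_cong]: "sets std_gaussian = sets borel"
  by (simp add: std_gaussian_eq)

lemma space_std_gaussian [simp]: "space std_gaussian = UNIV"
  by (simp add: std_gaussian_eq)

lemma gauss_density_prod: "gauss_density x = (\<Prod>b\<in>Basis. std_normal_density (x \<bullet> b))"
proof -
  have "(\<Prod>b\<in>Basis. std_normal_density (x \<bullet> b)) = (1 / sqrt (2 * pi)) ^ DIM('a) * exp (\<Sum>b\<in>Basis. - (x \<bullet> b)\<^sup>2 / 2)"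
    by (simp only: std_normal_density_def prod.distrib prod_constant exp_sum[OF finite_Basis])
  also have "(\<Sum>b\<in>Basis. - (x \<bullet> b)\<^sup>2 / 2) = - (norm x)\<^sup>2 / 2"
    unfolding power2_norm_eq_inner by (subst euclidean_inner) (simp add: power2_eq_square sum_negf sum_divide_distrib)
  also have "(1 / sqrt (2 * pi)) ^ DIM('a) = (2 * pi) powr (- real DIM('a) / 2)"
  proof -
    have "1 / sqrt (2 * pi) = (2 * pi) powr (- (1/2))" by (simp add: powr_minus powr_half_sqrt field_simps)
    then show ?thesis by (simp add: powr_power mult.commute)
  qed
  finally show ?thesis by (simp add: gauss_density_def)
qed

lemma prob_space_std_gaussian: "prob_space (std_gaussian :: 'a::euclidean_space measure)"
proof (rule prob_spaceI)
  have "(\<integral>\<^sup>+x. ennreal (gauss_density x) \<partial>(lborel :: 'a measure))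
      = (\<integral>\<^sup>+x. (\<Prod>b\<in>Basis. ennreal (std_normal_density (x \<bullet> b))) \<partial>(lborel :: 'a measure))"
    unfolding gauss_density_prod by (rule nn_integral_cong) (simp add: prod_ennreal less_imp_le)
  also have "\<dots> = (\<Prod>b\<in>(Basis::'a set). (\<integral>\<^sup>+x. ennreal (std_normal_density x) \<partial>lborel))"
    by (rule nn_integral_lborel_prod) auto
  also have "\<dots> = 1" using nn_integral_shifted_std_normal[of 0] by simp
  finally show "emeasure (std_gaussian :: 'a measure) (space std_gaussian) = 1"
    by (simp add: std_gaussian_eq emeasure_density)
qed

lemmas std_gaussian_measure_space = prob_space.prob_space[OF prob_space_std_gaussian]

lemma gauss_density_swap:
  assumes "b \<in> Basis"
  shows "gauss_density x * std_normal_density t = gauss_density (upd b x t) * std_normal_density (x \<bullet> b)"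
proof -
  have "(norm (upd b x t))\<^sup>2 = (norm x)\<^sup>2 + t\<^sup>2 - (x \<bullet> b)\<^sup>2"
    using assms unfolding power2_norm_eq_inner upd_def
    by (simp add: inner_add_left inner_add_right inner_commute[of b x] power2_eq_square algebra_simps)
  then have "exp (- (norm x)\<^sup>2 / 2) * exp (- t\<^sup>2 / 2) = exp (- (norm (upd b x t))\<^sup>2 / 2) * exp (- (x \<bullet> b)\<^sup>2 / 2)"
    by (simp add: field_simps flip: exp_add)
  then show ?thesis unfolding gauss_density_def std_normal_density_def by simp
qed

text \<open>The map exchanging the coordinate of \<open>x\<close> along \<open>b\<close> with \<open>t\<close> preserves Lebesgue measure:
  it is a composition of translations in one variable with the other one fixed.\<close>

lemma nn_integral_std_gaussian_resample:
  fixes F :: "'a::euclidean_space \<Rightarrow> ennreal"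
  assumes b: "b \<in> Basis" and [measurable]: "F \<in> borel_measurable borel"
  shows "(\<integral>\<^sup>+x. \<integral>\<^sup>+t. F (upd b x t) \<partial>gauss1 \<partial>std_gaussian) = (\<integral>\<^sup>+x. F x \<partial>std_gaussian)"
proof -
  let ?\<gamma> = std_normal_density
  define H where "H x s = ennreal (gauss_density x) * F x * ennreal (?\<gamma> s)" for x s
  have [measurable]: "case_prod H \<in> borel_measurable (borel \<Otimes>\<^sub>M borel)" unfolding H_def by measurable
  have "(\<integral>\<^sup>+x. \<integral>\<^sup>+t. F (upd b x t) \<partial>gauss1 \<partial>std_gaussian)
      = (\<integral>\<^sup>+x. \<integral>\<^sup>+t. ennreal (gauss_density x) * (ennreal (?\<gamma> t) * F (upd b x t)) \<partial>lborel \<partial>lborel)"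
    unfolding std_gaussian_eq by (simp add: nn_integral_density nn_integral_cmult)
  also have "\<dots> = (\<integral>\<^sup>+x. \<integral>\<^sup>+t. H (x + (t + - (x \<bullet> b)) *\<^sub>R b) (x \<bullet> b) \<partial>lborel \<partial>lborel)"
  proof (intro nn_integral_cong)
    fix x t
    have *: "ennreal (gauss_density x) * ennreal (?\<gamma> t) = ennreal (gauss_density (upd b x t)) * ennreal (?\<gamma> (x \<bullet> b))"
      using gauss_density_swap[OF b, of x t] by (simp add: less_imp_le gauss_density_pos flip: ennreal_mult)
    have upd_eq: "x + (t + - (x \<bullet> b)) *\<^sub>R b = upd b x t" by (simp add: upd_def)
    show "ennreal (gauss_density x) * (ennreal (?\<gamma> t) * F (upd b x t)) = H (x + (t + - (x \<bullet> b)) *\<^sub>R b) (x \<bullet> b)"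
      unfolding H_def upd_eq mult.assoc[symmetric] * by (simp only: ac_simps)
  qed
  also have "\<dots> = (\<integral>\<^sup>+x. \<integral>\<^sup>+\<tau>. H (x + \<tau> *\<^sub>R b) (x \<bullet> b) \<partial>lborel \<partial>lborel)"
    by (intro nn_integral_cong nn_integral_lborel_translate[where f="\<lambda>\<tau>. H (_ + \<tau> *\<^sub>R b) _"]) measurable
  also have "\<dots> = (\<integral>\<^sup>+\<tau>. \<integral>\<^sup>+x. H (x + \<tau> *\<^sub>R b) (x \<bullet> b) \<partial>lborel \<partial>lborel)"
    by (rule lborel_pair.Fubini'[symmetric]) measurable
  also have "\<dots> = (\<integral>\<^sup>+\<tau>. \<integral>\<^sup>+x. H x (x \<bullet> b - \<tau>) \<partial>lborel \<partial>lborel)"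
  proof (rule nn_integral_cong)
    fix \<tau> :: real
    have "(\<integral>\<^sup>+x. H x (x \<bullet> b - \<tau>) \<partial>lborel) = (\<integral>\<^sup>+x. H (x + \<tau> *\<^sub>R b) ((x + \<tau> *\<^sub>R b) \<bullet> b - \<tau>) \<partial>lborel)"
      by (rule nn_integral_lborel_translate[symmetric]) measurable
    then show "(\<integral>\<^sup>+x. H (x + \<tau> *\<^sub>R b) (x \<bullet> b) \<partial>lborel) = (\<integral>\<^sup>+x. H x (x \<bullet> b - \<tau>) \<partial>lborel)"
      using b by (simp add: inner_add_left)
  qed
  also have "\<dots> = (\<integral>\<^sup>+x. \<integral>\<^sup>+\<tau>. H x (x \<bullet> b - \<tau>) \<partial>lborel \<partial>lborel)"
    by (rule lborel_pair.Fubini') measurable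
  also have "\<dots> = (\<integral>\<^sup>+x. \<integral>\<^sup>+s. H x s \<partial>lborel \<partial>lborel)"
  proof (rule nn_integral_cong)
    fix x :: 'a
    show "(\<integral>\<^sup>+\<tau>. H x (x \<bullet> b - \<tau>) \<partial>lborel) = (\<integral>\<^sup>+s. H x s \<partial>lborel)"
      by (subst nn_integral_real_affine[where c="-1" and t="x \<bullet> b" and f="H x"]) auto
  qed
  also have "\<dots> = (\<integral>\<^sup>+x. F x \<partial>std_gaussian)"
    using nn_integral_shifted_std_normal[of 0]
    by (simp add: H_def nn_integral_cmult std_gaussian_eq nn_integral_density)
  finally show ?thesis .
qed

lemma AE_std_gaussian_iff: "(AE x in std_gaussian. P x) \<longleftrightarrow> (AE x in lborel. P x)"
  unfolding std_gaussian_eq by (subst AE_density) (auto simp: gauss_density_pos)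

lemma AE_gauss1_iff: "(AE x in gauss1. P x) \<longleftrightarrow> (AE x in lborel. P x)"
  by (subst AE_density) auto

text \<open>Gaussian and Lebesgue measure have the same null sets, so the resampling formula applied
  to the indicator of a null set suffices.\<close>

lemma AE_upd:
  fixes P :: "'a::euclidean_space \<Rightarrow> bool"
  assumes b: "b \<in> Basis" and P: "AE x in lborel. P x"
  shows "AE x in lborel. AE t in lborel. P (upd b x t)"
proof -
  obtain N where N: "{x. \<not> P x} \<subseteq> N" "N \<in> sets borel" "emeasure std_gaussian N = 0"
    using P unfolding AE_std_gaussian_iff[symmetric] by (auto elim!: AE_E)
  note [measurable] = N(2)
  have "(\<integral>\<^sup>+x. \<integral>\<^sup>+t. indicator N (upd b x t) \<partial>gauss1 \<partial>std_gaussian) = 0"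
    using N(3) by (subst nn_integral_std_gaussian_resample[OF b]) auto
  then have "AE x in std_gaussian. (\<integral>\<^sup>+t. indicator N (upd b x t) \<partial>gauss1) = 0"
    by (subst (asm) nn_integral_0_iff_AE) auto
  then have "AE x in std_gaussian. AE t in gauss1. P (upd b x t)"
  proof eventually_elim
    case (elim x)
    then have "AE t in gauss1. indicator N (upd b x t) = (0::ennreal)"
      by (subst (asm) nn_integral_0_iff_AE) auto
    then show ?case by eventually_elim (use N(1) in \<open>auto simp: indicator_def split: if_splits\<close>)
  qed
  then show ?thesis unfolding AE_std_gaussian_iff AE_gauss1_iff .
qed

interpretation std_gaussian: prob_space "std_gaussian :: 'a::euclidean_space measure"
  by (rule prob_space_std_gaussian)

text \<open>Under the Gaussian measure this is the conditional expectation of \<open>F\<close> given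
  all coordinates except the one along \<open>b\<close>.\<close>

definition avg :: "'a::euclidean_space \<Rightarrow> ('a \<Rightarrow> real) \<Rightarrow> 'a \<Rightarrow> real" where
  "avg b F x = (\<integral>t. F (upd b x t) \<partial>gauss1)"

lemma avg_measurable [measurable]:
  assumes [measurable]: "F \<in> borel_measurable borel"
  shows "avg b F \<in> borel_measurable borel"
  unfolding avg_def[abs_def] by measurable

text \<open>Restates the resampling formula as an equality of measures, through which it passes to
  Bochner integrals of signed functions.\<close>

lemma std_gaussian_resample:
  assumes b: "b \<in> Basis"
  shows "distr (std_gaussian \<Otimes>\<^sub>M gauss1) borel (\<lambda>(x, t). upd b x t) = std_gaussian"
proof (rule measure_eqI)
  fix A :: "'a set" assume "A \<in> sets (distr (std_gaussian \<Otimes>\<^sub>M gauss1) borel (\<lambda>(x, t). upd b x t))"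
  then have [measurable]: "A \<in> sets borel" by simp
  have "emeasure (distr (std_gaussian \<Otimes>\<^sub>M gauss1) borel (\<lambda>(x, t). upd b x t)) A
      = (\<integral>\<^sup>+y. indicator A y \<partial>distr (std_gaussian \<Otimes>\<^sub>M gauss1) borel (\<lambda>(x, t). upd b x t))"
    by (rule nn_integral_indicator[symmetric]) simp
  also have "\<dots> = (\<integral>\<^sup>+z. indicator A (case z of (x, t) \<Rightarrow> upd b x t) \<partial>(std_gaussian \<Otimes>\<^sub>M gauss1))"
    by (rule nn_integral_distr) measurable
  also have "\<dots> = (\<integral>\<^sup>+x. \<integral>\<^sup>+t. indicator A (upd b x t) \<partial>gauss1 \<partial>std_gaussian)"
    by (subst gauss1.nn_integral_fst[symmetric]) (auto simp: split_beta')
  also have "\<dots> = emeasure std_gaussian A"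
    by (subst nn_integral_std_gaussian_resample[OF b]) auto
  finally show "emeasure (distr (std_gaussian \<Otimes>\<^sub>M gauss1) borel (\<lambda>(x, t). upd b x t)) A = emeasure std_gaussian A" .
qed simp

lemma avg_integral:
  fixes F :: "'a::euclidean_space \<Rightarrow> real"
  assumes b: "b \<in> Basis" and [measurable]: "F \<in> borel_measurable borel" and F: "integrable std_gaussian F"
  shows "AE x in std_gaussian. integrable gauss1 (\<lambda>t. F (upd b x t))"
    "integrable std_gaussian (avg b F)"
    "(\<integral>x. avg b F x \<partial>std_gaussian) = (\<integral>x. F x \<partial>std_gaussian)"
proof -
  interpret pair_sigma_finite "std_gaussian :: 'a measure" gauss1 ..
  have eq: "(\<lambda>z. F (case z of (x, t) \<Rightarrow> upd b x t)) = (\<lambda>(x, t). F (upd b x t))" by auto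
  have "integrable (distr (std_gaussian \<Otimes>\<^sub>M gauss1) borel (\<lambda>(x, t). upd b x t)) F"
    using F by (simp add: std_gaussian_resample[OF b])
  then have i: "integrable (std_gaussian \<Otimes>\<^sub>M gauss1) (\<lambda>(x, t). F (upd b x t))"
    by (subst (asm) integrable_distr_eq) (auto simp: eq)
  show "AE x in std_gaussian. integrable gauss1 (\<lambda>t. F (upd b x t))"
    using AE_integrable_fst'[OF i] by simp
  show "integrable std_gaussian (avg b F)"
    using integrable_fst'[OF i] by (simp add: avg_def[abs_def])
  have "(\<integral>x. F x \<partial>std_gaussian) = (\<integral>x. F x \<partial>distr (std_gaussian \<Otimes>\<^sub>M gauss1) borel (\<lambda>(x, t). upd b x t))"
    by (simp add: std_gaussian_resample[OF b])
  also have "\<dots> = (\<integral>(x, t). F (upd b x t) \<partial>(std_gaussian \<Otimes>\<^sub>M gauss1))"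
    by (subst integral_distr) (auto simp: eq)
  also have "\<dots> = (\<integral>x. avg b F x \<partial>std_gaussian)"
    using integral_fst'[OF i] by (simp add: avg_def)
  finally show "(\<integral>x. avg b F x \<partial>std_gaussian) = (\<integral>x. F x \<partial>std_gaussian)" ..
qed

section \<open>Iterated averages over coordinates\<close>

lemma std_gaussian_integrable_bounded:
  fixes F :: "'a::euclidean_space \<Rightarrow> real"
  assumes "F \<in> borel_measurable borel" "\<And>x. \<bar>F x\<bar> \<le> B"
  shows "integrable std_gaussian F"
  using assms by (intro std_gaussian.integrable_const_bound[where B=B]) auto

lemma avg_bounds:
  fixes F :: "'a::euclidean_space \<Rightarrow> real"
  assumes [measurable]: "F \<in> borel_measurable borel" and F: "\<And>x. l \<le> F x" "\<And>x. F x \<le> u"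
  shows "l \<le> avg b F x" "avg b F x \<le> u"
proof -
  have i: "integrable gauss1 (\<lambda>t. F (upd b x t))"
  proof (rule gauss1_integrable_bounded[of _ "\<bar>l\<bar> + \<bar>u\<bar>"])
    show "\<bar>F (upd b x t)\<bar> \<le> \<bar>l\<bar> + \<bar>u\<bar>" for t using F[of "upd b x t"] by linarith
  qed simp
  have "(\<integral>t. l \<partial>gauss1) \<le> avg b F x" unfolding avg_def using F i by (intro integral_mono) auto
  then show "l \<le> avg b F x" using gauss1.prob_space by simp
  have "avg b F x \<le> (\<integral>t. u \<partial>gauss1)" unfolding avg_def using F i by (intro integral_mono) auto
  then show "avg b F x \<le> u" using gauss1.prob_space by simp
qed

lemma avg_upd: "b \<in> Basis \<Longrightarrow> avg b F (upd b x t) = avg b F x"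
  by (simp add: avg_def upd_upd)

lemma fold_avg_bounds:
  fixes F :: "'a::euclidean_space \<Rightarrow> real"
  assumes "F \<in> borel_measurable borel" "\<And>x. l \<le> F x" "\<And>x. F x \<le> u"
  shows "fold avg bs F \<in> borel_measurable borel" "l \<le> fold avg bs F x" "fold avg bs F x \<le> u"
proof -
  have "fold avg bs F \<in> borel_measurable borel \<and> (\<forall>x. l \<le> fold avg bs F x \<and> fold avg bs F x \<le> u)"
    using assms
  proof (induction bs arbitrary: F)
    case (Cons b bs)
    then show ?case using avg_bounds[OF Cons.prems] by simp
  qed simp
  then show "fold avg bs F \<in> borel_measurable borel" "l \<le> fold avg bs F x" "fold avg bs F x \<le> u" by auto
qed

text \<open>An average over a further coordinate preserves the invariance already gained, because
  changes of different coordinates commute.\<close>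

lemma fold_avg_indep:
  assumes "set bs \<subseteq> Basis" "b \<in> set bs"
  shows "fold avg bs F (upd b x t) = fold avg bs F x"
  using assms
proof (induction bs arbitrary: x rule: rev_induct)
  case (snoc c bs)
  have c: "c \<in> Basis" using snoc.prems by auto
  show ?case
  proof (cases "b = c")
    case True
    then show ?thesis using c by (simp add: avg_upd)
  next
    case False
    define G where "G = fold avg bs F"
    have "G (upd b x t) = G x" for x using False snoc unfolding G_def by auto
    moreover have "upd c (upd b x t) s = upd b (upd c x s) t" for s
      using False c snoc.prems by (intro upd_commute) auto
    ultimately have "avg c G (upd b x t) = avg c G x" by (simp add: avg_def)
    then show ?thesis by (simp add: G_def)
  qed
qed simp

text \<open>The coordinates of \<open>x\<close> are set to 0 one after another.\<close>

lemma upd_invariant_constant: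
  fixes G :: "'a::euclidean_space \<Rightarrow> real"
  assumes "\<And>b x t. b \<in> Basis \<Longrightarrow> G (upd b x t) = G x"
  shows "G x = G 0"
proof -
  have "G (x - (\<Sum>b\<in>S. (x \<bullet> b) *\<^sub>R b)) = G x" if "finite S" "S \<subseteq> Basis" for S
    using that
  proof (induction S rule: finite_induct)
    case (insert c S)
    let ?y = "x - (\<Sum>b\<in>S. (x \<bullet> b) *\<^sub>R b)"
    have "(\<Sum>b\<in>S. (x \<bullet> b) * (b \<bullet> c)) = 0"
    proof (rule sum.neutral, rule ballI)
      fix b assume "b \<in> S"
      then have "b \<bullet> c = 0" using insert by (intro inner_not_same_Basis) auto
      then show "(x \<bullet> b) * (b \<bullet> c) = 0" by simp
    qed
    then have "?y \<bullet> c = x \<bullet> c" by (simp add: inner_diff_left inner_sum_left)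
    then have "x - (\<Sum>b\<in>insert c S. (x \<bullet> b) *\<^sub>R b) = upd c ?y 0"
      using insert by (simp add: upd_def algebra_simps)
    then show ?case using assms[of c ?y 0] insert by simp
  qed simp
  from this[of Basis] show ?thesis by (simp add: euclidean_representation)
qed

lemma fold_avg_integral:
  fixes F :: "'a::euclidean_space \<Rightarrow> real"
  assumes "set bs \<subseteq> Basis" "F \<in> borel_measurable borel" "\<And>x. l \<le> F x" "\<And>x. F x \<le> u"
  shows "(\<integral>x. fold avg bs F x \<partial>std_gaussian) = (\<integral>x. F x \<partial>std_gaussian)"
  using assms
proof (induction bs arbitrary: F)
  case (Cons b bs)
  have "\<bar>F x\<bar> \<le> \<bar>l\<bar> + \<bar>u\<bar>" for x using Cons.prems(3,4)[of x] by linarith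
  then have i: "integrable std_gaussian F" using Cons.prems by (intro std_gaussian_integrable_bounded)
  have "(\<integral>x. fold avg bs (avg b F) x \<partial>std_gaussian) = (\<integral>x. avg b F x \<partial>std_gaussian)"
    using Cons.prems avg_bounds[OF Cons.prems(2-4)] by (intro Cons.IH) auto
  then show ?case using avg_integral(3)[OF _ Cons.prems(2) i, of b] Cons.prems(1) by simp
qed simp

text \<open>After all coordinates have been averaged the function is constant, and each average
  preserved the integral. This takes the place of a representation of the Gaussian measure as a
  product.\<close>

lemma fold_avg_Basis:
  fixes F :: "'a::euclidean_space \<Rightarrow> real"
  assumes "set bs = Basis" "F \<in> borel_measurable borel" "\<And>x. l \<le> F x" "\<And>x. F x \<le> u"
  shows "fold avg bs F x = (\<integral>x. F x \<partial>std_gaussian)"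
proof -
  have c: "fold avg bs F x = fold avg bs F 0" for x
    using assms(1) by (intro upd_invariant_constant fold_avg_indep) auto
  have "(\<integral>x. F x \<partial>std_gaussian) = (\<integral>x. fold avg bs F x \<partial>std_gaussian)"
    using assms by (subst fold_avg_integral) auto
  also have "\<dots> = (\<integral>x. fold avg bs F 0 \<partial>(std_gaussian :: 'a measure))" by (subst c) simp
  finally show ?thesis using c[of x] std_gaussian_measure_space[where 'a='a] by simp
qed

text \<open>Gibbs' inequality: the entropy of \<open>f / m\<close> relative to \<open>q / Q\<close>
  is nonnegative. Pointwise it is \<open>ln t \<le> t - 1\<close> for
  \<open>t = q x * m / (Q * f x)\<close>, whose right side contributes 0 after integration.\<close>

lemma gauss1_gibbs:
  fixes f q :: "real \<Rightarrow> real"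
  assumes [measurable]: "f \<in> borel_measurable borel" "q \<in> borel_measurable borel" and \<alpha>: "0 < \<alpha>"
    and f: "\<And>x. \<alpha> \<le> f x" "\<And>x. f x \<le> M" and q: "\<And>x. \<alpha> \<le> q x" "\<And>x. q x \<le> M"
  shows "(\<integral>x. f x * (ln (q x) - ln (\<integral>x. q x \<partial>gauss1)) \<partial>gauss1)
    \<le> (\<integral>x. f x * ln (f x) \<partial>gauss1) - (\<integral>x. f x \<partial>gauss1) * ln (\<integral>x. f x \<partial>gauss1)"
proof -
  define m Q where "m = (\<integral>x. f x \<partial>gauss1)" and "Q = (\<integral>x. q x \<partial>gauss1)"
  note ef = gauss1_entropy_identity[OF assms(1) \<alpha> f m_def]
  note eq = gauss1_entropy_identity[OF assms(2) \<alpha> q Q_def]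
  have pos: "0 < m" "0 < Q" using ef(2) eq(2) \<alpha> by linarith+
  have fpos: "0 < f x" and qpos: "0 < q x" for x using f(1)[of x] q(1)[of x] \<alpha> by linarith+
  have li: "integrable gauss1 (\<lambda>x. f x * (ln (q x) - ln Q))"
  proof (rule gauss1_integrable_bounded)
    show "\<bar>f x * (ln (q x) - ln Q)\<bar> \<le> M * (\<bar>ln \<alpha>\<bar> + \<bar>ln M\<bar> + \<bar>ln Q\<bar>)" for x
    proof -
      have "ln \<alpha> \<le> ln (q x)" "ln (q x) \<le> ln M" using q[of x] \<alpha> qpos[of x] by (auto intro!: ln_mono)
      then have "\<bar>ln (q x) - ln Q\<bar> \<le> \<bar>ln \<alpha>\<bar> + \<bar>ln M\<bar> + \<bar>ln Q\<bar>" by linarith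
      then show ?thesis using f[of x] fpos[of x] by (simp add: abs_mult mult_mono)
    qed
  qed measurable
  have pt: "f x * (ln (q x) - ln Q) \<le> f x * ln (f x / m) + (m / Q * q x - f x)" for x
  proof -
    have "ln (q x * m / (Q * f x)) \<le> q x * m / (Q * f x) - 1"
      using pos fpos[of x] qpos[of x] by (intro ln_le_minus_one) auto
    moreover have "ln (q x * m / (Q * f x)) = ln (q x) - ln Q - ln (f x / m)"
      using pos fpos[of x] qpos[of x] by (simp add: ln_div ln_mult)
    ultimately have "f x * (ln (q x) - ln Q - ln (f x / m)) \<le> f x * (q x * m / (Q * f x) - 1)"
      using fpos[of x] by (intro mult_left_mono) auto
    also have "\<dots> = m / Q * q x - f x" using pos fpos[of x] qpos[of x] by (simp add: field_simps)
    finally show ?thesis by (simp add: algebra_simps)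
  qed
  have "(\<integral>x. f x * (ln (q x) - ln Q) \<partial>gauss1) \<le> (\<integral>x. f x * ln (f x / m) + (m / Q * q x - f x) \<partial>gauss1)"
    using pt li ef(1,4) eq(1) by (intro integral_mono) auto
  also have "\<dots> = (\<integral>x. f x * ln (f x / m) \<partial>gauss1) + (m / Q * Q - m)"
    using ef(1,4) eq(1) by (simp add: m_def Q_def)
  also have "\<dots> = (\<integral>x. f x * ln (f x) \<partial>gauss1) - m * ln m" using pos ef(5) by simp
  finally show ?thesis by (simp add: m_def Q_def)
qed

definition slice_ent :: "'a::euclidean_space \<Rightarrow> ('a \<Rightarrow> real) \<Rightarrow> 'a \<Rightarrow> real" where
  "slice_ent b F x = avg b (\<lambda>y. F y * ln (F y)) x - avg b F x * ln (avg b F x)"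

lemma xlnx_bound:
  fixes y :: real
  assumes "0 < \<alpha>" "\<alpha> \<le> y" "y \<le> M" "\<alpha> \<le> z" "z \<le> M"
  shows "\<bar>y * ln z\<bar> \<le> M * (\<bar>ln \<alpha>\<bar> + \<bar>ln M\<bar>)"
proof -
  have "ln \<alpha> \<le> ln z" "ln z \<le> ln M" using assms by (auto intro!: ln_mono)
  then have "\<bar>ln z\<bar> \<le> \<bar>ln \<alpha>\<bar> + \<bar>ln M\<bar>" by linarith
  then show ?thesis using assms by (simp add: abs_mult mult_mono)
qed

lemma slice_ent_integrable:
  fixes F :: "'a::euclidean_space \<Rightarrow> real"
  assumes [measurable]: "F \<in> borel_measurable borel" and \<alpha>: "0 < \<alpha>" and F: "\<And>x. \<alpha> \<le> F x" "\<And>x. F x \<le> M"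
    and b: "b \<in> Basis"
  shows "integrable std_gaussian (slice_ent b F)"
  unfolding slice_ent_def[abs_def]
proof (rule Bochner_Integration.integrable_diff)
  show "integrable std_gaussian (avg b (\<lambda>y. F y * ln (F y)))"
    using xlnx_bound[OF \<alpha> F F] by (intro avg_integral(2)[OF b] std_gaussian_integrable_bounded) auto
  show "integrable std_gaussian (\<lambda>x. avg b F x * ln (avg b F x))"
    using xlnx_bound[OF \<alpha> avg_bounds[OF assms(1) F] avg_bounds[OF assms(1) F]]
    by (intro std_gaussian_integrable_bounded) auto
qed

text \<open>On a line parallel to \<open>b\<close> the function \<open>avg b q\<close> is the
  constant mean of \<open>q\<close>, so Gibbs' inequality bounds the integral of
  \<open>F * ln (q / avg b q)\<close> over the line by the entropy of \<open>F\<close> there.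
  Integration over all lines gives the claim.\<close>

lemma entropy_subadditivity_step:
  fixes F q :: "'a::euclidean_space \<Rightarrow> real"
  assumes [measurable]: "F \<in> borel_measurable borel" "q \<in> borel_measurable borel" and \<alpha>: "0 < \<alpha>"
    and F: "\<And>x. \<alpha> \<le> F x" "\<And>x. F x \<le> M" and q: "\<And>x. \<alpha> \<le> q x" "\<And>x. q x \<le> M" and b: "b \<in> Basis"
  shows "(\<integral>x. F x * ln (q x) \<partial>std_gaussian)
    \<le> (\<integral>x. slice_ent b F x \<partial>std_gaussian) + (\<integral>x. F x * ln (avg b q x) \<partial>std_gaussian)"
proof -
  note qb = avg_bounds[OF assms(2) q, of b]
  have i1: "integrable std_gaussian (\<lambda>x. F x * ln (q x))"
    by (rule std_gaussian_integrable_bounded[OF _ xlnx_bound[OF \<alpha> F q]]) measurable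
  have i2: "integrable std_gaussian (\<lambda>x. F x * ln (avg b q x))"
    by (rule std_gaussian_integrable_bounded[OF _ xlnx_bound[OF \<alpha> F qb]]) measurable
  have i: "integrable std_gaussian (\<lambda>x. F x * (ln (q x) - ln (avg b q x)))"
    using Bochner_Integration.integrable_diff[OF i1 i2] by (simp add: right_diff_distrib)
  have "(\<integral>x. F x * ln (q x) \<partial>std_gaussian) - (\<integral>x. F x * ln (avg b q x) \<partial>std_gaussian)
      = (\<integral>x. F x * (ln (q x) - ln (avg b q x)) \<partial>std_gaussian)"
    using i1 i2 by (simp add: right_diff_distrib)
  also have "\<dots> = (\<integral>x. avg b (\<lambda>x. F x * (ln (q x) - ln (avg b q x))) x \<partial>std_gaussian)"
    by (rule avg_integral(3)[OF b _ i, symmetric]) measurable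
  also have "\<dots> \<le> (\<integral>x. slice_ent b F x \<partial>std_gaussian)"
  proof (rule integral_mono)
    show "integrable std_gaussian (avg b (\<lambda>x. F x * (ln (q x) - ln (avg b q x))))"
      by (rule avg_integral(2)[OF b _ i]) measurable
    show "integrable std_gaussian (slice_ent b F)" by (rule slice_ent_integrable[OF assms(1) \<alpha> F b])
    fix x
    have "(\<integral>t. F (upd b x t) * (ln (q (upd b x t)) - ln (\<integral>t. q (upd b x t) \<partial>gauss1)) \<partial>gauss1)
      \<le> (\<integral>t. F (upd b x t) * ln (F (upd b x t)) \<partial>gauss1)
        - (\<integral>t. F (upd b x t) \<partial>gauss1) * ln (\<integral>t. F (upd b x t) \<partial>gauss1)"
      by (rule gauss1_gibbs[OF _ _ \<alpha> F q]) measurable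
    then show "avg b (\<lambda>x. F x * (ln (q x) - ln (avg b q x))) x \<le> slice_ent b F x"
      unfolding slice_ent_def avg_def[of b "\<lambda>x. F x * (ln (q x) - ln (avg b q x))"] avg_upd[OF b]
      by (simp add: avg_def)
  qed
  finally show ?thesis by simp
qed

text \<open>The logarithm of \<open>q\<close> is telescoped along its successive averages. With
  \<open>q = F\<close> and all coordinates, the last average is the mean of \<open>F\<close>, while
  every term of the sum is an entropy of \<open>F\<close> itself and not of an average.\<close>

lemma entropy_subadditivity_list:
  fixes F q :: "'a::euclidean_space \<Rightarrow> real"
  assumes F[measurable]: "F \<in> borel_measurable borel" and \<alpha>: "0 < \<alpha>" "\<And>x. \<alpha> \<le> F x" "\<And>x. F x \<le> M"
    and "q \<in> borel_measurable borel" "\<And>x. \<alpha> \<le> q x" "\<And>x. q x \<le> M" and "set bs \<subseteq> Basis"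
  shows "(\<integral>x. F x * ln (q x) \<partial>std_gaussian)
    \<le> (\<Sum>b\<leftarrow>bs. (\<integral>x. slice_ent b F x \<partial>std_gaussian)) + (\<integral>x. F x * ln (fold avg bs q x) \<partial>std_gaussian)"
  using assms(5-)
proof (induction bs arbitrary: q)
  case (Cons b bs)
  have "(\<integral>x. F x * ln (q x) \<partial>std_gaussian)
    \<le> (\<integral>x. slice_ent b F x \<partial>std_gaussian) + (\<integral>x. F x * ln (avg b q x) \<partial>std_gaussian)"
    using Cons.prems by (intro entropy_subadditivity_step[OF F _ \<alpha>]) auto
  also have "(\<integral>x. F x * ln (avg b q x) \<partial>std_gaussian)
    \<le> (\<Sum>b\<leftarrow>bs. (\<integral>x. slice_ent b F x \<partial>std_gaussian)) + (\<integral>x. F x * ln (fold avg bs (avg b q) x) \<partial>std_gaussian)"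
    using Cons.prems avg_bounds[OF Cons.prems(1-3)] by (intro Cons.IH) auto
  finally show ?case by simp
qed simp

theorem entropy_subadditivity:
  fixes F :: "'a::euclidean_space \<Rightarrow> real"
  assumes F[measurable]: "F \<in> borel_measurable borel" and \<alpha>: "0 < \<alpha>" "\<And>x. \<alpha> \<le> F x" "\<And>x. F x \<le> M"
  shows "(\<integral>x. F x * ln (F x) \<partial>std_gaussian) - (\<integral>x. F x \<partial>std_gaussian) * ln (\<integral>x. F x \<partial>std_gaussian)
    \<le> (\<Sum>b\<in>Basis. (\<integral>x. slice_ent b F x \<partial>std_gaussian))"
proof -
  obtain bs where bs: "set bs = (Basis :: 'a set)" "distinct bs" using finite_distinct_list[OF finite_Basis] by auto
  have "(\<integral>x. F x * ln (F x) \<partial>std_gaussian)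
    \<le> (\<Sum>b\<leftarrow>bs. (\<integral>x. slice_ent b F x \<partial>std_gaussian)) + (\<integral>x. F x * ln (fold avg bs F x) \<partial>std_gaussian)"
    using bs by (intro entropy_subadditivity_list[OF F \<alpha> F \<alpha>(2,3)]) auto
  also have "(\<integral>x. F x * ln (fold avg bs F x) \<partial>std_gaussian) = (\<integral>x. F x \<partial>std_gaussian) * ln (\<integral>x. F x \<partial>std_gaussian)"
    unfolding fold_avg_Basis[OF bs(1) F \<alpha>(2,3)] by simp
  finally show ?thesis using bs by (simp add: sum_list_distinct_conv_sum_set)
qed

text \<open>With \<open>G\<close> the average over \<open>bs\<close>, split
  \<open>F - avg b G\<close> into \<open>F - avg b F\<close> and \<open>avg b (F - G)\<close>; the
  average over \<open>b\<close> does not increase the L1 norm of \<open>F - G\<close>.\<close>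

lemma avg_deviation_list:
  fixes F :: "'a::euclidean_space \<Rightarrow> real"
  assumes F[measurable]: "F \<in> borel_measurable borel" and lu: "\<And>x. l \<le> F x" "\<And>x. F x \<le> u" and "set bs \<subseteq> Basis"
  shows "(\<integral>x. \<bar>F x - fold avg bs F x\<bar> \<partial>std_gaussian) \<le> (\<Sum>b\<leftarrow>bs. (\<integral>x. \<bar>F x - avg b F x\<bar> \<partial>std_gaussian))"
  using assms(4)
proof (induction bs rule: rev_induct)
  case (snoc b bs)
  define G where "G = fold avg bs F"
  note G = fold_avg_bounds[OF F lu, of bs, folded G_def]
  have [measurable]: "G \<in> borel_measurable borel" by (rule G)
  have b: "b \<in> Basis" using snoc by simp
  have int: "integrable std_gaussian F" "integrable std_gaussian G" "integrable std_gaussian (avg b F)"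
      "integrable std_gaussian (avg b G)" "integrable gauss1 (\<lambda>t. F (upd b x t))" "integrable gauss1 (\<lambda>t. G (upd b x t))" for x
  proof -
    have bd: "\<bar>F x\<bar> \<le> \<bar>l\<bar> + \<bar>u\<bar>" "\<bar>G x\<bar> \<le> \<bar>l\<bar> + \<bar>u\<bar>" for x
      using lu[of x] G(2,3)[of x] by linarith+
    show "integrable std_gaussian F" "integrable std_gaussian G"
      using bd by (auto intro!: std_gaussian_integrable_bounded)
    then show "integrable std_gaussian (avg b F)" "integrable std_gaussian (avg b G)"
      by (auto intro!: avg_integral(2)[OF b])
    show "integrable gauss1 (\<lambda>t. F (upd b x t))" "integrable gauss1 (\<lambda>t. G (upd b x t))"
      using bd by (auto intro!: gauss1_integrable_bounded)
  qed
  have "(\<integral>x. \<bar>avg b F x - avg b G x\<bar> \<partial>std_gaussian) \<le> (\<integral>x. avg b (\<lambda>y. \<bar>F y - G y\<bar>) x \<partial>std_gaussian)"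
  proof (rule integral_mono)
    show "integrable std_gaussian (avg b (\<lambda>y. \<bar>F y - G y\<bar>))" using int by (intro avg_integral(2)[OF b]) auto
    show "\<bar>avg b F x - avg b G x\<bar> \<le> avg b (\<lambda>y. \<bar>F y - G y\<bar>) x" for x
      unfolding avg_def Bochner_Integration.integral_diff[OF int(5,6), symmetric] by (rule integral_abs_bound)
  qed (use int in auto)
  also have "\<dots> = (\<integral>x. \<bar>F x - G x\<bar> \<partial>std_gaussian)"
    using int by (intro avg_integral(3)[OF b]) auto
  also have "\<dots> \<le> (\<Sum>b\<leftarrow>bs. (\<integral>x. \<bar>F x - avg b F x\<bar> \<partial>std_gaussian))"
    using snoc unfolding G_def by simp
  finally have 1: "(\<integral>x. \<bar>avg b F x - avg b G x\<bar> \<partial>std_gaussian) \<le> (\<Sum>b\<leftarrow>bs. (\<integral>x. \<bar>F x - avg b F x\<bar> \<partial>std_gaussian))" .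
  have "(\<integral>x. \<bar>F x - avg b G x\<bar> \<partial>std_gaussian) \<le> (\<integral>x. \<bar>F x - avg b F x\<bar> + \<bar>avg b F x - avg b G x\<bar> \<partial>std_gaussian)"
    using int by (intro integral_mono) auto
  also have "\<dots> = (\<integral>x. \<bar>F x - avg b F x\<bar> \<partial>std_gaussian) + (\<integral>x. \<bar>avg b F x - avg b G x\<bar> \<partial>std_gaussian)"
    using int by (intro Bochner_Integration.integral_add) auto
  finally show ?case using 1 by (simp add: G_def)
qed simp

theorem avg_deviation:
  fixes F :: "'a::euclidean_space \<Rightarrow> real"
  assumes F[measurable]: "F \<in> borel_measurable borel" and lu: "\<And>x. l \<le> F x" "\<And>x. F x \<le> u"
  shows "(\<integral>x. \<bar>F x - (\<integral>x. F x \<partial>std_gaussian)\<bar> \<partial>std_gaussian) \<le> (\<Sum>b\<in>Basis. (\<integral>x. \<bar>F x - avg b F x\<bar> \<partial>std_gaussian))"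
proof -
  obtain bs where bs: "set bs = (Basis :: 'a set)" "distinct bs" using finite_distinct_list[OF finite_Basis] by auto
  show ?thesis
    using avg_deviation_list[OF F lu, of bs] bs
    unfolding fold_avg_Basis[OF bs(1) F lu] by (simp add: sum_list_distinct_conv_sum_set)
qed

section \<open>Test functions\<close>

lemma Ck_continuous: "Ck k \<phi> \<Longrightarrow> continuous_on UNIV \<phi>"
  by (cases k) (auto intro!: continuous_at_imp_continuous_on differentiable_imp_continuous_within)

lemma Ck_Suc_imp: "Ck (Suc k) \<phi> \<Longrightarrow> Ck k \<phi>"
proof (induction k arbitrary: \<phi>)
  case 0
  from Ck_continuous[OF this] show ?case by simp
next
  case (Suc k)
  then have "\<forall>x. \<phi> differentiable (at x)" "\<forall>b\<in>Basis. Ck (Suc k) (\<lambda>x. frechet_derivative \<phi> (at x) b)"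
    by (auto simp only: Ck.simps(2))
  then show ?case using Suc.IH unfolding Ck.simps(2) by blast
qed

lemma Ck_const: "Ck k (\<lambda>x. c)"
proof (induction k arbitrary: c)
  case (Suc k)
  then show ?case by (simp add: frechet_derivative_const)
qed simp

lemma Ck_add: "Ck k p \<Longrightarrow> Ck k q \<Longrightarrow> Ck k (\<lambda>x. p x + q x)"
proof (induction k arbitrary: p q)
  case 0
  then show ?case by (auto intro: continuous_intros)
next
  case (Suc k)
  have d: "p differentiable (at x)" "q differentiable (at x)" for x using Suc.prems by auto
  have "frechet_derivative (\<lambda>x. p x + q x) (at x) = (\<lambda>v. frechet_derivative p (at x) v + frechet_derivative q (at x) v)" for x
    using d[of x] by (intro frechet_derivative_at[symmetric] has_derivative_add) (auto simp: frechet_derivative_works)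
  then show ?case using Suc d by auto
qed

lemma frechet_derivative_mult_real:
  fixes p q :: "'a::real_normed_vector \<Rightarrow> real"
  assumes "p differentiable (at x)" "q differentiable (at x)"
  shows "frechet_derivative (\<lambda>x. p x * q x) (at x) v = p x * frechet_derivative q (at x) v + frechet_derivative p (at x) v * q x"
proof -
  have "((\<lambda>x. p x * q x) has_derivative
      (\<lambda>v. p x * frechet_derivative q (at x) v + frechet_derivative p (at x) v * q x)) (at x)"
    using assms by (intro has_derivative_mult) (auto simp: frechet_derivative_works)
  from frechet_derivative_at[OF this] show ?thesis by (simp add: fun_eq_iff)
qed

lemma Ck_mult: "Ck k p \<Longrightarrow> Ck k q \<Longrightarrow> Ck k (\<lambda>x. p x * q x)"
proof (induction k arbitrary: p q)
  case 0
  then show ?case by (auto intro: continuous_intros)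
next
  case (Suc k)
  have d: "p differentiable (at x)" "q differentiable (at x)" for x using Suc.prems by auto
  show ?case
    using Suc.prems Suc.IH Suc.prems[THEN Ck_Suc_imp] d
    by (auto simp: frechet_derivative_mult_real intro!: Ck_add)
qed

lemma Ck_prod: "finite I \<Longrightarrow> (\<And>i. i \<in> I \<Longrightarrow> Ck k (p i)) \<Longrightarrow> Ck k (\<lambda>x. \<Prod>i\<in>I. p i x)"
  by (induction I rule: finite_induct) (auto intro: Ck_const Ck_mult)

text \<open>The polynomial factor in \<open>1 / t\<close> makes the family closed under
  differentiation, so all orders of smoothness follow by one induction. As \<open>c\<close> tends to
  0 with \<open>p = 1\<close>, the function increases to the indicator of the positive
  half-line.\<close>

definition bump :: "real \<Rightarrow> real poly \<Rightarrow> real \<Rightarrow> real" where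
  "bump c p t = (if 0 < t then poly p (1 / t) * exp (- c / t) else 0)"

lemma poly_mult_exp_tendsto_0:
  fixes p :: "real poly"
  assumes "0 < c"
  shows "((\<lambda>s. poly p s * exp (- c * s)) \<longlongrightarrow> 0) at_top"
  using assms
proof (induction p arbitrary: c)
  case (pCons a p)
  have lin: "filterlim (\<lambda>s::real. e * s) at_top at_top" if "0 < e" for e
    using that by (intro filterlim_tendsto_pos_mult_at_top[OF tendsto_const]) (auto simp: filterlim_ident)
  have e0: "((\<lambda>s. exp (- c * s)) \<longlongrightarrow> 0) at_top"
    using lin[OF pCons.prems] by (intro filterlim_compose[OF exp_at_bot]) (simp add: filterlim_uminus_at_bot)
  have "((\<lambda>s. (c / 2 * s) ^ 1 / exp (c / 2 * s)) \<longlongrightarrow> 0) at_top"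
    using pCons.prems by (intro filterlim_compose[OF tendsto_power_div_exp_0] lin) auto
  then have "((\<lambda>s. 2 / c * ((c / 2 * s) ^ 1 / exp (c / 2 * s))) \<longlongrightarrow> 0) at_top"
    by (rule tendsto_mult_right_zero)
  moreover have "((\<lambda>s. poly p s * exp (- (c / 2) * s)) \<longlongrightarrow> 0) at_top"
    using pCons.prems by (intro pCons.IH) auto
  ultimately have "((\<lambda>s. 2 / c * ((c / 2 * s) ^ 1 / exp (c / 2 * s)) * (poly p s * exp (- (c / 2) * s))) \<longlongrightarrow> 0) at_top"
    by (rule tendsto_mult_zero)
  then have "((\<lambda>s. a * exp (- c * s) + 2 / c * ((c / 2 * s) ^ 1 / exp (c / 2 * s)) * (poly p s * exp (- (c / 2) * s))) \<longlongrightarrow> a * 0 + 0) at_top"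
    using e0 by (intro tendsto_intros)
  moreover have "a * exp (- c * s) + 2 / c * ((c / 2 * s) ^ 1 / exp (c / 2 * s)) * (poly p s * exp (- (c / 2) * s))
      = poly (pCons a p) s * exp (- c * s)" for s
  proof -
    have "exp (- c * s) = exp (- (c / 2) * s) * exp (- (c / 2) * s)" by (simp flip: exp_add)
    moreover have "1 / exp (c / 2 * s) = exp (- (c / 2) * s)" by (simp add: exp_minus field_simps)
    ultimately show ?thesis using pCons.prems by (simp add: field_simps)
  qed
  ultimately show ?case by simp
qed simp

text \<open>In the variable \<open>s = 1 / t\<close> differentiation by \<open>t\<close> is
  \<open>- s\<^sup>2\<close> times differentiation by \<open>s\<close>. At 0 the difference quotient
  is again of this form, with \<open>p\<close> multiplied by \<open>s\<close>, and tends to 0 by the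
  decay of the exponential.\<close>

lemma DERIV_bump:
  assumes c: "0 < c"
  shows "(bump c p has_real_derivative bump c ([:0, 0, 1:] * (smult c p - pderiv p)) t) (at t)"
proof -
  consider "0 < t" | "t < 0" | "t = 0" by linarith
  then show ?thesis
  proof cases
    case 1
    have "((\<lambda>t. poly p (1 / t) * exp (- c / t)) has_real_derivative bump c ([:0, 0, 1:] * (smult c p - pderiv p)) t) (at t)"
      using 1 by (auto intro!: derivative_eq_intros simp: bump_def power2_eq_square field_simps)
    then show ?thesis
      by (rule has_field_derivative_transform_within_open[where S="{0<..}"]) (use 1 in \<open>auto simp: bump_def\<close>)
  next
    case 2
    have "((\<lambda>t. 0) has_real_derivative bump c ([:0, 0, 1:] * (smult c p - pderiv p)) t) (at t)"
      using 2 by (simp add: bump_def)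
    then show ?thesis
      by (rule has_field_derivative_transform_within_open[where S="{..<0}"]) (use 2 in \<open>auto simp: bump_def\<close>)
  next
    case 3
    have "((\<lambda>h. bump c p h / h) \<longlongrightarrow> 0) (at 0)"
    proof (rule filterlim_split_at)
      have "eventually (\<lambda>h. 0 = bump c p h / h) (at_left 0)"
        by (rule eventually_at_leftI[of "-1"]) (auto simp: bump_def)
      then show "((\<lambda>h. bump c p h / h) \<longlongrightarrow> 0) (at_left 0)" by (rule Lim_transform_eventually[OF tendsto_const])
      have "((\<lambda>h. poly (pCons 0 p) (inverse h) * exp (- c * inverse h)) \<longlongrightarrow> 0) (at_right 0)"
        by (rule filterlim_compose[OF poly_mult_exp_tendsto_0[OF c] filterlim_inverse_at_top_right])
      moreover have "eventually (\<lambda>h. poly (pCons 0 p) (inverse h) * exp (- c * inverse h) = bump c p h / h) (at_right 0)"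
        by (rule eventually_at_rightI[of _ 1]) (auto simp: bump_def field_simps)
      ultimately show "((\<lambda>h. bump c p h / h) \<longlongrightarrow> 0) (at_right 0)" by (rule Lim_transform_eventually)
    qed
    then show ?thesis unfolding has_field_derivative_iff 3 by (simp add: bump_def)
  qed
qed

lemma Ck_bump:
  assumes c: "0 < c"
  shows "Ck k (\<lambda>x. bump c p (x \<bullet> v + r))"
proof (induction k arbitrary: p)
  case 0
  have "continuous_on UNIV (bump c p)" using DERIV_bump[OF c] DERIV_isCont by (metis continuous_at_imp_continuous_on)
  then show ?case by (auto intro!: continuous_on_compose2[of UNIV "bump c p"] continuous_intros)
next
  case (Suc k)
  define q where "q = [:0, 0, 1:] * (smult c p - pderiv p)"
  have D: "((\<lambda>x. bump c p (x \<bullet> v + r)) has_derivative (\<lambda>d. bump c q (x \<bullet> v + r) * (d \<bullet> v))) (at x)" for x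
    by (rule DERIV_compose_FDERIV[OF DERIV_bump[OF c, folded q_def], THEN has_derivative_eq_rhs])
       (auto intro!: derivative_eq_intros simp: q_def mult.commute)
  have eq: "frechet_derivative (\<lambda>x. bump c p (x \<bullet> v + r)) (at x) = (\<lambda>d. bump c q (x \<bullet> v + r) * (d \<bullet> v))" for x
    using frechet_derivative_at[OF D] by simp
  have "Ck k (\<lambda>x. bump c q (x \<bullet> v + r) * (d \<bullet> v))" for d by (intro Ck_mult Suc.IH Ck_const)
  then show ?case using D by (auto simp: eq differentiable_def)
qed

text \<open>Smooth functions between 0 and the indicator of the box, converging to it as
  \<open>c\<close> tends to 0. Translates are again of this form, which the proof of absolute
  continuity along lines relies on.\<close>

definition box_bump :: "'a::euclidean_space \<Rightarrow> 'a \<Rightarrow> real \<Rightarrow> 'a \<Rightarrow> real" where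
  "box_bump a b c x = (\<Prod>i\<in>Basis. bump c 1 (x \<bullet> i + - (a \<bullet> i)) * bump c 1 (x \<bullet> (- i) + b \<bullet> i))"

lemma bump_1_bounds: "0 < c \<Longrightarrow> 0 \<le> bump c 1 t \<and> bump c 1 t \<le> 1"
  by (auto simp: bump_def)

lemma box_bump_bounds: "0 < c \<Longrightarrow> 0 \<le> box_bump a b c x" "0 < c \<Longrightarrow> box_bump a b c x \<le> 1"
  unfolding box_bump_def using bump_1_bounds[of c]
  by (auto intro!: prod_nonneg prod_le_1 mult_nonneg_nonneg mult_le_one)

lemma box_bump_outside: "x \<notin> box a b \<Longrightarrow> box_bump a b c x = 0"
proof -
  assume "x \<notin> box a b"
  then obtain i where i: "i \<in> Basis" "\<not> (a \<bullet> i < x \<bullet> i \<and> x \<bullet> i < b \<bullet> i)" by (auto simp: mem_box)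
  then have "bump c 1 (x \<bullet> i + - (a \<bullet> i)) * bump c 1 (x \<bullet> (- i) + b \<bullet> i) = 0" by (auto simp: bump_def)
  then show ?thesis unfolding box_bump_def using i(1) by (intro prod_zero) auto
qed

lemma box_bump_translate: "box_bump a b c (x - v) = box_bump (a + v) (b + v) c x"
  unfolding box_bump_def by (intro prod.cong) (simp_all add: inner_diff_left inner_add_left algebra_simps)

lemma test_function_box_bump:
  assumes "0 < c"
  shows "test_function (box_bump a b c)"
  unfolding test_function_def
proof (intro conjI allI)
  show "Ck k (box_bump a b c)" for k
    unfolding box_bump_def[abs_def] by (intro Ck_prod Ck_mult Ck_bump assms) auto
  have "{x. box_bump a b c x \<noteq> 0} \<subseteq> box a b" using box_bump_outside by blast
  then show "compact (closure {x. box_bump a b c x \<noteq> 0})"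
    using bounded_subset[OF bounded_box] by (simp add: compact_closure)
qed

lemma box_bump_tendsto:
  fixes x :: "'a::euclidean_space"
  shows "(\<lambda>j. box_bump a b (1 / real (Suc j)) x) \<longlonglongrightarrow> indicator (box a b) x"
proof (cases "x \<in> box a b")
  case True
  have "(\<lambda>j. bump (1 / real (Suc j)) 1 t) \<longlonglongrightarrow> 1" if "0 < t" for t
  proof -
    have "(\<lambda>j. exp (- (1 / real (Suc j)) / t)) \<longlonglongrightarrow> exp (- 0 / t)"
      using LIMSEQ_Suc[OF lim_1_over_n] that by (intro tendsto_intros) auto
    then show ?thesis using that by (simp add: bump_def)
  qed
  then have "(\<lambda>j. box_bump a b (1 / real (Suc j)) x) \<longlonglongrightarrow> (\<Prod>i\<in>(Basis :: 'a set). 1 * 1)"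
    unfolding box_bump_def using True by (intro tendsto_prod tendsto_mult) (auto simp: mem_box)
  then show ?thesis using True by simp
qed (simp add: box_bump_outside)

section \<open>The fundamental lemma of the calculus of variations\<close>

lemma locally_integrable_measurable:
  assumes "locally_integrable u"
  shows "u \<in> borel_measurable borel"
proof (rule borel_measurable_LIMSEQ_metric)
  show "(\<lambda>x. indicator (cball 0 (real n)) x *\<^sub>R u x) \<in> borel_measurable borel" for n
  proof -
    have "set_integrable lborel (cball 0 (real n)) u" using assms by (simp add: locally_integrable_def)
    from borel_measurable_integrable[OF this[unfolded set_integrable_def]] show ?thesis by simp
  qed
  show "(\<lambda>n. indicator (cball 0 (real n)) x *\<^sub>R u x) \<longlonglongrightarrow> u x" for x
  proof (rule tendsto_eventually)
    obtain N :: nat where "norm x \<le> real N" using real_arch_simple by blast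
    then show "\<forall>\<^sub>F n in sequentially. indicator (cball 0 (real n)) x *\<^sub>R u x = u x"
      by (intro eventually_sequentiallyI[of N]) (auto simp: indicator_def)
  qed
qed

lemma locally_integrable_mult_bounded:
  fixes w \<psi> :: "'a::euclidean_space \<Rightarrow> real"
  assumes w: "locally_integrable w" and [measurable]: "\<psi> \<in> borel_measurable borel"
    and \<psi>: "\<And>x. \<bar>\<psi> x\<bar> \<le> B" "\<And>x. \<psi> x \<noteq> 0 \<Longrightarrow> x \<in> K" and K: "compact K"
  shows "integrable lborel (\<lambda>x. w x * \<psi> x)"
proof (rule Bochner_Integration.integrable_bound)
  note [measurable] = locally_integrable_measurable[OF w]
  show "(\<lambda>x. w x * \<psi> x) \<in> borel_measurable lborel" by measurable
  show "integrable lborel (\<lambda>x. B * (indicator K x *\<^sub>R w x))"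
    using w K unfolding locally_integrable_def set_integrable_def by (intro integrable_mult_right) auto
  show "AE x in lborel. norm (w x * \<psi> x) \<le> norm (B * (indicator K x *\<^sub>R w x))"
  proof (rule AE_I2)
    fix x
    have "\<bar>w x\<bar> * \<bar>\<psi> x\<bar> \<le> \<bar>w x\<bar> * \<bar>B\<bar>" using \<psi>(1)[of x] by (intro mult_left_mono) auto
    then show "norm (w x * \<psi> x) \<le> norm (B * (indicator K x *\<^sub>R w x))"
    proof (cases "x \<in> K")
      case False
      then have "\<psi> x = 0" using \<psi>(2) by blast
      then show ?thesis by simp
    qed (simp add: abs_mult mult.commute)
  qed
qed

lemma box_bump_measurable [measurable]: "0 < c \<Longrightarrow> box_bump a b c \<in> borel_measurable borel"
  using test_function_box_bump[of c a b] Ck_continuous[of 0]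
  by (intro borel_measurable_continuous_onI) (auto simp: test_function_def simp del: Ck.simps)

text \<open>As \<open>c\<close> tends to 0, the integral of \<open>w\<close> over every box vanishes
  by dominated convergence. The positive and negative parts of \<open>w\<close> are then densities
  of measures that agree on boxes, a generator stable under intersections, so the two parts coincide
  almost everywhere.\<close>

theorem fundamental_lemma_box_bump:
  fixes w :: "'a::euclidean_space \<Rightarrow> real"
  assumes w: "locally_integrable w"
    and 0: "\<And>a b c. 0 < c \<Longrightarrow> (\<integral>x. w x * box_bump a b c x \<partial>lborel) = 0"
  shows "AE x in lborel. w x = 0"
proof -
  note [measurable] = locally_integrable_measurable[OF w]
  have int: "integrable lborel (\<lambda>x. w x * indicator (box a b) x)" for a b
    using box_subset_cbox by (intro locally_integrable_mult_bounded[OF w, of _ 1 "cbox a b"]) (auto simp: indicator_def split: if_splits)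
  have z: "(\<integral>x. w x * indicator (box a b) x \<partial>lborel) = 0" for a b
  proof (rule LIMSEQ_unique)
    show "(\<lambda>j. \<integral>x. w x * box_bump a b (1 / real (Suc j)) x \<partial>lborel) \<longlonglongrightarrow> (\<integral>x. w x * indicator (box a b) x \<partial>lborel)"
    proof (rule integral_dominated_convergence[where w="\<lambda>x. \<bar>w x * indicator (box a b) x\<bar>"])
      show "AE x in lborel. (\<lambda>j. w x * box_bump a b (1 / real (Suc j)) x) \<longlonglongrightarrow> w x * indicator (box a b) x"
        by (intro AE_I2 tendsto_intros box_bump_tendsto)
      fix j
      show "AE x in lborel. norm (w x * box_bump a b (1 / real (Suc j)) x) \<le> \<bar>w x * indicator (box a b) x\<bar>"
      proof (rule AE_I2)
        fix x
        show "norm (w x * box_bump a b (1 / real (Suc j)) x) \<le> \<bar>w x * indicator (box a b) x\<bar>"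
        proof (cases "x \<in> box a b")
          case True
          then show ?thesis using box_bump_bounds[of "1 / real (Suc j)" a b x]
            by (simp add: abs_mult mult_left_le)
        qed (simp add: box_bump_outside)
      qed
    qed (use int in auto)
    show "(\<lambda>j. \<integral>x. w x * box_bump a b (1 / real (Suc j)) x \<partial>lborel) \<longlonglongrightarrow> 0"
      by (subst 0) auto
  qed
  \<comment> \<open>As functions to \<open>ennreal\<close>, \<open>w\<close> and \<open>- w\<close>
    are the positive and the negative part; finiteness on boxes is what uniqueness of measures
    requires.\<close>
  have pn: "(\<integral>\<^sup>+x. ennreal (w x) * indicator (box a b) x \<partial>lborel) = (\<integral>\<^sup>+x. ennreal (- w x) * indicator (box a b) x \<partial>lborel)"
    "(\<integral>\<^sup>+x. ennreal (w x) * indicator (box a b) x \<partial>lborel) \<noteq> \<infinity>" for a b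
  proof -
    have e: "(\<integral>\<^sup>+x. ennreal (s * w x) * indicator (box a b) x \<partial>lborel) = ennreal (\<integral>x. max 0 (s * (w x * indicator (box a b) x)) \<partial>lborel)" for s
    proof -
      have "(\<integral>\<^sup>+x. ennreal (s * w x) * indicator (box a b) x \<partial>lborel) = (\<integral>\<^sup>+x. ennreal (max 0 (s * (w x * indicator (box a b) x))) \<partial>lborel)"
        by (intro nn_integral_cong) (auto simp: indicator_def max_def ennreal_neg)
      also have "\<dots> = ennreal (\<integral>x. max 0 (s * (w x * indicator (box a b) x)) \<partial>lborel)"
        using int[of a b] by (intro nn_integral_eq_integral) auto
      finally show ?thesis .
    qed
    have "(\<integral>x. max 0 (w x * indicator (box a b) x) \<partial>lborel) - (\<integral>x. max 0 (- (w x * indicator (box a b) x)) \<partial>lborel)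
        = (\<integral>x. max 0 (w x * indicator (box a b) x) - max 0 (- (w x * indicator (box a b) x)) \<partial>lborel)"
      using int[of a b] by (intro Bochner_Integration.integral_diff[symmetric]) auto
    also have "\<dots> = (\<integral>x. w x * indicator (box a b) x \<partial>lborel)"
      by (intro Bochner_Integration.integral_cong) (auto simp: max_def)
    finally show "(\<integral>\<^sup>+x. ennreal (w x) * indicator (box a b) x \<partial>lborel) = (\<integral>\<^sup>+x. ennreal (- w x) * indicator (box a b) x \<partial>lborel)"
      "(\<integral>\<^sup>+x. ennreal (w x) * indicator (box a b) x \<partial>lborel) \<noteq> \<infinity>"
      using e[of 1] e[of "-1"] z[of a b] by auto
  qed
  have "density lborel (\<lambda>x. ennreal (w x)) = density lborel (\<lambda>x. ennreal (- w x))"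
  proof (rule measure_eqI_generator_eq)
    let ?E = "range (\<lambda>(a, b). box a b::'a set)"
    show "Int_stable ?E" by (auto simp: Int_stable_def box_Int_box)
    show "?E \<subseteq> Pow UNIV" "sets (density lborel (\<lambda>x. ennreal (w x))) = sigma_sets UNIV ?E"
      "sets (density lborel (\<lambda>x. ennreal (- w x))) = sigma_sets UNIV ?E"
      by (simp_all add: borel_eq_box)
    let ?A = "\<lambda>n::nat. box (- (real n *\<^sub>R One)) (real n *\<^sub>R One) :: 'a set"
    show "range ?A \<subseteq> ?E" "(\<Union>i. ?A i) = UNIV" unfolding UN_box_eq_UNIV by auto
    show "emeasure (density lborel (\<lambda>x. ennreal (w x))) (?A i) \<noteq> \<infinity>" for i
      using pn(2) by (simp add: emeasure_density)
    show "emeasure (density lborel (\<lambda>x. ennreal (w x))) X = emeasure (density lborel (\<lambda>x. ennreal (- w x))) X" if "X \<in> ?E" for X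
      using that pn(1) by (auto simp: emeasure_density)
  qed
  then have "AE x in lborel. ennreal (w x) = ennreal (- w x)"
    by (intro sigma_finite_measure.density_unique[OF sigma_finite_lborel]) auto
  then show ?thesis
  proof eventually_elim
    case (elim x)
    then show ?case by (cases "0 \<le> w x") (auto simp: ennreal_neg)
  qed
qed

section \<open>Weak gradients along lines\<close>

lemma lborel_translate:
  fixes f :: "'a::euclidean_space \<Rightarrow> 'b::{banach, second_countable_topology}"
  assumes [measurable]: "f \<in> borel_measurable borel"
  shows "(\<integral>x. f (x + c) \<partial>lborel) = (\<integral>x. f x \<partial>lborel)"
    "integrable lborel (\<lambda>x. f (x + c)) \<longleftrightarrow> integrable lborel f"
proof -
  have "(\<integral>x. f x \<partial>lborel) = (\<integral>x. f x \<partial>distr lborel borel ((+) c))" by (simp add: lborel_distr_plus)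
  also have "\<dots> = (\<integral>x. f (c + x) \<partial>lborel)" by (subst integral_distr) auto
  finally show "(\<integral>x. f (x + c) \<partial>lborel) = (\<integral>x. f x \<partial>lborel)" by (simp add: add.commute)
  have "integrable lborel f \<longleftrightarrow> integrable (distr lborel borel ((+) c)) f" by (simp add: lborel_distr_plus)
  also have "\<dots> \<longleftrightarrow> integrable lborel (\<lambda>x. f (c + x))" by (subst integrable_distr_eq) auto
  finally show "integrable lborel (\<lambda>x. f (x + c)) \<longleftrightarrow> integrable lborel f" by (simp add: add.commute)
qed

lemma AE_lborel_translate:
  fixes c :: "'a::euclidean_space"
  assumes "AE x in lborel. P x"
  shows "AE x in lborel. P (x + c)"
proof -
  obtain N where N: "{x. \<not> P x} \<subseteq> N" "N \<in> sets borel" "emeasure lborel N = 0"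
    using assms by (auto elim!: AE_E)
  note [measurable] = N(2)
  have "(\<integral>\<^sup>+x. indicator N (x + c) \<partial>lborel) = (\<integral>\<^sup>+x. indicator N x \<partial>lborel)"
    by (rule nn_integral_lborel_translate) measurable
  also have "\<dots> = 0" using N by simp
  finally have "AE x in lborel. indicator N (x + c) = (0::ennreal)"
    by (subst (asm) nn_integral_0_iff_AE) auto
  then show ?thesis by eventually_elim (use N(1) in \<open>auto simp: indicator_def split: if_splits\<close>)
qed

text \<open>The signed indicator of the segment between 0 and \<open>\<tau>\<close>. The two terms
  cancel for \<open>\<tau> = \<sigma> = 0\<close>, so \<open>seg 0\<close> vanishes
  identically.\<close>

definition seg :: "real \<Rightarrow> real \<Rightarrow> real" where
  "seg \<tau> \<sigma> = (if 0 \<le> \<sigma> \<and> \<sigma> \<le> \<tau> then 1 else 0) - (if \<tau> \<le> \<sigma> \<and> \<sigma> \<le> 0 then 1 else 0)"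

lemma seg_measurable [measurable]:
  assumes [measurable]: "f \<in> borel_measurable M" "g \<in> borel_measurable M"
  shows "(\<lambda>x. seg (f x) (g x)) \<in> borel_measurable M"
  unfolding seg_def by measurable

lemma seg_bounds: "\<bar>seg \<tau> \<sigma>\<bar> \<le> 1" "seg \<tau> \<sigma> \<noteq> 0 \<Longrightarrow> \<bar>\<sigma>\<bar> \<le> \<bar>\<tau>\<bar>"
  by (auto simp: seg_def split: if_splits)

text \<open>The oriented integral of \<open>h\<close> from 0 to \<open>\<tau>\<close>, written with a kernel so that Fubini's theorem applies.\<close>

definition segint :: "(real \<Rightarrow> real) \<Rightarrow> real \<Rightarrow> real" where
  "segint h \<tau> = (\<integral>\<sigma>. seg \<tau> \<sigma> * h \<sigma> \<partial>lborel)"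

lemma seg_integrable:
  assumes [measurable]: "h \<in> borel_measurable borel" and h: "\<And>x y. set_integrable lborel {x..y} h"
  shows "integrable lborel (\<lambda>\<sigma>. seg \<tau> \<sigma> * h \<sigma>)"
proof (rule Bochner_Integration.integrable_bound)
  show "integrable lborel (\<lambda>\<sigma>. indicator {- \<bar>\<tau>\<bar>..\<bar>\<tau>\<bar>} \<sigma> *\<^sub>R h \<sigma>)" using h unfolding set_integrable_def .
  show "AE \<sigma> in lborel. norm (seg \<tau> \<sigma> * h \<sigma>) \<le> norm (indicator {- \<bar>\<tau>\<bar>..\<bar>\<tau>\<bar>} \<sigma> *\<^sub>R h \<sigma>)"
    by (intro AE_I2) (auto simp: seg_def)
qed measurable

lemma segint_diff:
  assumes [measurable]: "h \<in> borel_measurable borel" and h: "\<And>x y. set_integrable lborel {x..y} h"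
    and "x \<le> y"
  shows "segint h y - segint h x = (LINT t:{x..y}|lborel. h t)"
proof -
  have "segint h y - segint h x = (\<integral>\<sigma>. seg y \<sigma> * h \<sigma> - seg x \<sigma> * h \<sigma> \<partial>lborel)"
    unfolding segint_def by (intro Bochner_Integration.integral_diff[symmetric] seg_integrable assms)
  also have "\<dots> = (LINT t:{x..y}|lborel. h t)"
    \<comment> \<open>The segments are closed at both ends, so the difference of the kernels can
      deviate from the indicator at \<open>0\<close>, \<open>x\<close> and \<open>y\<close>.\<close>
    unfolding set_lebesgue_integral_def
    using \<open>x \<le> y\<close> by (intro integral_discrete_difference[where X="{0, x, y}"]) (auto simp: seg_def)
  finally show ?thesis .
qed

lemma segint_0 [simp]: "segint h 0 = 0"
proof -
  have "seg 0 \<sigma> = 0" for \<sigma> by (auto simp: seg_def)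
  then show ?thesis by (simp add: segint_def)
qed

lemma primitive_of_segint:
  assumes "h \<in> borel_measurable borel" "\<And>x y. set_integrable lborel {x..y} h"
  shows "primitive_of (\<lambda>\<tau>. c + segint h \<tau>) h"
  using assms by (auto simp: primitive_of_def segint_diff[symmetric])

lemma segint_primitive_of:
  assumes U: "primitive_of U h"
  shows "segint h \<tau> = U \<tau> - U 0"
proof -
  note * = segint_diff[OF primitive_ofD(1,2)[OF U]]
  show ?thesis
    using *[of 0 \<tau>] *[of \<tau> 0] primitive_ofD(3)[OF U, of 0 \<tau>] primitive_ofD(3)[OF U, of \<tau> 0]
    by (cases "0 \<le> \<tau>") auto
qed

lemma segint_cong_AE:
  assumes "AE \<sigma> in lborel. h \<sigma> = h' \<sigma>" and [measurable]: "h \<in> borel_measurable borel" "h' \<in> borel_measurable borel"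
  shows "segint h \<tau> = segint h' \<tau>"
  unfolding segint_def using assms(1) by (intro integral_cong_AE) (auto elim: eventually_mono)

lemma primitive_of_shift:
  assumes U: "primitive_of U h"
  shows "primitive_of (\<lambda>t. U (t + c)) (\<lambda>t. h (t + c))"
  unfolding primitive_of_def
proof (intro conjI allI impI)
  note [measurable] = primitive_ofD(1)[OF U]
  show "(\<lambda>t. h (t + c)) \<in> borel_measurable borel" by measurable
  fix x y :: real assume "x \<le> y"
  have eq: "(\<lambda>t. indicator {x..y} t *\<^sub>R h (t + c)) = (\<lambda>t. (\<lambda>t. indicator {x+c..y+c} t *\<^sub>R h t) (t + c))"
    by (auto simp: indicator_def fun_eq_iff)
  have m: "(\<lambda>t. indicator {x+c..y+c} t *\<^sub>R h t) \<in> borel_measurable borel" by measurable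
  show "set_integrable lborel {x..y} (\<lambda>t. h (t + c))"
    using primitive_ofD(2)[OF U, of "x+c" "y+c"] unfolding set_integrable_def eq lborel_translate(2)[OF m] .
  show "(LINT t:{x..y}|lborel. h (t + c)) = U (y + c) - U (x + c)"
    using primitive_ofD(3)[OF U, of "x+c" "y+c"] \<open>x \<le> y\<close>
    unfolding set_lebesgue_integral_def eq lborel_translate(1)[OF m] by simp
qed

text \<open>For each fixed \<open>\<sigma>\<close> the shear is a translation in \<open>x\<close>,
  so Fubini's theorem in the other order gives the same norm.\<close>

lemma shear_integrable:
  fixes f :: "'a::euclidean_space \<Rightarrow> real \<Rightarrow> real"
  assumes f: "integrable (lborel \<Otimes>\<^sub>M lborel) (\<lambda>(x, \<sigma>). f x \<sigma>)"
  shows "integrable (lborel \<Otimes>\<^sub>M lborel) (\<lambda>(x, \<sigma>). f (x + \<sigma> *\<^sub>R b) \<sigma>)"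
proof (rule integrableI_bounded)
  have [measurable]: "(\<lambda>(x, \<sigma>). f x \<sigma>) \<in> borel_measurable (borel \<Otimes>\<^sub>M borel)"
    using borel_measurable_integrable[OF f] by simp
  have m: "(\<lambda>(x, \<sigma>). f (x + \<sigma> *\<^sub>R b) \<sigma>) \<in> borel_measurable (borel \<Otimes>\<^sub>M borel)" by measurable
  then show "(\<lambda>(x, \<sigma>). f (x + \<sigma> *\<^sub>R b) \<sigma>) \<in> borel_measurable (lborel \<Otimes>\<^sub>M lborel)" by simp
  have "(\<integral>\<^sup>+z. ennreal (norm (case z of (x, \<sigma>) \<Rightarrow> f (x + \<sigma> *\<^sub>R b) \<sigma>)) \<partial>(lborel \<Otimes>\<^sub>M lborel))
      = (\<integral>\<^sup>+x. \<integral>\<^sup>+\<sigma>. ennreal \<bar>f (x + \<sigma> *\<^sub>R b) \<sigma>\<bar> \<partial>lborel \<partial>lborel)"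
    using m by (subst lborel.nn_integral_fst[symmetric]) auto
  also have "\<dots> = (\<integral>\<^sup>+\<sigma>. \<integral>\<^sup>+x. ennreal \<bar>f (x + \<sigma> *\<^sub>R b) \<sigma>\<bar> \<partial>lborel \<partial>lborel)"
    by (rule lborel_pair.Fubini'[symmetric]) measurable
  also have "\<dots> = (\<integral>\<^sup>+\<sigma>. \<integral>\<^sup>+x. ennreal \<bar>f x \<sigma>\<bar> \<partial>lborel \<partial>lborel)"
    by (intro nn_integral_cong nn_integral_lborel_translate[where f="\<lambda>x. ennreal \<bar>f x _\<bar>"]) measurable
  also have "\<dots> = (\<integral>\<^sup>+x. \<integral>\<^sup>+\<sigma>. ennreal \<bar>f x \<sigma>\<bar> \<partial>lborel \<partial>lborel)"
    by (rule lborel_pair.Fubini') measurable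
  also have "\<dots> = (\<integral>\<^sup>+z. ennreal (norm (case z of (x, \<sigma>) \<Rightarrow> f x \<sigma>)) \<partial>(lborel \<Otimes>\<^sub>M lborel))"
    by (subst lborel.nn_integral_fst[symmetric]) auto
  also have "\<dots> < \<infinity>" using f by (simp add: integrable_iff_bounded)
  finally show "(\<integral>\<^sup>+z. ennreal (norm (case z of (x, \<sigma>) \<Rightarrow> f (x + \<sigma> *\<^sub>R b) \<sigma>)) \<partial>(lborel \<Otimes>\<^sub>M lborel)) < \<infinity>" .
qed

lemma indicator_cball_measurable: "(indicator (cball x r) :: 'a::euclidean_space \<Rightarrow> real) \<in> borel_measurable borel"
proof -
  have "cball x r \<in> sets borel" by (rule borel_closed) simp
  then show ?thesis by (rule borel_measurable_indicator)
qed

lemma kernel_integrable: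
  fixes v \<psi> :: "'a::euclidean_space \<Rightarrow> real" and k :: "real \<Rightarrow> real"
  assumes v: "locally_integrable v" and [measurable]: "\<psi> \<in> borel_measurable borel" "k \<in> borel_measurable borel"
    and \<psi>: "\<And>x. \<bar>\<psi> x\<bar> \<le> B" "\<And>x. \<psi> x \<noteq> 0 \<Longrightarrow> norm x \<le> R"
    and k: "\<And>\<sigma>. \<bar>k \<sigma>\<bar> \<le> 1" "\<And>\<sigma>. k \<sigma> \<noteq> 0 \<Longrightarrow> \<bar>\<sigma>\<bar> \<le> S" and b: "b \<in> Basis"
  shows "integrable (lborel \<Otimes>\<^sub>M lborel) (\<lambda>(x, \<sigma>). k \<sigma> * (v x * \<psi> (x - \<sigma> *\<^sub>R b)))"
    "integrable (lborel \<Otimes>\<^sub>M lborel) (\<lambda>(x, \<sigma>). k \<sigma> * (v (x + \<sigma> *\<^sub>R b) * \<psi> x))"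
proof -
  note [measurable] = locally_integrable_measurable[OF v]
  have B: "0 \<le> B" using \<psi>(1)[of 0] by linarith
  define V where "V x = B * \<bar>v x * indicator (cball 0 (R + S)) x\<bar>" for x
  have Vi: "integrable lborel V"
  proof -
    have "integrable lborel (\<lambda>x. v x * indicator (cball 0 (R + S)) x)"
      by (rule locally_integrable_mult_bounded[OF v indicator_cball_measurable, where B=1 and K="cball 0 (R + S)"])
         (auto simp: indicator_def split: if_splits)
    then show ?thesis unfolding V_def[abs_def] by (intro integrable_mult_right integrable_abs)
  qed
  have [measurable]: "V \<in> borel_measurable borel" using borel_measurable_integrable[OF Vi] by simp
  have V0: "0 \<le> V x" for x using B by (simp add: V_def)
  have bd: "\<bar>k \<sigma> * (v x * \<psi> (x - \<sigma> *\<^sub>R b))\<bar> \<le> V x * indicator {-S..S} \<sigma>" for x \<sigma>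
  proof (cases "k \<sigma> = 0 \<or> \<psi> (x - \<sigma> *\<^sub>R b) = 0")
    case True
    then show ?thesis using V0[of x] by (auto simp: indicator_def)
  next
    case False
    then have \<sigma>: "\<bar>\<sigma>\<bar> \<le> S" and n: "norm (x - \<sigma> *\<^sub>R b) \<le> R" using k(2) \<psi>(2) by auto
    have "norm x \<le> norm (x - \<sigma> *\<^sub>R b) + norm (\<sigma> *\<^sub>R b)" using norm_triangle_ineq[of "x - \<sigma> *\<^sub>R b" "\<sigma> *\<^sub>R b"] by simp
    also have "\<dots> \<le> R + S" using n \<sigma> b by simp
    finally have x: "norm x \<le> R + S" .
    have "\<bar>k \<sigma> * (v x * \<psi> (x - \<sigma> *\<^sub>R b))\<bar> \<le> 1 * (\<bar>v x\<bar> * B)"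
      unfolding abs_mult using k(1) \<psi>(1) by (intro mult_mono) auto
    then show ?thesis using \<sigma> x by (auto simp: V_def indicator_def mult.commute)
  qed
  have m: "(\<lambda>(x, \<sigma>). k \<sigma> * (v x * \<psi> (x - \<sigma> *\<^sub>R b))) \<in> borel_measurable (borel \<Otimes>\<^sub>M borel)" by measurable
  show 1: "integrable (lborel \<Otimes>\<^sub>M lborel) (\<lambda>(x, \<sigma>). k \<sigma> * (v x * \<psi> (x - \<sigma> *\<^sub>R b)))"
  proof (rule integrableI_bounded)
    show "(\<lambda>(x, \<sigma>). k \<sigma> * (v x * \<psi> (x - \<sigma> *\<^sub>R b))) \<in> borel_measurable (lborel \<Otimes>\<^sub>M lborel)" using m by simp
    have "(\<integral>\<^sup>+z. ennreal (norm (case z of (x, \<sigma>) \<Rightarrow> k \<sigma> * (v x * \<psi> (x - \<sigma> *\<^sub>R b)))) \<partial>(lborel \<Otimes>\<^sub>M lborel))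
        = (\<integral>\<^sup>+x. \<integral>\<^sup>+\<sigma>. ennreal \<bar>k \<sigma> * (v x * \<psi> (x - \<sigma> *\<^sub>R b))\<bar> \<partial>lborel \<partial>lborel)"
      using m by (subst lborel.nn_integral_fst[symmetric]) auto
    also have "\<dots> \<le> (\<integral>\<^sup>+x. \<integral>\<^sup>+\<sigma>. ennreal (V x) * indicator {-S..S} \<sigma> \<partial>lborel \<partial>lborel)"
    proof (intro nn_integral_mono)
      fix x \<sigma>
      have "ennreal \<bar>k \<sigma> * (v x * \<psi> (x - \<sigma> *\<^sub>R b))\<bar> \<le> ennreal (V x * indicator {-S..S} \<sigma>)" by (intro ennreal_leI bd)
      then show "ennreal \<bar>k \<sigma> * (v x * \<psi> (x - \<sigma> *\<^sub>R b))\<bar> \<le> ennreal (V x) * indicator {-S..S} \<sigma>"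
        by (cases "\<sigma> \<in> {-S..S}") simp_all
    qed
    also have "\<dots> = (\<integral>\<^sup>+x. ennreal (V x) \<partial>lborel) * emeasure lborel {-S..S}"
      by (simp add: nn_integral_cmult nn_integral_multc)
    also have "\<dots> < \<infinity>"
      using Vi V0 emeasure_bounded_finite[of "{-S..S}"] by (auto simp: integrable_iff_bounded ennreal_mult_less_top)
    finally show "(\<integral>\<^sup>+z. ennreal (norm (case z of (x, \<sigma>) \<Rightarrow> k \<sigma> * (v x * \<psi> (x - \<sigma> *\<^sub>R b)))) \<partial>(lborel \<Otimes>\<^sub>M lborel)) < \<infinity>" .
  qed
  show "integrable (lborel \<Otimes>\<^sub>M lborel) (\<lambda>(x, \<sigma>). k \<sigma> * (v (x + \<sigma> *\<^sub>R b) * \<psi> x))"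
    using shear_integrable[OF 1, of b] by simp
qed

text \<open>Moves an oriented integral along lines from the test function to \<open>v\<close>: both
  reduce to the oriented integral over shifts of the correlation of \<open>v\<close> with
  \<open>\<psi>\<close>.\<close>

lemma seg_Fubini:
  fixes v \<psi> :: "'a::euclidean_space \<Rightarrow> real"
  assumes v: "locally_integrable v" and [measurable]: "\<psi> \<in> borel_measurable borel"
    and \<psi>: "\<And>x. \<bar>\<psi> x\<bar> \<le> B" "\<And>x. \<psi> x \<noteq> 0 \<Longrightarrow> norm x \<le> R" and b: "b \<in> Basis"
  shows "(\<integral>x. v x * segint (\<lambda>\<sigma>. \<psi> (x - \<sigma> *\<^sub>R b)) \<tau> \<partial>lborel) = segint (\<lambda>\<sigma>. \<integral>x. v x * \<psi> (x - \<sigma> *\<^sub>R b) \<partial>lborel) \<tau>"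
    "(\<integral>x. segint (\<lambda>\<sigma>. v (x + \<sigma> *\<^sub>R b)) \<tau> * \<psi> x \<partial>lborel) = segint (\<lambda>\<sigma>. \<integral>x. v x * \<psi> (x - \<sigma> *\<^sub>R b) \<partial>lborel) \<tau>"
    "integrable lborel (\<lambda>x. segint (\<lambda>\<sigma>. v (x + \<sigma> *\<^sub>R b)) \<tau> * \<psi> x)"
proof -
  note [measurable] = locally_integrable_measurable[OF v]
  have "seg \<tau> \<in> borel_measurable borel" by measurable
  note ki = kernel_integrable[OF v assms(2) this \<psi> seg_bounds(1) seg_bounds(2) b]
  note i1 = ki(1)[of \<tau>] and i2 = ki(2)[of \<tau>]
  have "(\<integral>x. v x * segint (\<lambda>\<sigma>. \<psi> (x - \<sigma> *\<^sub>R b)) \<tau> \<partial>lborel) = (\<integral>x. \<integral>\<sigma>. seg \<tau> \<sigma> * (v x * \<psi> (x - \<sigma> *\<^sub>R b)) \<partial>lborel \<partial>lborel)"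
    by (simp add: segint_def mult.left_commute[of "seg _ _"])
  also have "\<dots> = (\<integral>\<sigma>. \<integral>x. seg \<tau> \<sigma> * (v x * \<psi> (x - \<sigma> *\<^sub>R b)) \<partial>lborel \<partial>lborel)"
    using lborel_pair.integral_fst[OF i1] lborel_pair.integral_snd[OF i1] by simp
  finally show "(\<integral>x. v x * segint (\<lambda>\<sigma>. \<psi> (x - \<sigma> *\<^sub>R b)) \<tau> \<partial>lborel) = segint (\<lambda>\<sigma>. \<integral>x. v x * \<psi> (x - \<sigma> *\<^sub>R b) \<partial>lborel) \<tau>"
    by (simp add: segint_def)
  have eq: "segint (\<lambda>\<sigma>. v (x + \<sigma> *\<^sub>R b)) \<tau> * \<psi> x = (\<integral>\<sigma>. seg \<tau> \<sigma> * (v (x + \<sigma> *\<^sub>R b) * \<psi> x) \<partial>lborel)" for x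
    by (simp add: segint_def mult.assoc[symmetric])
  show "integrable lborel (\<lambda>x. segint (\<lambda>\<sigma>. v (x + \<sigma> *\<^sub>R b)) \<tau> * \<psi> x)"
    unfolding eq using lborel_pair.integrable_fst[OF i2] .
  have "(\<integral>x. segint (\<lambda>\<sigma>. v (x + \<sigma> *\<^sub>R b)) \<tau> * \<psi> x \<partial>lborel) = (\<integral>\<sigma>. \<integral>x. seg \<tau> \<sigma> * (v (x + \<sigma> *\<^sub>R b) * \<psi> x) \<partial>lborel \<partial>lborel)"
    unfolding eq using lborel_pair.integral_fst[OF i2] lborel_pair.integral_snd[OF i2] by simp
  also have "\<dots> = segint (\<lambda>\<sigma>. \<integral>x. v x * \<psi> (x - \<sigma> *\<^sub>R b) \<partial>lborel) \<tau>"
    unfolding segint_def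
  proof (rule Bochner_Integration.integral_cong[OF refl])
    fix \<sigma>
    have "(\<integral>x. v (x + \<sigma> *\<^sub>R b) * \<psi> x \<partial>lborel) = (\<integral>x. v x * \<psi> (x - \<sigma> *\<^sub>R b) \<partial>lborel)"
      using lborel_translate(1)[of "\<lambda>x. v x * \<psi> (x - \<sigma> *\<^sub>R b)" "\<sigma> *\<^sub>R b"] by simp
    then show "(\<integral>x. seg \<tau> \<sigma> * (v (x + \<sigma> *\<^sub>R b) * \<psi> x) \<partial>lborel) = seg \<tau> \<sigma> * (\<integral>x. v x * \<psi> (x - \<sigma> *\<^sub>R b) \<partial>lborel)"
      by simp
  qed
  finally show "(\<integral>x. segint (\<lambda>\<sigma>. v (x + \<sigma> *\<^sub>R b)) \<tau> * \<psi> x \<partial>lborel) = segint (\<lambda>\<sigma>. \<integral>x. v x * \<psi> (x - \<sigma> *\<^sub>R b) \<partial>lborel) \<tau>" .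
qed

lemma test_function_bounds:
  fixes \<phi> :: "'a::euclidean_space \<Rightarrow> real"
  assumes \<phi>: "test_function \<phi>" and b: "b \<in> Basis"
  obtains B R where "\<And>x. \<bar>\<phi> x\<bar> \<le> B" "\<And>x. \<phi> x \<noteq> 0 \<Longrightarrow> norm x \<le> R"
    "\<And>x. \<bar>frechet_derivative \<phi> (at x) b\<bar> \<le> B" "\<And>x. frechet_derivative \<phi> (at x) b \<noteq> 0 \<Longrightarrow> norm x \<le> R"
proof -
  let ?D = "\<lambda>x. frechet_derivative \<phi> (at x) b"
  define K where "K = closure {x. \<phi> x \<noteq> 0}"
  have K: "compact K" using \<phi> by (simp add: test_function_def K_def)
  have c: "continuous_on UNIV \<phi>" "continuous_on UNIV ?D"
    using \<phi> b Ck_continuous[of 1 \<phi>] Ck_continuous[of 0 ?D] unfolding test_function_def by (auto dest: spec[of _ "Suc 0"])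
  have s1: "x \<in> K" if "\<phi> x \<noteq> 0" for x using that by (auto simp: K_def intro: subsetD[OF closure_subset])
  have s2: "x \<in> K" if "?D x \<noteq> 0" for x
  proof (rule ccontr)
    assume "x \<notin> K"
    have "((\<lambda>y. 0) has_derivative (\<lambda>v. 0)) (at x)" by simp
    then have "(\<phi> has_derivative (\<lambda>v. 0)) (at x)"
    proof (rule has_derivative_transform_within_open[of _ _ _ _ "- K"])
      show "open (- K)" by (simp add: K_def open_Compl)
      show "x \<in> - K" using \<open>x \<notin> K\<close> by simp
      show "0 = \<phi> y" if "y \<in> - K" for y using that s1 by force
    qed
    then have "frechet_derivative \<phi> (at x) = (\<lambda>v. 0)" by (rule frechet_derivative_at[symmetric])
    then show False using that by simp
  qed
  obtain R where R: "\<And>x. x \<in> K \<Longrightarrow> norm x \<le> R" using compact_imp_bounded[OF K] bounded_iff by metis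
  have "compact (\<phi> ` K)" "compact (?D ` K)"
    using K c continuous_on_subset by (auto intro!: compact_continuous_image)
  then obtain B1 B2 where B: "\<And>x. x \<in> K \<Longrightarrow> \<bar>\<phi> x\<bar> \<le> B1" "\<And>x. x \<in> K \<Longrightarrow> \<bar>?D x\<bar> \<le> B2"
    using compact_imp_bounded bounded_real by (metis (no_types, lifting) imageI)
  show thesis
  proof (rule that)
    show "\<bar>\<phi> x\<bar> \<le> max 0 (max B1 B2)" for x using B(1)[of x] s1[of x] by (cases "\<phi> x = 0") auto
    show "\<bar>?D x\<bar> \<le> max 0 (max B1 B2)" for x using B(2)[of x] s2[of x] by (cases "?D x = 0") auto
  qed (use R s1 s2 in auto)
qed

lemma test_function_regular:
  fixes \<phi> :: "'a::euclidean_space \<Rightarrow> real"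
  assumes \<phi>: "test_function \<phi>" and b: "b \<in> Basis"
  shows "continuous_on UNIV \<phi>" "continuous_on UNIV (\<lambda>x. frechet_derivative \<phi> (at x) b)"
    "(\<phi> has_derivative frechet_derivative \<phi> (at x)) (at x)"
proof -
  have "Ck (Suc 0) \<phi>" "Ck 1 \<phi>" using \<phi> by (simp_all only: test_function_def)
  then show "continuous_on UNIV \<phi>" "continuous_on UNIV (\<lambda>x. frechet_derivative \<phi> (at x) b)"
    "(\<phi> has_derivative frechet_derivative \<phi> (at x)) (at x)"
    using b Ck_continuous[of 1 \<phi>] by (simp_all add: frechet_derivative_works)
qed

lemma test_function_along_line:
  fixes \<phi> :: "'a::euclidean_space \<Rightarrow> real"
  assumes \<phi>: "test_function \<phi>" and b: "b \<in> Basis"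
  shows "\<phi> (x - \<tau> *\<^sub>R b) - \<phi> x = - segint (\<lambda>\<sigma>. frechet_derivative \<phi> (at (x - \<sigma> *\<^sub>R b)) b) \<tau>"
proof -
  note r = test_function_regular[OF \<phi> b]
  have "primitive_of (\<lambda>\<sigma>. - \<phi> (x - \<sigma> *\<^sub>R b)) (\<lambda>\<sigma>. frechet_derivative \<phi> (at (x - \<sigma> *\<^sub>R b)) b)"
  proof (rule primitive_of_continuous_deriv)
    show "continuous_on UNIV (\<lambda>\<sigma>. frechet_derivative \<phi> (at (x - \<sigma> *\<^sub>R b)) b)"
      by (rule continuous_on_compose2[OF r(2)]) (auto intro!: continuous_intros)
    fix \<sigma>
    have "((\<lambda>\<sigma>. x - \<sigma> *\<^sub>R b) has_derivative (\<lambda>d. - (d *\<^sub>R b))) (at \<sigma>)"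
      by (auto intro!: derivative_eq_intros)
    from has_derivative_compose[OF this r(3)]
    have D: "((\<lambda>\<sigma>. \<phi> (x - \<sigma> *\<^sub>R b)) has_derivative (\<lambda>d. frechet_derivative \<phi> (at (x - \<sigma> *\<^sub>R b)) (- (d *\<^sub>R b)))) (at \<sigma>)" .
    interpret L: bounded_linear "frechet_derivative \<phi> (at (x - \<sigma> *\<^sub>R b))" by (rule has_derivative_bounded_linear[OF r(3)])
    show "((\<lambda>\<sigma>. - \<phi> (x - \<sigma> *\<^sub>R b)) has_real_derivative frechet_derivative \<phi> (at (x - \<sigma> *\<^sub>R b)) b) (at \<sigma>)"
      unfolding has_field_derivative_def
      by (rule has_derivative_eq_rhs[OF has_derivative_minus[OF D]]) (auto simp: fun_eq_iff L.neg L.scaleR)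
  qed
  from segint_primitive_of[OF this] show ?thesis by simp
qed

lemma locally_integrableI:
  assumes "\<And>R. set_integrable lborel (cball 0 R) u"
  shows "locally_integrable u"
  unfolding locally_integrable_def
proof (intro allI impI)
  fix K :: "'a set" assume K: "compact K"
  obtain R where "\<And>x. x \<in> K \<Longrightarrow> norm x \<le> R" using compact_imp_bounded[OF K] bounded_iff by metis
  then have "K \<subseteq> cball 0 R" by auto
  then show "set_integrable lborel K u"
    using borel_closed[OF compact_imp_closed[OF K]] by (intro set_integrable_subset[OF assms[of R]]) auto
qed

lemma locally_integrable_inner:
  fixes g :: "'a::euclidean_space \<Rightarrow> 'b::euclidean_space"
  assumes "locally_integrable g"
  shows "locally_integrable (\<lambda>x. g x \<bullet> b)"
  unfolding locally_integrable_def
proof (intro allI impI)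
  fix K :: "'a set" assume "compact K"
  then have "integrable lborel (\<lambda>x. indicator K x *\<^sub>R g x)"
    using assms by (auto simp: locally_integrable_def set_integrable_def)
  then have "integrable lborel (\<lambda>x. (indicator K x *\<^sub>R g x) \<bullet> b)" by (rule integrable_inner_left)
  then show "set_integrable lborel K (\<lambda>x. g x \<bullet> b)" by (simp add: set_integrable_def)
qed

text \<open>Summation by parts: a translation of \<open>u\<close> is moved to the test function,
  whose difference is the oriented integral of its derivative along the line.\<close>

lemma test_difference_integral:
  fixes u \<phi> :: "'a::euclidean_space \<Rightarrow> real"
  assumes u: "locally_integrable u" and \<phi>: "test_function \<phi>" and b: "b \<in> Basis"
  shows "(\<integral>x. (u (x + \<tau> *\<^sub>R b) - u x) * \<phi> x \<partial>lborel)
      = - segint (\<lambda>\<sigma>. \<integral>x. u x * frechet_derivative \<phi> (at (x - \<sigma> *\<^sub>R b)) b \<partial>lborel) \<tau>"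
    "integrable lborel (\<lambda>x. (u (x + \<tau> *\<^sub>R b) - u x) * \<phi> x)"
proof -
  obtain B R where B: "\<And>x. \<bar>\<phi> x\<bar> \<le> B" "\<And>x. \<phi> x \<noteq> 0 \<Longrightarrow> norm x \<le> R"
    "\<And>x. \<bar>frechet_derivative \<phi> (at x) b\<bar> \<le> B" "\<And>x. frechet_derivative \<phi> (at x) b \<noteq> 0 \<Longrightarrow> norm x \<le> R"
    using test_function_bounds[OF \<phi> b] by blast
  note r = test_function_regular[OF \<phi> b]
  note [measurable] = locally_integrable_measurable[OF u] borel_measurable_continuous_onI[OF r(1)]
    borel_measurable_continuous_onI[OF r(2)]
  have s: "x \<in> cball 0 R" if "\<phi> x \<noteq> 0" for x using B(2)[OF that] by simp
  have s': "x \<in> cball (\<tau> *\<^sub>R b) R" if "\<phi> (x - \<tau> *\<^sub>R b) \<noteq> 0" for x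
    using B(2)[OF that] by (simp add: dist_norm norm_minus_commute)
  have i: "integrable lborel (\<lambda>x. u x * \<phi> x)"
    using B(1) s by (intro locally_integrable_mult_bounded[OF u, of _ B "cball 0 R"]) auto
  have i': "integrable lborel (\<lambda>x. u x * \<phi> (x - \<tau> *\<^sub>R b))"
    using B(1) s' by (intro locally_integrable_mult_bounded[OF u, of _ B "cball (\<tau> *\<^sub>R b) R"]) auto
  have t: "(\<integral>x. u (x + \<tau> *\<^sub>R b) * \<phi> x \<partial>lborel) = (\<integral>x. u x * \<phi> (x - \<tau> *\<^sub>R b) \<partial>lborel)"
    "integrable lborel (\<lambda>x. u (x + \<tau> *\<^sub>R b) * \<phi> x)"
    using lborel_translate[of "\<lambda>x. u x * \<phi> (x - \<tau> *\<^sub>R b)" "\<tau> *\<^sub>R b"] i' by simp_all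
  show "integrable lborel (\<lambda>x. (u (x + \<tau> *\<^sub>R b) - u x) * \<phi> x)"
    using Bochner_Integration.integrable_diff[OF t(2) i] by (simp add: left_diff_distrib)
  have "(\<integral>x. (u (x + \<tau> *\<^sub>R b) - u x) * \<phi> x \<partial>lborel) = (\<integral>x. u x * \<phi> (x - \<tau> *\<^sub>R b) \<partial>lborel) - (\<integral>x. u x * \<phi> x \<partial>lborel)"
    using Bochner_Integration.integral_diff[OF t(2) i] t(1) by (simp add: left_diff_distrib)
  also have "\<dots> = (\<integral>x. u x * (\<phi> (x - \<tau> *\<^sub>R b) - \<phi> x) \<partial>lborel)"
    using Bochner_Integration.integral_diff[OF i' i] by (simp add: right_diff_distrib)
  also have "\<dots> = - (\<integral>x. u x * segint (\<lambda>\<sigma>. frechet_derivative \<phi> (at (x - \<sigma> *\<^sub>R b)) b) \<tau> \<partial>lborel)"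
    unfolding test_function_along_line[OF \<phi> b] by simp
  also have "(\<integral>x. u x * segint (\<lambda>\<sigma>. frechet_derivative \<phi> (at (x - \<sigma> *\<^sub>R b)) b) \<tau> \<partial>lborel)
      = segint (\<lambda>\<sigma>. \<integral>x. u x * frechet_derivative \<phi> (at (x - \<sigma> *\<^sub>R b)) b \<partial>lborel) \<tau>"
    using B by (intro seg_Fubini(1)[OF u, of "\<lambda>y. frechet_derivative \<phi> (at y) b"] b) auto
  finally show "(\<integral>x. (u (x + \<tau> *\<^sub>R b) - u x) * \<phi> x \<partial>lborel)
      = - segint (\<lambda>\<sigma>. \<integral>x. u x * frechet_derivative \<phi> (at (x - \<sigma> *\<^sub>R b)) b \<partial>lborel) \<tau>" .
qed

lemma frechet_derivative_translate:
  fixes \<phi> :: "'a::real_normed_vector \<Rightarrow> real"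
  assumes "\<phi> differentiable (at (x - v))"
  shows "frechet_derivative (\<lambda>x. \<phi> (x - v)) (at x) = frechet_derivative \<phi> (at (x - v))"
proof -
  have "((\<lambda>x. x - v) has_derivative (\<lambda>d. d)) (at x)" by (auto intro!: derivative_eq_intros)
  from has_derivative_compose[OF this assms[unfolded frechet_derivative_works]]
  show ?thesis by (rule frechet_derivative_at[symmetric])
qed

text \<open>Tested against a box bump, the difference of \<open>u\<close> becomes an oriented
  integral, over shifts, of \<open>u\<close> against derivatives of translated bumps. These are box
  bumps too, so the equation of the weak gradient applies at each shift, and Fubini's theorem turns
  the result into the test of the right side. The exceptional null set still depends on
  \<open>\<tau>\<close>.\<close>

theorem weak_gradient_segment:
  fixes u :: "'a::euclidean_space \<Rightarrow> real"
  assumes wg: "has_weak_gradient u g" and b: "b \<in> Basis"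
  shows "AE x in lborel. u (x + \<tau> *\<^sub>R b) - u x = segint (\<lambda>\<sigma>. g (x + \<sigma> *\<^sub>R b) \<bullet> b) \<tau>"
proof -
  define G where "G x = g x \<bullet> b" for x
  have u: "locally_integrable u" and g: "locally_integrable g"
    and wgt: "\<And>\<phi>. test_function \<phi> \<Longrightarrow> (\<integral>x. u x * frechet_derivative \<phi> (at x) b \<partial>lborel) = - (\<integral>x. G x * \<phi> x \<partial>lborel)"
    using wg b by (auto simp: has_weak_gradient_def G_def)
  have G: "locally_integrable G" unfolding G_def by (rule locally_integrable_inner[OF g])
  note [measurable] = locally_integrable_measurable[OF u] locally_integrable_measurable[OF G]
  define w where "w x = u (x + \<tau> *\<^sub>R b) - u x - segint (\<lambda>\<sigma>. G (x + \<sigma> *\<^sub>R b)) \<tau>" for x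
  have "AE x in lborel. w x = 0"
  proof (rule fundamental_lemma_box_bump)
    show "locally_integrable w"
    proof (rule locally_integrableI)
      fix R
      have "integrable lborel (\<lambda>x. indicator (cball 0 R) x *\<^sub>R u x)" "integrable lborel (\<lambda>x. indicator (cball (\<tau> *\<^sub>R b) R) x *\<^sub>R u x)"
        using u by (auto simp: locally_integrable_def set_integrable_def)
      moreover have "integrable lborel (\<lambda>x. indicator (cball 0 R) x *\<^sub>R u (x + \<tau> *\<^sub>R b))"
      proof -
        have "(\<lambda>x. indicator (cball (\<tau> *\<^sub>R b) R) (x + \<tau> *\<^sub>R b) *\<^sub>R u (x + \<tau> *\<^sub>R b)) = (\<lambda>x. indicator (cball 0 R) x *\<^sub>R u (x + \<tau> *\<^sub>R b))"
          by (auto simp: indicator_def dist_norm)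
        then show ?thesis
          using calculation(2) lborel_translate(2)[of "\<lambda>x. indicator (cball (\<tau> *\<^sub>R b) R) x *\<^sub>R u x" "\<tau> *\<^sub>R b"] by simp
      qed
      moreover have "integrable lborel (\<lambda>x. segint (\<lambda>\<sigma>. G (x + \<sigma> *\<^sub>R b)) \<tau> * indicator (cball 0 R) x)"
        by (rule seg_Fubini(3)[OF G indicator_cball_measurable, where B=1 and R=R])
           (use b in \<open>auto simp: indicator_def split: if_splits\<close>)
      ultimately have "integrable lborel (\<lambda>x. indicator (cball 0 R) x *\<^sub>R u (x + \<tau> *\<^sub>R b) - indicator (cball 0 R) x *\<^sub>R u x
          - segint (\<lambda>\<sigma>. G (x + \<sigma> *\<^sub>R b)) \<tau> * indicator (cball 0 R) x)"
        by (intro Bochner_Integration.integrable_diff)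
      then show "set_integrable lborel (cball 0 R) w"
        by (simp add: set_integrable_def w_def algebra_simps)
    qed
    fix l r :: 'a and c :: real assume c: "0 < c"
    let ?\<phi> = "box_bump l r c"
    have \<phi>: "test_function (box_bump l r c)" for l r :: 'a by (rule test_function_box_bump[OF c])
    obtain B R where B: "\<And>x. \<bar>?\<phi> x\<bar> \<le> B" "\<And>x. ?\<phi> x \<noteq> 0 \<Longrightarrow> norm x \<le> R"
      by (rule test_function_bounds[OF \<phi>[of l r] b]) (rule that; assumption)
    have [measurable]: "?\<phi> \<in> borel_measurable borel" using c by simp
    have sw: "(\<integral>x. u x * frechet_derivative ?\<phi> (at (x - \<sigma> *\<^sub>R b)) b \<partial>lborel) = - (\<integral>x. G x * ?\<phi> (x - \<sigma> *\<^sub>R b) \<partial>lborel)" for \<sigma>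
    proof -
      have e: "(\<lambda>x. ?\<phi> (x - \<sigma> *\<^sub>R b)) = box_bump (l + \<sigma> *\<^sub>R b) (r + \<sigma> *\<^sub>R b) c"
        by (simp add: fun_eq_iff box_bump_translate)
      have "frechet_derivative (\<lambda>x. ?\<phi> (x - \<sigma> *\<^sub>R b)) (at x) = frechet_derivative ?\<phi> (at (x - \<sigma> *\<^sub>R b))" for x
        using test_function_regular(3)[OF \<phi> b] by (intro frechet_derivative_translate) (auto simp: differentiable_def)
      then show ?thesis using wgt[OF \<phi>, of "l + \<sigma> *\<^sub>R b" "r + \<sigma> *\<^sub>R b"] unfolding e[symmetric] by simp
    qed
    note td = test_difference_integral[OF u \<phi>[of l r] b, where \<tau>=\<tau>]
    note sF = seg_Fubini[OF G \<open>?\<phi> \<in> borel_measurable borel\<close> B b, where \<tau>=\<tau>]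
    have "(\<integral>x. w x * ?\<phi> x \<partial>lborel)
        = (\<integral>x. (u (x + \<tau> *\<^sub>R b) - u x) * ?\<phi> x - segint (\<lambda>\<sigma>. G (x + \<sigma> *\<^sub>R b)) \<tau> * ?\<phi> x \<partial>lborel)"
      by (simp add: w_def left_diff_distrib)
    also have "\<dots> = (\<integral>x. (u (x + \<tau> *\<^sub>R b) - u x) * ?\<phi> x \<partial>lborel) - (\<integral>x. segint (\<lambda>\<sigma>. G (x + \<sigma> *\<^sub>R b)) \<tau> * ?\<phi> x \<partial>lborel)"
      by (rule Bochner_Integration.integral_diff[OF td(2) sF(3)])
    also have "\<dots> = 0"
    proof -
      have "segint (\<lambda>\<sigma>. \<integral>x. u x * frechet_derivative ?\<phi> (at (x - \<sigma> *\<^sub>R b)) b \<partial>lborel) \<tau>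
          = - segint (\<lambda>\<sigma>. \<integral>x. G x * ?\<phi> (x - \<sigma> *\<^sub>R b) \<partial>lborel) \<tau>"
        unfolding sw by (simp add: segint_def)
      then have "(\<integral>x. (u (x + \<tau> *\<^sub>R b) - u x) * ?\<phi> x \<partial>lborel) = segint (\<lambda>\<sigma>. \<integral>x. G x * ?\<phi> (x - \<sigma> *\<^sub>R b) \<partial>lborel) \<tau>"
        by (simp only: td(1) minus_minus)
      moreover have "(\<integral>x. segint (\<lambda>\<sigma>. G (x + \<sigma> *\<^sub>R b)) \<tau> * ?\<phi> x \<partial>lborel)
          = segint (\<lambda>\<sigma>. \<integral>x. G x * ?\<phi> (x - \<sigma> *\<^sub>R b) \<partial>lborel) \<tau>"
        by (rule sF(2))
      ultimately show ?thesis by (simp only: diff_self)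
    qed
    finally show "(\<integral>x. w x * ?\<phi> x \<partial>lborel) = 0" .
  qed
  then show ?thesis by eventually_elim (simp add: w_def G_def)
qed

lemma AE_slices_integrable:
  fixes v :: "'a::euclidean_space \<Rightarrow> real"
  assumes v: "locally_integrable v" and b: "b \<in> Basis"
  shows "AE x in lborel. \<forall>r s. set_integrable lborel {r..s} (\<lambda>\<sigma>. v (x + \<sigma> *\<^sub>R b))"
proof -
  have "AE x in lborel. integrable lborel (\<lambda>\<sigma>. indicator {-real n..real n} \<sigma> * (v (x + \<sigma> *\<^sub>R b) * indicator (cball 0 (real n)) x))" for n
  proof -
    have "integrable (lborel \<Otimes>\<^sub>M lborel) (\<lambda>(x, \<sigma>). indicator {-real n..real n} \<sigma> * (v (x + \<sigma> *\<^sub>R b) * indicator (cball 0 (real n)) x))"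
      by (rule kernel_integrable(2)[OF v indicator_cball_measurable, where B=1 and R="real n" and S="real n"])
         (use b in \<open>auto simp: indicator_def split: if_splits\<close>)
    from lborel_pair.AE_integrable_fst[OF this] show ?thesis .
  qed
  then have "AE x in lborel. \<forall>n. integrable lborel (\<lambda>\<sigma>. indicator {-real n..real n} \<sigma> * (v (x + \<sigma> *\<^sub>R b) * indicator (cball 0 (real n)) x))"
    by (subst AE_all_countable) blast
  then show ?thesis
  proof eventually_elim
    case (elim x)
    show ?case
    proof (intro allI)
      fix r s :: real
      obtain n :: nat where n: "max (norm x) (max \<bar>r\<bar> \<bar>s\<bar>) \<le> real n" using real_arch_simple by blast
      have "set_integrable lborel {-real n..real n} (\<lambda>\<sigma>. v (x + \<sigma> *\<^sub>R b))"
        using elim[rule_format, of n] n by (simp add: set_integrable_def)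
      then show "set_integrable lborel {r..s} (\<lambda>\<sigma>. v (x + \<sigma> *\<^sub>R b))"
        by (rule set_integrable_subset) (use n in auto)
    qed
  qed
qed

text \<open>Fubini's theorem exchanges the quantifiers, so that one null set of lines serves almost
  all \<open>\<tau>\<close>. The value at 0 and the formula for every \<open>\<tau>\<close> are kept
  in the statement because \<open>u\<close> is known to agree with \<open>U\<close> only at almost
  every \<open>\<tau>\<close>, while the rule for squares needs a prescribed one.\<close>

theorem weak_gradient_line:
  fixes u :: "'a::euclidean_space \<Rightarrow> real"
  assumes wg: "has_weak_gradient u g" and b: "b \<in> Basis"
  shows "AE x in lborel. \<exists>U. U 0 = u x \<and> (\<forall>\<tau>. U \<tau> = u x + segint (\<lambda>\<sigma>. g (x + \<sigma> *\<^sub>R b) \<bullet> b) \<tau>) \<and>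
    primitive_of U (\<lambda>\<sigma>. g (x + \<sigma> *\<^sub>R b) \<bullet> b) \<and> (AE \<tau> in lborel. u (x + \<tau> *\<^sub>R b) = U \<tau>)"
proof -
  define G where "G x = g x \<bullet> b" for x
  have u: "locally_integrable u" and g: "locally_integrable g"
    using wg by (auto simp: has_weak_gradient_def)
  have G: "locally_integrable G" unfolding G_def by (rule locally_integrable_inner[OF g])
  note [measurable] = locally_integrable_measurable[OF u] locally_integrable_measurable[OF G]
  have [measurable]: "(\<lambda>z. segint (\<lambda>\<sigma>. G (fst z + \<sigma> *\<^sub>R b)) (snd z)) \<in> borel_measurable (borel \<Otimes>\<^sub>M borel)"
    unfolding segint_def by measurable
  define P where "P x \<tau> \<longleftrightarrow> u (x + \<tau> *\<^sub>R b) = u x + segint (\<lambda>\<sigma>. G (x + \<sigma> *\<^sub>R b)) \<tau>" for x \<tau>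
  have "AE \<tau> in lborel. AE x in lborel. P x \<tau>"
  proof (rule AE_I2)
    fix \<tau>
    show "AE x in lborel. P x \<tau>"
      using weak_gradient_segment[OF wg b, of \<tau>] by eventually_elim (simp add: P_def G_def)
  qed
  moreover have "{z \<in> space (lborel \<Otimes>\<^sub>M lborel). P (fst z) (snd z)} \<in> sets (lborel \<Otimes>\<^sub>M lborel)"
    unfolding P_def by measurable
  ultimately have "AE x in lborel. AE \<tau> in lborel. P x \<tau>"
    using lborel_pair.AE_commute[of P] by simp
  then show ?thesis
    using AE_slices_integrable[OF G b]
  proof eventually_elim
    case (elim x)
    have "primitive_of (\<lambda>\<tau>. u x + segint (\<lambda>\<sigma>. G (x + \<sigma> *\<^sub>R b)) \<tau>) (\<lambda>\<sigma>. G (x + \<sigma> *\<^sub>R b))"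
      using elim(2) by (intro primitive_of_segint) auto
    then show ?case using elim(1) unfolding P_def G_def
      by (intro exI[of _ "\<lambda>\<tau>. u x + segint (\<lambda>\<sigma>. g (x + \<sigma> *\<^sub>R b) \<bullet> b) \<tau>"]) auto
  qed
qed

theorem weak_gradient_slice:
  fixes u :: "'a::euclidean_space \<Rightarrow> real"
  assumes wg: "has_weak_gradient u g" and b: "b \<in> Basis"
  shows "AE x in lborel. \<exists>U. primitive_of U (\<lambda>t. g (upd b x t) \<bullet> b) \<and> (AE t in lborel. u (upd b x t) = U t)"
  using weak_gradient_line[OF wg b]
proof eventually_elim
  case (elim x)
  then obtain U where U: "primitive_of U (\<lambda>\<sigma>. g (x + \<sigma> *\<^sub>R b) \<bullet> b)" "AE \<tau> in lborel. u (x + \<tau> *\<^sub>R b) = U \<tau>" by blast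
  show ?case
    using primitive_of_shift[OF U(1), of "- (x \<bullet> b)"] AE_lborel_translate[OF U(2), of "- (x \<bullet> b)"]
    by (intro exI[of _ "\<lambda>t. U (t + - (x \<bullet> b))"]) (simp add: upd_def)
qed

section \<open>From absolute continuity on lines back to weak gradients\<close>

lemma continuous_translate_integral:
  fixes v \<psi> :: "'a::euclidean_space \<Rightarrow> real"
  assumes v: "locally_integrable v" and \<psi>c: "continuous_on UNIV \<psi>"
    and \<psi>: "\<And>x. \<bar>\<psi> x\<bar> \<le> B" "\<And>x. \<psi> x \<noteq> 0 \<Longrightarrow> norm x \<le> R" and b: "b \<in> Basis"
  shows "continuous_on UNIV (\<lambda>\<sigma>. \<integral>x. v x * \<psi> (x - \<sigma> *\<^sub>R b) \<partial>lborel)"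
proof -
  note [measurable] = locally_integrable_measurable[OF v] borel_measurable_continuous_onI[OF \<psi>c]
  have "(\<lambda>n. \<integral>x. v x * \<psi> (x - s n *\<^sub>R b) \<partial>lborel) \<longlonglongrightarrow> (\<integral>x. v x * \<psi> (x - \<sigma> *\<^sub>R b) \<partial>lborel)"
    if s: "s \<longlonglongrightarrow> \<sigma>" for s \<sigma>
  proof -
    obtain S where S: "\<And>n. \<bar>s n\<bar> \<le> S"
      using convergent_imp_Bseq[OF convergentI[OF s]] by (auto simp: Bseq_def)
    have w: "integrable lborel (\<lambda>x. B * \<bar>v x * indicator (cball 0 (R + S)) x\<bar>)"
    proof -
      have "integrable lborel (\<lambda>x. v x * indicator (cball 0 (R + S)) x)"
        by (rule locally_integrable_mult_bounded[OF v indicator_cball_measurable, where B=1 and K="cball 0 (R + S)"])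
           (auto simp: indicator_def split: if_splits)
      then show ?thesis by (intro integrable_mult_right integrable_abs)
    qed
    show ?thesis
    proof (rule integral_dominated_convergence[OF _ _ w])
      show "AE x in lborel. (\<lambda>n. v x * \<psi> (x - s n *\<^sub>R b)) \<longlonglongrightarrow> v x * \<psi> (x - \<sigma> *\<^sub>R b)"
        using s by (intro AE_I2 tendsto_intros continuous_on_tendsto_compose[OF \<psi>c]) auto
      fix n
      show "AE x in lborel. norm (v x * \<psi> (x - s n *\<^sub>R b)) \<le> B * \<bar>v x * indicator (cball 0 (R + S)) x\<bar>"
      proof (rule AE_I2)
        fix x
        show "norm (v x * \<psi> (x - s n *\<^sub>R b)) \<le> B * \<bar>v x * indicator (cball 0 (R + S)) x\<bar>"
        proof (cases "\<psi> (x - s n *\<^sub>R b) = 0")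
          case True
          have "0 \<le> B" using \<psi>(1)[of x] by linarith
          then show ?thesis using True by simp
        next
          case False
          have "norm x \<le> norm (x - s n *\<^sub>R b) + norm (s n *\<^sub>R b)"
            using norm_triangle_ineq[of "x - s n *\<^sub>R b" "s n *\<^sub>R b"] by simp
          also have "\<dots> \<le> R + S" using \<psi>(2)[OF False] S[of n] b by simp
          finally have "x \<in> cball 0 (R + S)" by simp
          moreover have "\<bar>v x\<bar> * \<bar>\<psi> (x - s n *\<^sub>R b)\<bar> \<le> \<bar>v x\<bar> * B" using \<psi>(1) by (intro mult_left_mono) auto
          ultimately show ?thesis by (simp add: abs_mult mult.commute)
        qed
      qed
    qed measurable
  qed
  then show ?thesis
    by (auto simp: continuous_on_sequentially o_def)
qed

lemma segint_zero_imp: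
  assumes m: "continuous_on UNIV m" and 0: "\<And>\<tau>. segint m \<tau> = 0"
  shows "m 0 = 0"
proof -
  have [measurable]: "m \<in> borel_measurable borel" by (rule borel_measurable_continuous_onI[OF m])
  have "set_integrable lborel {x..y} m" for x y
    unfolding set_integrable_def using continuous_on_subset[OF m] by (intro borel_integrable_compact) auto
  then have "primitive_of (\<lambda>\<tau>. 0 + segint m \<tau>) m" by (intro primitive_of_segint) auto
  then have "primitive_of (\<lambda>\<tau>. 0) m" by (simp add: 0)
  then have "((\<lambda>\<tau>. 0) has_real_derivative m 0) (at 0)" by (rule primitive_of_DERIV[OF _ m])
  then show ?thesis using DERIV_unique[OF _ DERIV_const] by blast
qed

text \<open>Testing the difference identity shows that \<open>m1 + m2\<close> has oriented integral
  0 up to every \<open>\<tau>\<close>. Correlations with continuous functions of compact support are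
  continuous in the shift, so the integrand vanishes at 0, which is the equation of the weak
  gradient.\<close>

theorem has_weak_gradientI:
  fixes f :: "'a::euclidean_space \<Rightarrow> real"
  assumes f: "locally_integrable f" and g: "locally_integrable g"
    and seg: "\<And>b \<tau>. b \<in> Basis \<Longrightarrow> AE x in lborel. f (x + \<tau> *\<^sub>R b) - f x = segint (\<lambda>\<sigma>. g (x + \<sigma> *\<^sub>R b) \<bullet> b) \<tau>"
  shows "has_weak_gradient f g"
  unfolding has_weak_gradient_def
proof (intro conjI allI impI ballI f g)
  fix \<phi> :: "'a \<Rightarrow> real" and b :: 'a assume \<phi>: "test_function \<phi>" and b: "b \<in> Basis"
  have G: "locally_integrable (\<lambda>x. g x \<bullet> b)" by (rule locally_integrable_inner[OF g])
  obtain B R where B: "\<And>x. \<bar>\<phi> x\<bar> \<le> B" "\<And>x. \<phi> x \<noteq> 0 \<Longrightarrow> norm x \<le> R"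
    "\<And>x. \<bar>frechet_derivative \<phi> (at x) b\<bar> \<le> B" "\<And>x. frechet_derivative \<phi> (at x) b \<noteq> 0 \<Longrightarrow> norm x \<le> R"
    by (rule test_function_bounds[OF \<phi> b]) (rule that)
  note r = test_function_regular[OF \<phi> b]
  have [measurable]: "\<phi> \<in> borel_measurable borel" by (rule borel_measurable_continuous_onI[OF r(1)])
  define m1 where "m1 \<sigma> = (\<integral>x. f x * frechet_derivative \<phi> (at (x - \<sigma> *\<^sub>R b)) b \<partial>lborel)" for \<sigma>
  define m2 where "m2 \<sigma> = (\<integral>x. (g x \<bullet> b) * \<phi> (x - \<sigma> *\<^sub>R b) \<partial>lborel)" for \<sigma>
  have c1: "continuous_on UNIV m1"
    unfolding m1_def[abs_def] by (rule continuous_translate_integral[OF f r(2) B(3,4) b])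
  have c2: "continuous_on UNIV m2"
    unfolding m2_def[abs_def] by (rule continuous_translate_integral[OF G r(1) B(1,2) b])
  have sm: "integrable lborel (\<lambda>\<sigma>. seg \<tau> \<sigma> * m \<sigma>)" if m: "continuous_on UNIV m" for m \<tau>
  proof (rule seg_integrable)
    show "m \<in> borel_measurable borel" by (rule borel_measurable_continuous_onI[OF m])
    show "set_integrable lborel {x..y} m" for x y
      unfolding set_integrable_def using continuous_on_subset[OF m] by (intro borel_integrable_compact) auto
  qed
  have "segint (\<lambda>\<sigma>. m1 \<sigma> + m2 \<sigma>) \<tau> = 0" for \<tau>
  proof -
    have "- segint m1 \<tau> = (\<integral>x. (f (x + \<tau> *\<^sub>R b) - f x) * \<phi> x \<partial>lborel)"
      unfolding m1_def by (rule test_difference_integral(1)[OF f \<phi> b, symmetric])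
    also have "\<dots> = (\<integral>x. segint (\<lambda>\<sigma>. g (x + \<sigma> *\<^sub>R b) \<bullet> b) \<tau> * \<phi> x \<partial>lborel)"
    proof (rule integral_cong_AE)
      show "(\<lambda>x. (f (x + \<tau> *\<^sub>R b) - f x) * \<phi> x) \<in> borel_measurable lborel"
        using borel_measurable_integrable[OF test_difference_integral(2)[OF f \<phi> b]] .
      show "(\<lambda>x. segint (\<lambda>\<sigma>. g (x + \<sigma> *\<^sub>R b) \<bullet> b) \<tau> * \<phi> x) \<in> borel_measurable lborel"
        using borel_measurable_integrable[OF seg_Fubini(3)[OF G \<open>\<phi> \<in> borel_measurable borel\<close> B(1,2) b]] .
      show "AE x in lborel. (f (x + \<tau> *\<^sub>R b) - f x) * \<phi> x = segint (\<lambda>\<sigma>. g (x + \<sigma> *\<^sub>R b) \<bullet> b) \<tau> * \<phi> x"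
        using seg[OF b, of \<tau>] by eventually_elim simp
    qed
    also have "\<dots> = segint m2 \<tau>"
      unfolding m2_def by (rule seg_Fubini(2)[OF G \<open>\<phi> \<in> borel_measurable borel\<close> B(1,2) b])
    finally have "segint m1 \<tau> + segint m2 \<tau> = 0" by simp
    moreover have "segint (\<lambda>\<sigma>. m1 \<sigma> + m2 \<sigma>) \<tau> = segint m1 \<tau> + segint m2 \<tau>"
      unfolding segint_def using sm[OF c1] sm[OF c2] by (simp add: distrib_left)
    ultimately show ?thesis by simp
  qed
  then have "m1 0 + m2 0 = 0"
    by (rule segint_zero_imp[of "\<lambda>\<sigma>. m1 \<sigma> + m2 \<sigma>", rotated]) (rule continuous_on_add[OF c1 c2])
  then show "(\<integral>x. f x * frechet_derivative \<phi> (at x) b \<partial>lborel) = - (\<integral>x. (g x \<bullet> b) * \<phi> x \<partial>lborel)"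
    by (simp add: m1_def m2_def)
qed

text \<open>The hypothesis concerns the square root of the density but the Fisher information the
  density itself. On lines the rule is that for squares of absolutely continuous functions.\<close>

theorem has_weak_gradient_power2:
  fixes u :: "'a::euclidean_space \<Rightarrow> real"
  assumes wg: "has_weak_gradient u g" and u2: "locally_integrable (\<lambda>x. (u x)\<^sup>2)"
    and ug: "locally_integrable (\<lambda>x. (2 * u x) *\<^sub>R g x)"
  shows "has_weak_gradient (\<lambda>x. (u x)\<^sup>2) (\<lambda>x. (2 * u x) *\<^sub>R g x)"
proof (rule has_weak_gradientI[OF u2 ug])
  fix b :: 'a and \<tau> :: real assume b: "b \<in> Basis"
  have [measurable]: "u \<in> borel_measurable borel" "g \<in> borel_measurable borel"
    using wg by (auto simp: has_weak_gradient_def intro!: locally_integrable_measurable)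
  show "AE x in lborel. (u (x + \<tau> *\<^sub>R b))\<^sup>2 - (u x)\<^sup>2 = segint (\<lambda>\<sigma>. (2 * u (x + \<sigma> *\<^sub>R b)) *\<^sub>R g (x + \<sigma> *\<^sub>R b) \<bullet> b) \<tau>"
    using weak_gradient_line[OF wg b] weak_gradient_segment[OF wg b, of \<tau>]
  proof eventually_elim
    case (elim x)
    let ?h = "\<lambda>\<sigma>. g (x + \<sigma> *\<^sub>R b) \<bullet> b"
    obtain U where U: "U 0 = u x" "\<And>\<tau>. U \<tau> = u x + segint ?h \<tau>" "primitive_of U ?h"
      "AE \<tau> in lborel. u (x + \<tau> *\<^sub>R b) = U \<tau>"
      using elim(1) by blast
    have [measurable]: "U \<in> borel_measurable borel"
      by (rule borel_measurable_continuous_onI[OF primitive_of_continuous[OF U(3)]])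
    have "u (x + \<tau> *\<^sub>R b) = U \<tau>" using elim(2) U(2)[of \<tau>] by simp
    then have "(u (x + \<tau> *\<^sub>R b))\<^sup>2 - (u x)\<^sup>2 = segint (\<lambda>\<sigma>. 2 * U \<sigma> * ?h \<sigma>) \<tau>"
      using segint_primitive_of[OF primitive_of_power2[OF U(3)], of \<tau>] U(1) by simp
    also have "\<dots> = segint (\<lambda>\<sigma>. (2 * u (x + \<sigma> *\<^sub>R b)) *\<^sub>R g (x + \<sigma> *\<^sub>R b) \<bullet> b) \<tau>"
      using U(4) by (intro segint_cong_AE) (auto elim: eventually_mono)
    finally show ?case .
  qed
qed

text \<open>Shows that the choice made in \<open>weak_gradient\<close> does not influence the Fisher
  information.\<close>

theorem has_weak_gradient_unique:
  fixes u :: "'a::euclidean_space \<Rightarrow> real"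
  assumes "has_weak_gradient u g" "has_weak_gradient u g'"
  shows "AE x in lborel. g x = g' x"
proof -
  have l: "locally_integrable g" "locally_integrable g'" using assms by (auto simp: has_weak_gradient_def)
  have "AE x in lborel. g x \<bullet> b - g' x \<bullet> b = 0" if b: "b \<in> Basis" for b
  proof (rule fundamental_lemma_box_bump)
    have l': "locally_integrable (\<lambda>x. g x \<bullet> b)" "locally_integrable (\<lambda>x. g' x \<bullet> b)"
      using l by (auto intro: locally_integrable_inner)
    then show "locally_integrable (\<lambda>x. g x \<bullet> b - g' x \<bullet> b)"
      unfolding locally_integrable_def by (auto intro: set_integral_diff)
    fix p q :: 'a and c :: real assume c: "0 < c"
    have t: "test_function (box_bump p q c)" by (rule test_function_box_bump[OF c])
    have i: "integrable lborel (\<lambda>x. v x * box_bump p q c x)" if "locally_integrable v" for v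
    proof (rule locally_integrable_mult_bounded[OF that])
      show "\<bar>box_bump p q c x\<bar> \<le> 1" for x using box_bump_bounds[OF c, of p q x] by simp
      show "x \<in> cbox p q" if "box_bump p q c x \<noteq> 0" for x
        using that box_bump_outside[of x p q c] box_subset_cbox[of p q] by blast
    qed (use c in auto)
    have "(\<integral>x. (g x \<bullet> b) * box_bump p q c x \<partial>lborel) = (\<integral>x. (g' x \<bullet> b) * box_bump p q c x \<partial>lborel)"
      using assms t b unfolding has_weak_gradient_def by (metis neg_equal_iff_equal)
    then show "(\<integral>x. (g x \<bullet> b - g' x \<bullet> b) * box_bump p q c x \<partial>lborel) = 0"
      using i[OF l'(1)] i[OF l'(2)] by (simp add: left_diff_distrib)
  qed
  then have "AE x in lborel. \<forall>b\<in>Basis. g x \<bullet> b - g' x \<bullet> b = 0" by (intro AE_finite_allI) auto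
  then show ?thesis by eventually_elim (auto intro: euclidean_eqI)
qed

section \<open>Densities bounded below\<close>

text \<open>On the ball of radius \<open>R\<close> the Gaussian density is at least its boundary
  value \<open>c\<close>.\<close>

lemma locally_integrable_std_gaussian:
  fixes v :: "'a::euclidean_space \<Rightarrow> 'b::euclidean_space"
  assumes [measurable]: "v \<in> borel_measurable borel" and v: "integrable std_gaussian v"
  shows "locally_integrable v"
proof (rule locally_integrableI)
  fix R
  define c :: real where "c = (2 * pi) powr (- real DIM('a) / 2) * exp (- R\<^sup>2 / 2)"
  have c: "0 < c" by (simp add: c_def)
  have i: "integrable lborel (\<lambda>x. gauss_density x *\<^sub>R v x)"
    using v unfolding std_gaussian_eq
    by (subst (asm) integrable_density) (auto simp: gauss_density_pos less_imp_le)
  show "set_integrable lborel (cball 0 R) v"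
    unfolding set_integrable_def
  proof (rule Bochner_Integration.integrable_bound)
    show "integrable lborel (\<lambda>x. (1 / c) *\<^sub>R (gauss_density x *\<^sub>R v x))" by (rule integrable_scaleR_right[OF i])
    have "(indicator (cball 0 R) :: 'a \<Rightarrow> real) \<in> borel_measurable borel" by (rule indicator_cball_measurable)
    then show "(\<lambda>x. indicator (cball 0 R) x *\<^sub>R v x) \<in> borel_measurable lborel" by simp
    show "AE x in lborel. norm (indicator (cball 0 R) x *\<^sub>R v x) \<le> norm ((1 / c) *\<^sub>R (gauss_density x *\<^sub>R v x))"
    proof (rule AE_I2)
      fix x :: 'a
      show "norm (indicator (cball 0 R) x *\<^sub>R v x) \<le> norm ((1 / c) *\<^sub>R (gauss_density x *\<^sub>R v x))"
      proof (cases "norm x \<le> R")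
        case True
        then have "(norm x)\<^sup>2 \<le> R\<^sup>2" by (intro power_mono) auto
        then have "c \<le> gauss_density x" by (auto simp: c_def gauss_density_def intro!: mult_left_mono)
        then have "1 \<le> gauss_density x / c" using c by simp
        then have "norm (v x) \<le> gauss_density x / c * norm (v x)"
          using mult_right_mono[of 1 "gauss_density x / c" "norm (v x)"] by simp
        then show ?thesis using True c gauss_density_pos[of x] by (simp add: indicator_def)
      qed (simp add: indicator_def)
    qed
  qed
qed

lemma has_weak_gradient_cong_AE:
  fixes u :: "'a::euclidean_space \<Rightarrow> real"
  assumes wg: "has_weak_gradient u g" and [measurable]: "u' \<in> borel_measurable borel" and eq: "AE x in lborel. u x = u' x"
  shows "has_weak_gradient u' g"
proof -
  have u: "locally_integrable u" using wg by (simp add: has_weak_gradient_def)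
  note [measurable] = locally_integrable_measurable[OF u]
  have "locally_integrable u'"
    unfolding locally_integrable_def
  proof (intro allI impI)
    fix K :: "'a set" assume K: "compact K"
    then have i: "integrable lborel (\<lambda>x. indicator K x *\<^sub>R u x)" using u by (auto simp: locally_integrable_def set_integrable_def)
    have "K \<in> sets borel" by (rule borel_closed[OF compact_imp_closed[OF K]])
    then have "(\<lambda>x. indicator K x *\<^sub>R u' x) \<in> borel_measurable lborel" by simp
    moreover have "AE x in lborel. indicator K x *\<^sub>R u x = indicator K x *\<^sub>R u' x" using eq by eventually_elim simp
    ultimately show "set_integrable lborel K u'"
      using i unfolding set_integrable_def by (rule integrable_cong_AE_imp[rotated])
  qed
  moreover have "(\<integral>x. u' x * frechet_derivative \<phi> (at x) b \<partial>lborel) = (\<integral>x. u x * frechet_derivative \<phi> (at x) b \<partial>lborel)"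
    if "test_function \<phi>" "b \<in> Basis" for \<phi> b
  proof -
    note [measurable] = borel_measurable_continuous_onI[OF test_function_regular(2)[OF that]]
    show ?thesis using eq by (intro integral_cong_AE) (auto elim: eventually_mono)
  qed
  ultimately show ?thesis using wg unfolding has_weak_gradient_def by simp
qed

lemma AE_continuous_ge:
  fixes U :: "real \<Rightarrow> real"
  assumes "continuous_on UNIV U" "AE t in lborel. c \<le> U t"
  shows "c \<le> U t"
proof -
  have "closed {t. c \<le> U t}" using assms(1) by (intro closed_Collect_le continuous_intros) auto
  moreover have "AE t in lebesgue. t \<in> {t. c \<le> U t}" using assms(2) by (auto intro: AE_completion)
  ultimately show ?thesis using mem_closed_if_AE_lebesgue[of "{t. c \<le> U t}" t] by simp
qed

text \<open>The truncation \<open>\<kappa> M s = (1 / s + 1 / M)\<inverse>\<close> of the square root of the density is bounded,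
  increasing and 1-Lipschitz, so that it does not increase the Fisher information.\<close>

definition \<kappa> :: "real \<Rightarrow> real \<Rightarrow> real" where
  "\<kappa> M s = s * M / (M + s)"

lemma \<kappa>_pos: "0 < M \<Longrightarrow> 0 < s \<Longrightarrow> 0 < \<kappa> M s"
  by (simp add: \<kappa>_def)

lemma \<kappa>_le: "0 < M \<Longrightarrow> 0 < s \<Longrightarrow> \<kappa> M s \<le> s" "0 < M \<Longrightarrow> 0 < s \<Longrightarrow> \<kappa> M s \<le> M"
  by (simp_all add: \<kappa>_def field_simps)

lemma \<kappa>_inverse: "0 < M \<Longrightarrow> 0 < s \<Longrightarrow> 1 / \<kappa> M s = 1 / s + 1 / M"
  by (simp add: \<kappa>_def field_simps)

lemma \<kappa>_mono:
  assumes "0 < M" "M \<le> M'" "0 < s" "s \<le> s'"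
  shows "\<kappa> M s \<le> \<kappa> M' s'"
proof -
  have "1 / \<kappa> M' s' \<le> 1 / \<kappa> M s"
    using assms by (simp add: \<kappa>_inverse add_mono divide_left_mono)
  then show ?thesis using assms \<kappa>_pos[of M s] \<kappa>_pos[of M' s'] by (simp add: field_simps)
qed

lemma DERIV_\<kappa>: "0 < M \<Longrightarrow> 0 < s \<Longrightarrow> (\<kappa> M has_real_derivative (M / (M + s))\<^sup>2) (at s)"
  unfolding \<kappa>_def[abs_def]
  by (auto intro!: derivative_eq_intros simp: power2_eq_square field_simps)

lemma x_ln_x_ge: "0 < (y::real) \<Longrightarrow> -1 \<le> y * ln y"
proof -
  assume y: "0 < y"
  have "ln (1 / y) \<le> 1 / y - 1" using y by (intro ln_le_minus_one) simp
  then have "y * (1 - 1 / y) \<le> y * ln y" using y by (intro mult_left_mono) (auto simp: ln_div)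
  then show ?thesis using y by (simp add: algebra_simps)
qed

locale log_sobolev_density =
  fixes f :: "'a::euclidean_space \<Rightarrow> real" and g :: "'a \<Rightarrow> 'a" and \<alpha> :: real
  assumes \<alpha>: "0 < \<alpha>"
    and f_meas [measurable]: "f \<in> borel_measurable borel"
    and f_ge: "AE x in lborel. \<alpha> \<le> f x"
    and f_int: "integrable std_gaussian f" "(\<integral>x. f x \<partial>std_gaussian) = 1"
    and wg: "has_weak_gradient (\<lambda>x. sqrt (f x)) g"
    and g_int: "integrable std_gaussian (\<lambda>x. (norm (g x))\<^sup>2)"
begin

text \<open>The bound \<open>f \<ge> \<alpha>\<close> holds only almost everywhere; \<open>v\<close>
  is the version of the square root that obeys it everywhere, as the estimates for entropies
  require.\<close>

definition v :: "'a \<Rightarrow> real" where "v x = max (sqrt \<alpha>) (sqrt (f x))"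

definition F :: "real \<Rightarrow> 'a \<Rightarrow> real" where "F M x = (\<kappa> M (v x))\<^sup>2"

text \<open>The Fisher integrand of \<open>F M\<close> in direction \<open>b\<close>: the derivative
  of \<open>F M\<close> is twice the truncated root times
  \<open>(M / (M + v x))\<^sup>2 * (g x \<bullet> b)\<close>, and division of its square by
  \<open>F M\<close> cancels the root.\<close>

definition J :: "real \<Rightarrow> 'a \<Rightarrow> 'a \<Rightarrow> real" where "J M b x = 4 * ((M / (M + v x))\<^sup>2)\<^sup>2 * (g x \<bullet> b)\<^sup>2"

text \<open>A lower bound for \<open>F M\<close> uniform in \<open>M \<ge> 1\<close>, as
  \<open>\<kappa>\<close> increases in both arguments. It depends on \<open>\<alpha>\<close> alone
  and is thus common to all densities of the sequence.\<close>

definition \<beta> :: real where "\<beta> = (\<kappa> 1 (sqrt \<alpha>))\<^sup>2"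

definition slice_deficit :: "real \<Rightarrow> 'a \<Rightarrow> 'a \<Rightarrow> real" where
  "slice_deficit M b x = avg b (J M b) x / 2 - slice_ent b (F M) x"

lemma g_meas [measurable]: "g \<in> borel_measurable borel"
  using wg by (auto simp: has_weak_gradient_def intro: locally_integrable_measurable)

lemma v_meas [measurable]: "v \<in> borel_measurable borel"
  unfolding v_def[abs_def] by measurable

lemma F_meas [measurable]: "F M \<in> borel_measurable borel"
  unfolding F_def[abs_def] \<kappa>_def by measurable

lemma J_meas [measurable]: "J M b \<in> borel_measurable borel"
  unfolding J_def[abs_def] by measurable

lemma v_pos: "0 < v x" and v_ge: "sqrt \<alpha> \<le> v x"
  using \<alpha> by (auto simp: v_def less_max_iff_disj)

lemma v_eq: "AE x in lborel. v x = sqrt (f x)"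
  using f_ge by eventually_elim (auto simp: v_def max_def)

lemma f_eq: "AE x in lborel. f x = (v x)\<^sup>2"
  using v_eq f_ge by eventually_elim (use \<alpha> in simp)

lemma \<beta>_pos: "0 < \<beta>"
  using \<alpha> \<kappa>_pos[of 1 "sqrt \<alpha>"] by (simp add: \<beta>_def)

lemma F_ge: "1 \<le> M \<Longrightarrow> \<beta> \<le> F M x"
  unfolding \<beta>_def F_def using \<alpha> v_ge \<kappa>_pos[of 1 "sqrt \<alpha>"]
  by (intro power_mono \<kappa>_mono) auto

lemma F_le: "1 \<le> M \<Longrightarrow> F M x \<le> M\<^sup>2"
  unfolding F_def using v_pos[of x] \<kappa>_pos[of M "v x"] by (intro power_mono \<kappa>_le) auto

lemma F_pos: "1 \<le> M \<Longrightarrow> 0 < F M x"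
  using F_ge[of M x] \<beta>_pos by linarith

lemma F_le_f:
  assumes "1 \<le> M"
  shows "AE x in lborel. F M x \<le> f x"
  using f_eq
proof eventually_elim
  case (elim x)
  have "(\<kappa> M (v x))\<^sup>2 \<le> (v x)\<^sup>2" using assms v_pos[of x] \<kappa>_pos[of M "v x"] by (intro power_mono \<kappa>_le) auto
  then show ?case by (simp only: F_def elim)
qed

lemma F_int: "1 \<le> M \<Longrightarrow> integrable std_gaussian (F M)"
  using F_le[of M] F_pos[of M] by (intro std_gaussian_integrable_bounded[of _ "M\<^sup>2"]) (auto simp: less_imp_le)

lemma F_mass:
  assumes M: "1 \<le> M"
  shows "(\<integral>x. F M x \<partial>std_gaussian) \<le> 1" "\<beta> \<le> (\<integral>x. F M x \<partial>std_gaussian)"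
proof -
  have "(\<integral>x. F M x \<partial>std_gaussian) \<le> (\<integral>x. f x \<partial>std_gaussian)"
    using F_le_f[OF M] by (intro integral_mono_AE F_int[OF M] f_int) (simp add: AE_std_gaussian_iff)
  then show "(\<integral>x. F M x \<partial>std_gaussian) \<le> 1" using f_int by simp
  have "(\<integral>x. \<beta> \<partial>(std_gaussian :: 'a measure)) \<le> (\<integral>x. F M x \<partial>std_gaussian)"
    using F_ge[OF M] by (intro integral_mono F_int[OF M]) auto
  then show "\<beta> \<le> (\<integral>x. F M x \<partial>std_gaussian)"
    using std_gaussian_measure_space[where 'a='a] by simp
qed

lemma inner_int: "b \<in> Basis \<Longrightarrow> integrable std_gaussian (\<lambda>x. (g x \<bullet> b)\<^sup>2)"
proof (rule Bochner_Integration.integrable_bound[OF g_int])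
  assume b: "b \<in> Basis"
  have "(g x \<bullet> b)\<^sup>2 \<le> (norm (g x))\<^sup>2" for x
    using power_mono[OF Basis_le_norm[OF b, of "g x"], of 2] by simp
  then show "AE x in std_gaussian. norm ((g x \<bullet> b)\<^sup>2) \<le> norm ((norm (g x))\<^sup>2)" by simp
qed measurable

lemma J_bounds: "1 \<le> M \<Longrightarrow> 0 \<le> J M b x" "1 \<le> M \<Longrightarrow> J M b x \<le> 4 * (g x \<bullet> b)\<^sup>2"
proof -
  assume M: "1 \<le> M"
  show "0 \<le> J M b x" by (simp add: J_def)
  have "M / (M + v x) \<le> 1" "0 \<le> M / (M + v x)" using M v_pos[of x] by (simp_all add: field_simps)
  then have "((M / (M + v x))\<^sup>2)\<^sup>2 \<le> 1" by (simp add: power_le_one)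
  then have "((M / (M + v x))\<^sup>2)\<^sup>2 * (g x \<bullet> b)\<^sup>2 \<le> 1 * (g x \<bullet> b)\<^sup>2" by (intro mult_right_mono) auto
  then show "J M b x \<le> 4 * (g x \<bullet> b)\<^sup>2" by (simp add: J_def)
qed

lemma J_int:
  assumes "1 \<le> M" "b \<in> Basis"
  shows "integrable std_gaussian (J M b)" "(\<integral>x. J M b x \<partial>std_gaussian) \<le> 4 * (\<integral>x. (g x \<bullet> b)\<^sup>2 \<partial>std_gaussian)"
proof -
  have i: "integrable std_gaussian (\<lambda>x. 4 * (g x \<bullet> b)\<^sup>2)" using inner_int[OF assms(2)] by simp
  show j: "integrable std_gaussian (J M b)"
    by (rule Bochner_Integration.integrable_bound[OF i]) (use J_bounds[OF assms(1), of b] in auto)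
  have "(\<integral>x. J M b x \<partial>std_gaussian) \<le> (\<integral>x. 4 * (g x \<bullet> b)\<^sup>2 \<partial>std_gaussian)"
    using J_bounds[OF assms(1)] by (intro integral_mono j i) auto
  then show "(\<integral>x. J M b x \<partial>std_gaussian) \<le> 4 * (\<integral>x. (g x \<bullet> b)\<^sup>2 \<partial>std_gaussian)" by simp
qed

lemma slice_primitive:
  assumes M: "1 \<le> M" and b: "b \<in> Basis"
  shows "AE x in lborel. \<exists>Fc h. primitive_of Fc h \<and> (\<forall>t. \<beta> \<le> Fc t) \<and> (\<forall>t. Fc t \<le> M\<^sup>2) \<and>
    (AE t in lborel. F M (upd b x t) = Fc t) \<and> (AE t in lborel. J M b (upd b x t) = (h t)\<^sup>2 / Fc t)"
  using weak_gradient_slice[OF wg b] AE_upd[OF b v_eq]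
proof eventually_elim
  case (elim x)
  obtain U where U: "primitive_of U (\<lambda>t. g (upd b x t) \<bullet> b)" and eq: "AE t in lborel. sqrt (f (upd b x t)) = U t"
    using elim(1) by blast
  have vU: "AE t in lborel. v (upd b x t) = U t" using eq elim(2) by eventually_elim simp
  have "AE t in lborel. sqrt \<alpha> \<le> U t" using vU by eventually_elim (metis v_ge)
  \<comment> \<open>Continuity of \<open>U\<close> turns the bound almost everywhere into one at
    every point, so that \<open>\<kappa> M\<close> may be composed with \<open>U\<close> along the
    whole line.\<close>
  then have Uge: "sqrt \<alpha> \<le> U t" for t by (rule AE_continuous_ge[OF primitive_of_continuous[OF U]])
  have Upos: "0 < U t" for t using Uge[of t] \<alpha> by (meson less_le_trans real_sqrt_gt_zero)
  define k where "k t = \<kappa> M (U t)" for t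
  define h where "h t = 2 * k t * ((M / (M + U t))\<^sup>2 * (g (upd b x t) \<bullet> b))" for t
  have kpos: "0 < k t" for t using M Upos by (simp add: k_def \<kappa>_pos)
  have "primitive_of (\<lambda>t. \<kappa> M (U t)) (\<lambda>t. (M / (M + U t))\<^sup>2 * (g (upd b x t) \<bullet> b))"
    using M Upos by (intro primitive_of_chain[OF U, of "{0<..}" "\<kappa> M" "\<lambda>s. (M / (M + s))\<^sup>2"])
      (auto intro!: continuous_intros DERIV_\<kappa> simp: is_interval_1)
  then have P: "primitive_of (\<lambda>t. (k t)\<^sup>2) h"
    unfolding k_def h_def[abs_def] by (rule primitive_of_power2)
  have "\<beta> \<le> (k t)\<^sup>2" "(k t)\<^sup>2 \<le> M\<^sup>2" for t
  proof -
    show "\<beta> \<le> (k t)\<^sup>2" unfolding \<beta>_def k_def using \<alpha> M Uge \<kappa>_pos[of 1 "sqrt \<alpha>"] by (intro power_mono \<kappa>_mono) auto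
    show "(k t)\<^sup>2 \<le> M\<^sup>2" using kpos[of t] Upos[of t] M unfolding k_def by (intro power_mono \<kappa>_le) auto
  qed
  moreover have "AE t in lborel. F M (upd b x t) = (k t)\<^sup>2" using vU by eventually_elim (simp add: F_def k_def)
  moreover have "AE t in lborel. J M b (upd b x t) = (h t)\<^sup>2 / (k t)\<^sup>2"
    using vU
  proof eventually_elim
    case (elim t)
    then show ?case using kpos[of t] by (simp add: J_def h_def power_mult_distrib)
  qed
  ultimately show ?case using P by blast
qed

lemma slice_deficit_bounds:
  assumes M: "1 \<le> M" and b: "b \<in> Basis"
  shows "AE x in lborel. 0 \<le> slice_deficit M b x \<and>
    (slice_stable \<beta> L \<epsilon> \<eta> \<longrightarrow> avg b (F M) x \<le> L \<longrightarrow> slice_deficit M b x \<le> \<eta> \<longrightarrow>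
      avg b (\<lambda>y. \<bar>1 / F M y - avg b (\<lambda>y. 1 / F M y) y\<bar>) x \<le> \<epsilon>)"
  using slice_primitive[OF M b] avg_integral(1)[OF b J_meas J_int(1)[OF M b], unfolded AE_std_gaussian_iff]
proof eventually_elim
  case (elim x)
  obtain Fc h where P: "primitive_of Fc h" and Fc: "\<And>t. \<beta> \<le> Fc t" "\<And>t. Fc t \<le> M\<^sup>2"
    and Feq: "AE t in lborel. F M (upd b x t) = Fc t" and Jeq: "AE t in lborel. J M b (upd b x t) = (h t)\<^sup>2 / Fc t"
    using elim(1) by blast
  note [measurable] = primitive_ofD(1)[OF P] borel_measurable_continuous_onI[OF primitive_of_continuous[OF P]]
  have Feq': "AE t in gauss1. F M (upd b x t) = Fc t" and Jeq': "AE t in gauss1. J M b (upd b x t) = (h t)\<^sup>2 / Fc t"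
    using Feq Jeq by (simp_all add: AE_gauss1_iff)
  have Ji: "integrable gauss1 (\<lambda>t. (h t)\<^sup>2 / Fc t)"
    by (rule integrable_cong_AE_imp[OF elim(2) _ Jeq']) measurable
  have e1: "avg b (J M b) x = (\<integral>t. (h t)\<^sup>2 / Fc t \<partial>gauss1)"
    unfolding avg_def using Jeq' by (intro integral_cong_AE) auto
  have e2: "avg b (F M) x = (\<integral>t. Fc t \<partial>gauss1)"
    unfolding avg_def using Feq' by (intro integral_cong_AE) auto
  have e3: "avg b (\<lambda>y. F M y * ln (F M y)) x = (\<integral>t. Fc t * ln (Fc t) \<partial>gauss1)"
    unfolding avg_def using Feq' by (intro integral_cong_AE) (auto elim: eventually_mono)
  have e4: "avg b (\<lambda>y. 1 / F M y) x = (\<integral>t. 1 / Fc t \<partial>gauss1)"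
    unfolding avg_def using Feq' by (intro integral_cong_AE) (auto elim: eventually_mono)
  have e5: "avg b (\<lambda>y. \<bar>1 / F M y - avg b (\<lambda>y. 1 / F M y) y\<bar>) x = (\<integral>t. \<bar>1 / Fc t - (\<integral>t. 1 / Fc t \<partial>gauss1)\<bar> \<partial>gauss1)"
    unfolding avg_def[of b "\<lambda>y. \<bar>1 / F M y - avg b (\<lambda>y. 1 / F M y) y\<bar>"] avg_upd[OF b] e4
    using Feq' by (intro integral_cong_AE) (auto elim: eventually_mono)
  have d: "slice_deficit M b x = (\<integral>t. (h t)\<^sup>2 / Fc t \<partial>gauss1) / 2
      - ((\<integral>t. Fc t * ln (Fc t) \<partial>gauss1) - (\<integral>t. Fc t \<partial>gauss1) * ln (\<integral>t. Fc t \<partial>gauss1))"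
    unfolding slice_deficit_def slice_ent_def e1 e2 e3 ..
  have "0 \<le> slice_deficit M b x"
    by (rule gaussian_transport_deficit[OF P \<beta>_pos Fc Ji refl d])
  moreover have "avg b (\<lambda>y. \<bar>1 / F M y - avg b (\<lambda>y. 1 / F M y) y\<bar>) x \<le> \<epsilon>"
    if "slice_stable \<beta> L \<epsilon> \<eta>" "avg b (F M) x \<le> L" "slice_deficit M b x \<le> \<eta>"
    using that(1)[unfolded slice_stable_def, rule_format, OF P Fc Ji] that(2,3) unfolding e2 e5 d by blast
  ultimately show ?case by blast
qed

lemma slice_deficit_int:
  assumes M: "1 \<le> M" and b: "b \<in> Basis"
  shows "integrable std_gaussian (slice_deficit M b)"
    "(\<integral>x. slice_deficit M b x \<partial>std_gaussian) = (\<integral>x. J M b x \<partial>std_gaussian) / 2 - (\<integral>x. slice_ent b (F M) x \<partial>std_gaussian)"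
    "0 \<le> (\<integral>x. slice_deficit M b x \<partial>std_gaussian)"
proof -
  note i1 = avg_integral(2,3)[OF b J_meas J_int(1)[OF M b]]
  note i2 = slice_ent_integrable[OF F_meas \<beta>_pos F_ge[OF M] F_le[OF M] b]
  show "integrable std_gaussian (slice_deficit M b)"
    unfolding slice_deficit_def[abs_def] using i1(1) i2 by (intro Bochner_Integration.integrable_diff integrable_divide)
  have "(\<integral>x. slice_deficit M b x \<partial>std_gaussian) = (\<integral>x. avg b (J M b) x / 2 \<partial>std_gaussian) - (\<integral>x. slice_ent b (F M) x \<partial>std_gaussian)"
    unfolding slice_deficit_def using i1(1) i2 by (intro Bochner_Integration.integral_diff integrable_divide)
  then show "(\<integral>x. slice_deficit M b x \<partial>std_gaussian) = (\<integral>x. J M b x \<partial>std_gaussian) / 2 - (\<integral>x. slice_ent b (F M) x \<partial>std_gaussian)"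
    using i1(2) by simp
  show "0 \<le> (\<integral>x. slice_deficit M b x \<partial>std_gaussian)"
    using slice_deficit_bounds[OF M b] by (intro integral_nonneg_AE) (auto simp: AE_std_gaussian_iff elim: eventually_mono)
qed

text \<open>The directional Fisher parts are dominated before truncation and add up to the full
  gradient; the entropies on lines are bounded from below by subadditivity. The normalizing term
  \<open>m * ln m\<close> may be dropped because truncation leaves a mass of at most 1.\<close>

lemma sum_slice_deficit:
  assumes M: "1 \<le> M"
  shows "(\<Sum>b\<in>Basis. (\<integral>x. slice_deficit M b x \<partial>std_gaussian))
    \<le> 2 * (\<integral>x. (norm (g x))\<^sup>2 \<partial>std_gaussian) - (\<integral>x. F M x * ln (F M x) \<partial>std_gaussian)"
proof -
  define m where "m = (\<integral>x. F M x \<partial>std_gaussian)"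
  have m: "0 < m" "m \<le> 1" using F_mass[OF M] \<beta>_pos by (auto simp: m_def)
  have "(\<Sum>b\<in>Basis. (\<integral>x. slice_deficit M b x \<partial>std_gaussian))
      \<le> (\<Sum>b\<in>Basis. 2 * (\<integral>x. (g x \<bullet> b)\<^sup>2 \<partial>std_gaussian) - (\<integral>x. slice_ent b (F M) x \<partial>std_gaussian))"
  proof (rule sum_mono)
    fix b :: 'a assume b: "b \<in> Basis"
    show "(\<integral>x. slice_deficit M b x \<partial>std_gaussian) \<le> 2 * (\<integral>x. (g x \<bullet> b)\<^sup>2 \<partial>std_gaussian) - (\<integral>x. slice_ent b (F M) x \<partial>std_gaussian)"
      using slice_deficit_int(2)[OF M b] J_int(2)[OF M b] by simp
  qed
  also have "\<dots> = 2 * (\<Sum>b\<in>Basis. (\<integral>x. (g x \<bullet> b)\<^sup>2 \<partial>std_gaussian)) - (\<Sum>b\<in>Basis. (\<integral>x. slice_ent b (F M) x \<partial>std_gaussian))"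
    by (simp add: sum_subtractf sum_distrib_left)
  also have "(\<Sum>b\<in>Basis. (\<integral>x. (g x \<bullet> b)\<^sup>2 \<partial>std_gaussian)) = (\<integral>x. (\<Sum>b\<in>Basis. (g x \<bullet> b)\<^sup>2) \<partial>std_gaussian)"
    by (rule Bochner_Integration.integral_sum[symmetric]) (rule inner_int)
  also have "(\<lambda>x. \<Sum>b\<in>Basis. (g x \<bullet> b)\<^sup>2) = (\<lambda>x. (norm (g x))\<^sup>2)"
    unfolding power2_norm_eq_inner by (subst (2) euclidean_inner) (simp add: power2_eq_square)
  finally have "(\<Sum>b\<in>Basis. (\<integral>x. slice_deficit M b x \<partial>std_gaussian))
      \<le> 2 * (\<integral>x. (norm (g x))\<^sup>2 \<partial>std_gaussian) - (\<Sum>b\<in>Basis. (\<integral>x. slice_ent b (F M) x \<partial>std_gaussian))" .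
  moreover have "(\<integral>x. F M x * ln (F M x) \<partial>std_gaussian) - m * ln m \<le> (\<Sum>b\<in>Basis. (\<integral>x. slice_ent b (F M) x \<partial>std_gaussian))"
    unfolding m_def by (rule entropy_subadditivity[OF F_meas \<beta>_pos F_ge[OF M] F_le[OF M]])
  moreover have "m * ln m \<le> 0" using m by (simp add: mult_nonneg_nonpos)
  ultimately show ?thesis by linarith
qed

lemma F_ln_F_int:
  assumes M: "1 \<le> M"
  shows "integrable std_gaussian (\<lambda>x. F M x * ln (F M x))"
  by (rule std_gaussian_integrable_bounded[OF _ xlnx_bound[OF \<beta>_pos F_ge[OF M] F_le[OF M] F_ge[OF M] F_le[OF M]]])
     measurable

lemma F_tendsto: "AE x in lborel. (\<lambda>n. F (real (Suc n)) x) \<longlonglongrightarrow> f x"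
  using f_eq
proof eventually_elim
  case (elim x)
  have "(\<lambda>n. 1 / (1 / v x + 1 / real (Suc n))) \<longlonglongrightarrow> 1 / (1 / v x + 0)"
    using v_pos[of x] LIMSEQ_Suc[OF lim_1_over_n] by (intro tendsto_intros) auto
  moreover have "1 / (1 / v x + 1 / real (Suc n)) = \<kappa> (real (Suc n)) (v x)" for n
  proof -
    have "1 / \<kappa> (real (Suc n)) (v x) = 1 / v x + 1 / real (Suc n)" by (rule \<kappa>_inverse) (auto simp: v_pos)
    then show ?thesis by (simp only: divide_divide_eq_right mult_1_left div_by_1 flip: \<open>1 / \<kappa> (real (Suc n)) (v x) = _\<close>)
  qed
  ultimately have "(\<lambda>n. (\<kappa> (real (Suc n)) (v x))\<^sup>2) \<longlonglongrightarrow> (v x)\<^sup>2"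
    by (intro tendsto_power) simp
  then show ?case by (simp only: F_def elim)
qed

text \<open>By Fatou's lemma; the argument also shows that \<open>f log f\<close> is integrable, so that the relative entropy
  is not a junk value.\<close>

lemma entropy_approx:
  assumes "0 < \<epsilon>"
  shows "\<exists>M\<ge>max 1 K. (\<integral>x. f x * ln (f x) \<partial>std_gaussian) - \<epsilon> \<le> (\<integral>x. F M x * ln (F M x) \<partial>std_gaussian)"
proof -
  define G where "G n x = F (real (Suc n)) x" for n x
  have G1: "1 \<le> real (Suc n)" for n by simp
  have Gi: "integrable std_gaussian (\<lambda>x. G n x * ln (G n x) + 1)" for n
    unfolding G_def using F_ln_F_int[OF G1] by simp
  \<comment> \<open>Adding 1 makes the integrand nonnegative, since
    \<open>y * ln y \<ge> -1\<close>; Fatou's lemma applies to it.\<close>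
  have G0: "0 \<le> G n x * ln (G n x) + 1" for n x
    using x_ln_x_ge[OF F_pos[OF G1[of n], of x]] unfolding G_def by linarith
  have [measurable]: "G n \<in> borel_measurable borel" for n unfolding G_def[abs_def] by measurable
  have fpos: "AE x in std_gaussian. 0 \<le> f x * ln (f x) + 1"
    using f_ge unfolding AE_std_gaussian_iff
  proof eventually_elim
    case (elim x)
    then show ?case using x_ln_x_ge[of "f x"] \<alpha> by linarith
  qed
  define C where "C = 2 * (\<integral>x. (norm (g x))\<^sup>2 \<partial>std_gaussian)"
  have nn: "(\<integral>\<^sup>+x. ennreal (G n x * ln (G n x) + 1) \<partial>std_gaussian) = ennreal ((\<integral>x. G n x * ln (G n x) \<partial>std_gaussian) + 1)" for n
  proof -
    have "(\<integral>\<^sup>+x. ennreal (G n x * ln (G n x) + 1) \<partial>std_gaussian) = ennreal (\<integral>x. G n x * ln (G n x) + 1 \<partial>std_gaussian)"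
      using Gi G0 by (intro nn_integral_eq_integral) auto
    then show ?thesis
      using F_ln_F_int[OF G1] std_gaussian_measure_space[where 'a='a] unfolding G_def by simp
  qed
  \<comment> \<open>The logarithmic Sobolev inequality for the truncated densities, with a bound
    that does not depend on the level.\<close>
  have GC: "(\<integral>x. G n x * ln (G n x) \<partial>std_gaussian) \<le> C" for n
  proof -
    have "0 \<le> (\<Sum>b\<in>Basis. (\<integral>x. slice_deficit (real (Suc n)) b x \<partial>std_gaussian))"
      using slice_deficit_int(3)[OF G1] by (intro sum_nonneg) auto
    then show ?thesis using sum_slice_deficit[OF G1, of n] unfolding G_def C_def by linarith
  qed
  have lim: "AE x in std_gaussian. (\<lambda>n. ennreal (G n x * ln (G n x) + 1)) \<longlonglongrightarrow> ennreal (f x * ln (f x) + 1)"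
    using F_tendsto f_ge unfolding AE_std_gaussian_iff
  proof eventually_elim
    case (elim x)
    then show ?case using \<alpha> unfolding G_def by (intro tendsto_ennrealI tendsto_intros) auto
  qed
  have fatou: "(\<integral>\<^sup>+x. ennreal (f x * ln (f x) + 1) \<partial>std_gaussian)
      \<le> liminf (\<lambda>n. \<integral>\<^sup>+x. ennreal (G n x * ln (G n x) + 1) \<partial>std_gaussian)"
  proof -
    have "(\<integral>\<^sup>+x. ennreal (f x * ln (f x) + 1) \<partial>std_gaussian) = (\<integral>\<^sup>+x. liminf (\<lambda>n. ennreal (G n x * ln (G n x) + 1)) \<partial>std_gaussian)"
      using lim by (intro nn_integral_cong_AE) (auto elim!: eventually_mono dest: lim_imp_Liminf[OF trivial_limit_sequentially])
    also have "\<dots> \<le> liminf (\<lambda>n. \<integral>\<^sup>+x. ennreal (G n x * ln (G n x) + 1) \<partial>std_gaussian)"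
      by (rule nn_integral_liminf) measurable
    finally show ?thesis .
  qed
  also have "\<dots> \<le> ennreal (C + 1)"
    unfolding nn using GC by (intro Liminf_le always_eventually allI ennreal_leI) auto
  finally have fin: "(\<integral>\<^sup>+x. ennreal (f x * ln (f x) + 1) \<partial>std_gaussian) < \<infinity>" by (rule le_less_trans) simp
  have fi1: "integrable std_gaussian (\<lambda>x. f x * ln (f x) + 1)"
    using fin fpos by (intro integrableI_nonneg) auto
  have fi: "integrable std_gaussian (\<lambda>x. f x * ln (f x))"
    using Bochner_Integration.integrable_diff[OF fi1 std_gaussian.integrable_const[of 1]] by simp
  define H where "H = (\<integral>x. f x * ln (f x) \<partial>std_gaussian)"
  have H: "(\<integral>\<^sup>+x. ennreal (f x * ln (f x) + 1) \<partial>std_gaussian) = ennreal (H + 1)"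
    using fi fi1 fpos std_gaussian_measure_space[where 'a='a]
    by (subst nn_integral_eq_integral) (auto simp: H_def)
  have H0: "0 \<le> H + 1"
  proof -
    have "0 \<le> (\<integral>x. f x * ln (f x) + 1 \<partial>std_gaussian)" using fpos by (rule integral_nonneg_AE)
    then show ?thesis using fi std_gaussian_measure_space[where 'a='a] by (simp add: H_def)
  qed
  obtain N :: nat where N: "K \<le> real N" using real_arch_simple by blast
  have "\<exists>n\<ge>N. H - \<epsilon> \<le> (\<integral>x. G n x * ln (G n x) \<partial>std_gaussian)"
  proof (rule ccontr)
    assume "\<not> ?thesis"
    then have lt: "(\<integral>x. G n x * ln (G n x) \<partial>std_gaussian) \<le> H - \<epsilon>" if "n \<ge> N" for n using that by force
    have "liminf (\<lambda>n. \<integral>\<^sup>+x. ennreal (G n x * ln (G n x) + 1) \<partial>std_gaussian) \<le> ennreal (H - \<epsilon> + 1)"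
    proof (rule Liminf_le)
      show "\<forall>\<^sub>F n in sequentially. (\<integral>\<^sup>+x. ennreal (G n x * ln (G n x) + 1) \<partial>std_gaussian) \<le> ennreal (H - \<epsilon> + 1)"
        unfolding nn using lt by (intro eventually_sequentiallyI[of N] ennreal_leI) auto
    qed simp
    then have "ennreal (H + 1) \<le> ennreal (H - \<epsilon> + 1)" using fatou unfolding H by simp
    \<comment> \<open>Needed to read the comparison in \<open>ennreal\<close> as one of real
      numbers.\<close>
    moreover have "0 \<le> H - \<epsilon> + 1"
    proof -
      have "0 \<le> (\<integral>x. G N x * ln (G N x) + 1 \<partial>std_gaussian)" using G0 by (intro integral_nonneg_AE) auto
      also have "\<dots> = (\<integral>x. G N x * ln (G N x) \<partial>std_gaussian) + 1"
        using F_ln_F_int[OF G1] std_gaussian_measure_space[where 'a='a] unfolding G_def by simp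
      finally show ?thesis using lt[of N] by simp
    qed
    ultimately show False using assms by simp
  qed
  then obtain n where "n \<ge> N" "H - \<epsilon> \<le> (\<integral>x. G n x * ln (G n x) \<partial>std_gaussian)" by blast
  then show ?thesis using N by (intro exI[of _ "real (Suc n)"]) (auto simp: G_def H_def)
qed

section \<open>Deviation of the reciprocal of the truncated density from its mean\<close>

lemma inverse_F_bounds: "1 \<le> M \<Longrightarrow> 0 \<le> 1 / F M x" "1 \<le> M \<Longrightarrow> 1 / F M x \<le> 1 / \<beta>"
  using F_ge[of M x] F_pos[of M x] \<beta>_pos by (auto intro!: divide_left_mono simp: less_imp_le)

lemma inverse_F_int: "1 \<le> M \<Longrightarrow> integrable std_gaussian (\<lambda>x. 1 / F M x)"
  using inverse_F_bounds[of M] by (intro std_gaussian_integrable_bounded[of _ "1 / \<beta>"]) auto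

text \<open>The lower bound is Jensen's inequality in the form of the tangent line
  \<open>1 / y \<ge> 2 - y\<close>, combined with a mass of at most 1. It is the origin of
  \<open>c \<le> 1\<close>.\<close>

lemma inverse_F_integral:
  assumes M: "1 \<le> M"
  shows "1 \<le> (\<integral>x. 1 / F M x \<partial>std_gaussian)" "(\<integral>x. 1 / F M x \<partial>std_gaussian) \<le> 1 / \<beta>"
proof -
  note 1 = std_gaussian_measure_space[where 'a='a]
  have "2 - F M x \<le> 1 / F M x" for x
  proof -
    have "0 \<le> (F M x - 1)\<^sup>2" by simp
    then show ?thesis using F_pos[OF M, of x] by (simp add: field_simps power2_eq_square)
  qed
  then have "(\<integral>x. 2 - F M x \<partial>std_gaussian) \<le> (\<integral>x. 1 / F M x \<partial>std_gaussian)"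
    using F_int[OF M] inverse_F_int[OF M] by (intro integral_mono) auto
  then show "1 \<le> (\<integral>x. 1 / F M x \<partial>std_gaussian)" using F_mass(1)[OF M] F_int[OF M] 1 by simp
  have "(\<integral>x. 1 / F M x \<partial>std_gaussian) \<le> (\<integral>x. 1 / \<beta> \<partial>(std_gaussian :: 'a measure))"
    using inverse_F_bounds[OF M] inverse_F_int[OF M] by (intro integral_mono) auto
  then show "(\<integral>x. 1 / F M x \<partial>std_gaussian) \<le> 1 / \<beta>" using 1 by simp
qed

text \<open>Lines of mass at most \<open>L\<close> and deficit at most \<open>\<eta>\<close>
  contribute at most \<open>\<epsilon>\<close> each. On every other line the deviation is at most
  \<open>1 / \<beta>\<close>, which is below \<open>1 / (\<beta> * L)\<close> times the mass or
  \<open>1 / (\<beta> * \<eta>)\<close> times the deficit. This is Markov's inequality in pointwise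
  form, for each coordinate.\<close>

lemma inverse_F_deviation:
  assumes M: "1 \<le> M" and L: "0 < L" and \<epsilon>: "0 < \<epsilon>" and \<eta>: "0 < \<eta>" and stable: "slice_stable \<beta> L \<epsilon> \<eta>"
  shows "(\<integral>x. \<bar>1 / F M x - (\<integral>x. 1 / F M x \<partial>std_gaussian)\<bar> \<partial>std_gaussian)
    \<le> real DIM('a) * (\<epsilon> + 1 / (\<beta> * L)) + 1 / (\<beta> * \<eta>) * (\<Sum>b\<in>Basis. (\<integral>x. slice_deficit M b x \<partial>std_gaussian))"
proof -
  define Y where "Y x = 1 / F M x" for x
  have [measurable]: "Y \<in> borel_measurable borel" unfolding Y_def[abs_def] by measurable
  have Y: "0 \<le> Y x" "Y x \<le> 1 / \<beta>" for x using inverse_F_bounds[OF M] by (auto simp: Y_def)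
  have Yi: "integrable std_gaussian Y" using inverse_F_int[OF M] by (simp add: Y_def[abs_def])
  note 1 = std_gaussian_measure_space[where 'a='a]
  have step: "(\<integral>x. \<bar>Y x - avg b Y x\<bar> \<partial>std_gaussian)
      \<le> (\<epsilon> + 1 / (\<beta> * L)) + 1 / (\<beta> * \<eta>) * (\<integral>x. slice_deficit M b x \<partial>std_gaussian)" if b: "b \<in> Basis" for b
  proof -
    note Yb = avg_bounds[OF \<open>Y \<in> borel_measurable borel\<close> Y, of b]
    have dev: "\<bar>Y x - avg b Y x\<bar> \<le> 1 / \<beta>" for x using Y[of x] Yb[of x] by linarith
    have di: "integrable std_gaussian (\<lambda>x. \<bar>Y x - avg b Y x\<bar>)"
      using dev by (intro std_gaussian_integrable_bounded[of _ "1 / \<beta>"]) auto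
    have adev: "avg b (\<lambda>y. \<bar>Y y - avg b Y y\<bar>) x \<le> 1 / \<beta>" for x
      by (rule avg_bounds(2)[of _ 0]) (use dev in auto)
    have Fb: "0 \<le> avg b (F M) x" for x
      using avg_bounds(1)[OF F_meas F_ge[OF M] F_le[OF M], of b x] \<beta>_pos by linarith
    have ineq: "AE x in std_gaussian. avg b (\<lambda>y. \<bar>Y y - avg b Y y\<bar>) x
        \<le> \<epsilon> + 1 / (\<beta> * L) * avg b (F M) x + 1 / (\<beta> * \<eta>) * slice_deficit M b x"
      using slice_deficit_bounds[OF M b, of L \<epsilon> \<eta>] unfolding AE_std_gaussian_iff
    proof eventually_elim
      case (elim x)
      have nn: "0 \<le> 1 / (\<beta> * L) * avg b (F M) x" "0 \<le> 1 / (\<beta> * \<eta>) * slice_deficit M b x"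
        using Fb[of x] elim \<beta>_pos L \<eta> by auto
      consider "avg b (F M) x \<le> L" "slice_deficit M b x \<le> \<eta>" | "L < avg b (F M) x" | "\<eta> < slice_deficit M b x"
        by linarith
      then show ?case
      proof cases
        case 1
        then have "avg b (\<lambda>y. \<bar>Y y - avg b Y y\<bar>) x \<le> \<epsilon>" using elim stable by (simp add: Y_def[abs_def])
        then show ?thesis using nn by linarith
      next
        case 2
        then have "1 / \<beta> \<le> 1 / (\<beta> * L) * avg b (F M) x" using \<beta>_pos L by (simp add: field_simps)
        then show ?thesis using nn adev[of x] \<epsilon> by linarith
      next
        case 3
        then have "1 / \<beta> \<le> 1 / (\<beta> * \<eta>) * slice_deficit M b x" using \<beta>_pos \<eta> by (simp add: field_simps)
        then show ?thesis using nn adev[of x] \<epsilon> by linarith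
      qed
    qed
    note ai = avg_integral(2,3)[OF b F_meas F_int[OF M]]
    have "(\<integral>x. \<bar>Y x - avg b Y x\<bar> \<partial>std_gaussian) = (\<integral>x. avg b (\<lambda>y. \<bar>Y y - avg b Y y\<bar>) x \<partial>std_gaussian)"
      by (rule avg_integral(3)[OF b _ di, symmetric]) measurable
    also have "\<dots> \<le> (\<integral>x. \<epsilon> + 1 / (\<beta> * L) * avg b (F M) x + 1 / (\<beta> * \<eta>) * slice_deficit M b x \<partial>std_gaussian)"
      using ai(1) slice_deficit_int(1)[OF M b]
      by (intro integral_mono_AE ineq avg_integral(2)[OF b _ di]) auto
    also have "\<dots> = \<epsilon> + 1 / (\<beta> * L) * (\<integral>x. F M x \<partial>std_gaussian) + 1 / (\<beta> * \<eta>) * (\<integral>x. slice_deficit M b x \<partial>std_gaussian)"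
      using ai slice_deficit_int(1)[OF M b] 1 by simp
    also have "\<dots> \<le> \<epsilon> + 1 / (\<beta> * L) * 1 + 1 / (\<beta> * \<eta>) * (\<integral>x. slice_deficit M b x \<partial>std_gaussian)"
      using F_mass(1)[OF M] \<beta>_pos L \<eta> by (intro add_mono mult_left_mono) auto
    finally show ?thesis by simp
  qed
  have "(\<integral>x. \<bar>Y x - (\<integral>x. Y x \<partial>std_gaussian)\<bar> \<partial>std_gaussian) \<le> (\<Sum>b\<in>Basis. (\<integral>x. \<bar>Y x - avg b Y x\<bar> \<partial>std_gaussian))"
    by (rule avg_deviation[OF _ Y]) measurable
  also have "\<dots> \<le> (\<Sum>b\<in>(Basis::'a set). (\<epsilon> + 1 / (\<beta> * L)) + 1 / (\<beta> * \<eta>) * (\<integral>x. slice_deficit M b x \<partial>std_gaussian))"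
    by (rule sum_mono) (rule step)
  also have "\<dots> = real DIM('a) * (\<epsilon> + 1 / (\<beta> * L)) + 1 / (\<beta> * \<eta>) * (\<Sum>b\<in>Basis. (\<integral>x. slice_deficit M b x \<partial>std_gaussian))"
    by (simp add: sum.distrib sum_distrib_left)
  finally show ?thesis by (simp add: Y_def)
qed

text \<open>The rule for squares supplies one weak gradient of \<open>f\<close>, twice the root
  times \<open>g\<close>, and uniqueness identifies the chosen one with it. The root is nonzero
  almost everywhere, so it cancels in the quotient.\<close>

lemma fisher_information_eq: "fisher_information f = 4 * (\<integral>x. (norm (g x))\<^sup>2 \<partial>std_gaussian)"
proof -
  define u where "u x = sqrt (f x)" for x
  have [measurable]: "u \<in> borel_measurable borel" unfolding u_def[abs_def] by measurable
  have fu: "AE x in lborel. (u x)\<^sup>2 = f x" using f_ge by eventually_elim (use \<alpha> in \<open>simp add: u_def\<close>)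
  have u2: "integrable std_gaussian (\<lambda>x. (u x)\<^sup>2)"
    using fu by (intro integrable_cong_AE_imp[OF f_int(1)]) (auto simp: AE_std_gaussian_iff elim: eventually_mono)
  have ug: "integrable std_gaussian (\<lambda>x. (2 * u x) *\<^sub>R g x)"
  proof (rule Bochner_Integration.integrable_bound)
    show "integrable std_gaussian (\<lambda>x. (u x)\<^sup>2 + (norm (g x))\<^sup>2)" using u2 g_int by simp
    show "AE x in std_gaussian. norm ((2 * u x) *\<^sub>R g x) \<le> norm ((u x)\<^sup>2 + (norm (g x))\<^sup>2)"
    proof (rule AE_I2)
      fix x
      have "norm ((2 * u x) *\<^sub>R g x) = 2 * \<bar>u x\<bar> * norm (g x)" by (simp add: abs_mult)
      also have "\<dots> \<le> \<bar>u x\<bar>\<^sup>2 + (norm (g x))\<^sup>2" by (rule sum_squares_bound)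
      finally show "norm ((2 * u x) *\<^sub>R g x) \<le> norm ((u x)\<^sup>2 + (norm (g x))\<^sup>2)" by simp
    qed
  qed measurable
  have "has_weak_gradient (\<lambda>x. (u x)\<^sup>2) (\<lambda>x. (2 * u x) *\<^sub>R g x)"
    using wg u2 ug unfolding u_def[symmetric]
    by (intro has_weak_gradient_power2 locally_integrable_std_gaussian) auto
  then have wgf: "has_weak_gradient f (\<lambda>x. (2 * u x) *\<^sub>R g x)"
    by (rule has_weak_gradient_cong_AE[OF _ f_meas fu])
  have W: "has_weak_gradient f (weak_gradient f)"
    unfolding weak_gradient_def by (rule someI[of "has_weak_gradient f", OF wgf])
  then have [measurable]: "weak_gradient f \<in> borel_measurable borel"
    by (auto simp: has_weak_gradient_def intro: locally_integrable_measurable)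
  have "AE x in lborel. (norm (weak_gradient f x))\<^sup>2 / f x = 4 * (norm (g x))\<^sup>2"
    using has_weak_gradient_unique[OF W wgf] fu f_ge
  proof eventually_elim
    case (elim x)
    then have "u x \<noteq> 0" using \<alpha> by auto
    then show ?case unfolding elim(1) by (simp add: power_mult_distrib flip: elim(2))
  qed
  then have "fisher_information f = (\<integral>x. 4 * (norm (g x))\<^sup>2 \<partial>std_gaussian)"
    unfolding fisher_information_def by (intro integral_cong_AE) (auto simp: AE_std_gaussian_iff)
  then show ?thesis by simp
qed

text \<open>Only the entropy has to be approximated, as truncation does not increase the Fisher
  information. The parameter \<open>K\<close> allows the level to be forced to infinity along the
  sequence.\<close>

lemma truncation_deficit:
  assumes "0 < \<epsilon>"
  shows "\<exists>M\<ge>max 1 K. (\<Sum>b\<in>Basis. (\<integral>x. slice_deficit M b x \<partial>std_gaussian)) \<le> log_sobolev_deficit f + \<epsilon>"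
proof -
  obtain M where M: "M \<ge> max 1 K"
    "(\<integral>x. f x * ln (f x) \<partial>std_gaussian) - \<epsilon> \<le> (\<integral>x. F M x * ln (F M x) \<partial>std_gaussian)"
    using entropy_approx[OF assms] by blast
  then show ?thesis
    using sum_slice_deficit[of M] unfolding log_sobolev_deficit_def fisher_information_eq relative_entropy_def
    by (intro exI[of _ M]) auto
qed

text \<open>The reason for the shape of \<open>\<kappa>\<close>: on the scale of inverse roots the
  truncation is an additive constant.\<close>

lemma inverse_sqrt_F:
  assumes "1 \<le> M"
  shows "sqrt (1 / F M x) = 1 / v x + 1 / M"
  using assms v_pos[of x] \<kappa>_inverse[of M "v x"] \<kappa>_pos[of M "v x"]
  by (simp add: F_def real_sqrt_divide less_imp_le)

end

section \<open>The sequence of densities\<close>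

lemma log_sobolev_densityI:
  fixes f :: "'a::euclidean_space \<Rightarrow> real"
  assumes \<alpha>: "0 < \<alpha>" and [measurable]: "f \<in> borel_measurable borel" and f: "AE x in lborel. \<alpha> \<le> f x"
    and prob: "prob_space (density std_gaussian (\<lambda>x. ennreal (f x)))" and W: "gaussian_W12 (\<lambda>x. sqrt (f x))"
  shows "\<exists>g. log_sobolev_density f g \<alpha>"
proof -
  obtain g where g: "has_weak_gradient (\<lambda>x. sqrt (f x)) g" "integrable std_gaussian (\<lambda>x. (norm (g x))\<^sup>2)"
    using W by (auto simp: gaussian_W12_def)
  have f0: "AE x in std_gaussian. 0 \<le> f x"
    using f unfolding AE_std_gaussian_iff by eventually_elim (use \<alpha> in linarith)
  have "(\<integral>\<^sup>+x. ennreal (f x) \<partial>std_gaussian) = emeasure (density std_gaussian (\<lambda>x. ennreal (f x))) UNIV"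
    by (subst emeasure_density) auto
  also have "\<dots> = 1" using prob_space.emeasure_space_1[OF prob] by simp
  finally have nn: "(\<integral>\<^sup>+x. ennreal (f x) \<partial>std_gaussian) = 1" .
  then have i: "integrable std_gaussian f" using f0 by (intro integrableI_nonneg) auto
  then have "ennreal (\<integral>x. f x \<partial>std_gaussian) = 1" using nn f0 by (subst (asm) nn_integral_eq_integral) auto
  then have "(\<integral>x. f x \<partial>std_gaussian) = 1" by simp
  then show ?thesis using \<alpha> f i g by (intro exI[of _ g]) (unfold_locales, auto)
qed

theorem corollary1p7:
  fixes f :: "nat \<Rightarrow> real ^ 'n \<Rightarrow> real" and \<alpha> :: real
  assumes "0 < \<alpha>" and "\<alpha> \<le> 1"
    and "\<And>k. f k \<in> borel_measurable borel"
    and "\<And>k. AE x in lborel. \<alpha> \<le> f k x"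
    and "\<And>k. prob_space (density std_gaussian (\<lambda>x. ennreal (f k x)))"
    and "\<And>k. centered (density std_gaussian (\<lambda>x. ennreal (f k x)))"
    and "\<And>k. gaussian_W12 (\<lambda>x. sqrt (f k x))"
    and "(\<lambda>k. log_sobolev_deficit (f k)) \<longlonglongrightarrow> 0"
  shows "\<exists>(r :: nat \<Rightarrow> nat) (c :: real). strict_mono r \<and> c \<in> {\<alpha>..1} \<and>
           (AE x in lborel. (\<lambda>j. f (r j) x) \<longlonglongrightarrow> c)"
proof -
  have "\<exists>g. log_sobolev_density (f k) g \<alpha>" for k
    by (rule log_sobolev_densityI[OF assms(1,3,4,5,7)])
  then obtain g where ld: "\<And>k. log_sobolev_density (f k) (g k) \<alpha>" by metis
  interpret D: log_sobolev_density "f k" "g k" \<alpha> for k by (rule ld)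
  let ?\<beta> = "D.\<beta>"
  note \<beta> = D.\<beta>_pos
  \<comment> \<open>Levels of at least \<open>k\<close> make \<open>1 / M k\<close> tend to 0, and
    the errors \<open>1 / Suc k\<close> keep the truncated deficits vanishing in the limit.\<close>
  have "\<exists>M\<ge>max 1 (real k). (\<Sum>b\<in>Basis. (\<integral>x. D.slice_deficit k M b x \<partial>std_gaussian))
      \<le> log_sobolev_deficit (f k) + 1 / real (Suc k)" for k
    by (rule D.truncation_deficit) simp
  then obtain M where M: "\<And>k. M k \<ge> max 1 (real k)"
    and def: "\<And>k. (\<Sum>b\<in>Basis. (\<integral>x. D.slice_deficit k (M k) b x \<partial>std_gaussian))
      \<le> log_sobolev_deficit (f k) + 1 / real (Suc k)" by metis
  have M1: "1 \<le> M k" for k using M[of k] by simp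
  have Mpos: "0 < M k" for k using M1[of k] by linarith
  define e where "e k = log_sobolev_deficit (f k) + 1 / real (Suc k)" for k
  have e: "e \<longlonglongrightarrow> 0"
    unfolding e_def using tendsto_add[OF assms(8) LIMSEQ_Suc[OF lim_1_over_n]] by simp
  define Y where "Y k x = 1 / D.F k (M k) x" for k x
  define E where "E k = (\<integral>x. Y k x \<partial>std_gaussian)" for k
  have [measurable]: "Y k \<in> borel_measurable borel" for k unfolding Y_def[abs_def] by measurable
  have L1: "(\<lambda>k. \<integral>x. \<bar>Y k x - E k\<bar> \<partial>std_gaussian) \<longlonglongrightarrow> 0"
  proof (rule LIMSEQ_I)
    fix \<epsilon> :: real assume \<epsilon>: "0 < \<epsilon>"
    define n where "n = real DIM(real ^ 'n)"
    have n: "0 < n" unfolding n_def by (simp only: of_nat_0_less_iff DIM_positive)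
    have \<epsilon>n: "0 < \<epsilon> / (4 * n)" using \<epsilon> n by simp
    \<comment> \<open>With this \<open>L\<close> the stability tolerance and the lines of large mass
      contribute a quarter of \<open>\<epsilon>\<close> each over all coordinates; the bound on
      \<open>e k\<close> limits the lines of large deficit to another quarter.\<close>
    define L where "L = 4 * n / (?\<beta> * \<epsilon>)"
    have L: "0 < L" using n \<epsilon> \<beta> by (simp add: L_def)
    obtain \<eta> where \<eta>: "0 < \<eta>" "slice_stable ?\<beta> L (\<epsilon> / (4 * n)) \<eta>"
      using ex_slice_stable[OF \<beta> L \<epsilon>n] by blast
    have "eventually (\<lambda>k. e k < ?\<beta> * \<eta> * \<epsilon> / 4) sequentially"
      using order_tendstoD(2)[OF e, of "?\<beta> * \<eta> * \<epsilon> / 4"] \<eta>(1) \<epsilon> \<beta> by simp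
    then obtain N where N: "\<And>k. k \<ge> N \<Longrightarrow> e k < ?\<beta> * \<eta> * \<epsilon> / 4" by (auto simp: eventually_sequentially)
    have "(\<integral>x. \<bar>Y k x - E k\<bar> \<partial>std_gaussian) < \<epsilon>" if "k \<ge> N" for k
    proof -
      have "(\<integral>x. \<bar>Y k x - E k\<bar> \<partial>std_gaussian) \<le> n * (\<epsilon> / (4 * n) + 1 / (?\<beta> * L))
          + 1 / (?\<beta> * \<eta>) * (\<Sum>b\<in>Basis. (\<integral>x. D.slice_deficit k (M k) b x \<partial>std_gaussian))"
        unfolding Y_def E_def by (rule D.inverse_F_deviation[OF M1 L \<epsilon>n \<eta>, folded n_def])
      also have "\<dots> \<le> n * (\<epsilon> / (4 * n) + 1 / (?\<beta> * L)) + 1 / (?\<beta> * \<eta>) * e k"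
        using def[of k] \<beta> \<eta>(1) by (intro add_left_mono mult_left_mono) (auto simp: e_def)
      also have "\<dots> < n * (\<epsilon> / (4 * n) + 1 / (?\<beta> * L)) + 1 / (?\<beta> * \<eta>) * (?\<beta> * \<eta> * \<epsilon> / 4)"
        using N[OF that] \<beta> \<eta>(1) by (intro add_strict_left_mono mult_strict_left_mono) auto
      also have "\<dots> = \<epsilon> / 4 + \<epsilon> / 4 + \<epsilon> / 4" using \<beta> \<eta>(1) n \<epsilon> by (simp add: L_def field_simps)
      also have "\<dots> < \<epsilon>" using \<epsilon> by simp
      finally show ?thesis .
    qed
    moreover have "0 \<le> (\<integral>x. \<bar>Y k x - E k\<bar> \<partial>std_gaussian)" for k by simp
    ultimately show "\<exists>no. \<forall>k\<ge>no. norm ((\<integral>x. \<bar>Y k x - E k\<bar> \<partial>std_gaussian) - 0) < \<epsilon>"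
      by (intro exI[of _ N]) (simp only: diff_zero real_norm_def abs_of_nonneg, blast)
  qed
  have Eb: "E k \<in> {1..1 / ?\<beta>}" for k
    unfolding E_def Y_def using D.inverse_F_integral[OF M1] by simp
  \<comment> \<open>The means lie in a compact interval. Its lower end 1 makes the limit
    \<open>l\<close> nonzero and yields \<open>1 / l \<le> 1\<close>.\<close>
  obtain l r1 where l: "l \<in> {1..1 / ?\<beta>}" and r1: "strict_mono r1" and El: "(E \<circ> r1) \<longlonglongrightarrow> l"
    using seq_compactE[OF compact_imp_seq_compact[OF compact_Icc], of E 1 "1 / ?\<beta>"] Eb by blast
  have "(\<lambda>j. \<integral>x. norm (Y (r1 j) x - E (r1 j)) \<partial>std_gaussian) \<longlonglongrightarrow> 0"
    using LIMSEQ_subseq_LIMSEQ[OF L1 r1] by (simp add: o_def)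
  moreover have "integrable std_gaussian (\<lambda>x. Y (r1 j) x - E (r1 j))" for j
    using D.inverse_F_int[OF M1] unfolding Y_def by simp
  ultimately obtain r2 where r2: "strict_mono r2"
      and lim: "AE x in std_gaussian. (\<lambda>j. Y (r1 (r2 j)) x - E (r1 (r2 j))) \<longlonglongrightarrow> 0"
    using tendsto_L1_AE_subseq[of std_gaussian "\<lambda>j x. Y (r1 j) x - E (r1 j)"] by blast
  define r where "r j = r1 (r2 j)" for j
  have r: "strict_mono r" using r1 r2 by (auto simp: strict_mono_def r_def)
  have E2: "(\<lambda>j. E (r j)) \<longlonglongrightarrow> l"
    using LIMSEQ_subseq_LIMSEQ[OF El r2] by (simp add: o_def r_def)
  have Mr: "(\<lambda>j. 1 / M (r j)) \<longlonglongrightarrow> 0"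
  proof (rule real_tendsto_sandwich[OF _ _ tendsto_const lim_1_over_n])
    show "\<forall>\<^sub>F j in sequentially. 0 \<le> 1 / M (r j)"
      by (intro always_eventually allI divide_nonneg_nonneg less_imp_le[OF Mpos]) simp
    show "\<forall>\<^sub>F j in sequentially. 1 / M (r j) \<le> 1 / real j"
    proof (rule eventually_sequentiallyI[of 1])
      fix j :: nat assume j: "1 \<le> j"
      have "real j \<le> real (r j)" using seq_suble[OF r, of j] by simp
      also have "\<dots> \<le> M (r j)" using M[of "r j"] by simp
      finally show "1 / M (r j) \<le> 1 / real j" using j by (intro divide_left_mono mult_pos_pos Mpos) auto
    qed
  qed
  have ae: "AE x in lborel. \<forall>k. f k x = (D.v k x)\<^sup>2" by (subst AE_all_countable) (auto intro: D.f_eq)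
  have conv: "AE x in lborel. (\<lambda>j. f (r j) x) \<longlonglongrightarrow> 1 / l"
    using lim[unfolded AE_std_gaussian_iff] ae
  proof eventually_elim
    case (elim x)
    have "(\<lambda>j. (Y (r j) x - E (r j)) + E (r j)) \<longlonglongrightarrow> 0 + l"
      using elim(1) E2 unfolding r_def by (intro tendsto_add)
    then have "(\<lambda>j. sqrt (Y (r j) x)) \<longlonglongrightarrow> sqrt l" by (intro tendsto_real_sqrt) simp
    then have "(\<lambda>j. sqrt (Y (r j) x) - 1 / M (r j)) \<longlonglongrightarrow> sqrt l - 0" using Mr by (intro tendsto_diff)
    \<comment> \<open>Removing the shift \<open>1 / M\<close> undoes the truncation exactly, so
      convergence passes to \<open>v\<close> and hence to \<open>f\<close>.\<close>
    moreover have "sqrt (Y (r j) x) - 1 / M (r j) = 1 / D.v (r j) x" for j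
      unfolding Y_def D.inverse_sqrt_F[OF M1] by simp
    ultimately have "(\<lambda>j. 1 / (1 / D.v (r j) x)\<^sup>2) \<longlonglongrightarrow> 1 / (sqrt l)\<^sup>2"
      using l by (intro tendsto_intros) auto
    then show ?case using elim(2) l by (simp add: power_divide)
  qed
  have "AE x in lborel. \<forall>k. \<alpha> \<le> f k x" by (subst AE_all_countable) (auto intro: assms(4))
  with conv have "AE x in (lborel :: (real ^ 'n) measure). \<alpha> \<le> 1 / l"
  proof eventually_elim
    case (elim x)
    then show ?case by (intro LIMSEQ_le_const[of "\<lambda>j. f (r j) x"]) auto
  qed
  \<comment> \<open>A statement without \<open>x\<close> that holds almost everywhere for a
    probability measure is true.\<close>
  then have "AE x in (std_gaussian :: (real ^ 'n) measure). \<alpha> \<le> 1 / l" by (simp only: AE_std_gaussian_iff)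
  then have "\<alpha> \<le> 1 / l" by (simp only: prob_space.AE_const[OF prob_space_std_gaussian])
  moreover have "1 / l \<le> 1" using l by simp
  ultimately show ?thesis using r conv by (intro exI[of _ r] exI[of _ "1 / l"]) auto
qed

end
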